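(* Let $f(X)\in\mathbb{Z}[X]$ be a polynomial whose derivative has the form $$f'(X)=g(X)^2(aX+b),\qquad g(X)\in\mathbb{Z}[X],\ a,b\in\mathbb{Z},\ a\neq 0.$$ Assume that $\gamma=-b/a$ is not a pre-periodic point of $f$. For $Q>0$ let $P_f(Q)$ denote the number of primes $p\in[Q,2Q]$ such that the reduction $f_p$ of $f$ modulo $p$ is dynamically irreducible over $\mathbb{F}_p$. Then $$P_f(Q)\leqslant \frac{(\log\log\log\log Q)^{2+o(1)}}{\log\log\log Q}\cdot\frac{Q}{\log Q},\qquad \text{as } Q\to\infty.$$
   Context: For a polynomial $f$ over a field $\mathbb{K}$, the iterates are $f^{(0)}(X)=X$ and $f^{(n)}(X)=f(f^{(n-1)}(X))$ for $n\ge 1$. A polynomial $f\in\mathbb{K}[X]$ is called dynamically irreducible over $\mathbb{K}$ if all iterates $f^{(n)}$, $n=1,2,\ldots$, are irreducible over $\mathbb{K}$. For a prime $p$, $f_p\in\mathbb{F}_p[X]$ denotes the reduction of $f$ modulo $p$. A point $\gamma$ is pre-periodic for $f$ if its forward orbit $\{f^{(n)}(\gamma): n\ge 0\}$ is finite. The $o(1)$ term may depend on $f$. *)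

theory Defs
  imports
    "HOL-Algebra.Polynomial_Divisibility"
    "HOL-Number_Theory.Residues"
    "HOL-Computational_Algebra.Polynomial"
    "HOL-Library.Landau_Symbols"
begin

text \<open>
  Polynomials over the integers and the rationals are those of
  \<^theory>\<open>HOL-Computational_Algebra.Polynomial\<close>. The finite field of order \<open>p\<close> is
  \<^term>\<open>residue_ring (int p)\<close>, since a type cannot depend on \<open>p\<close>; polynomials over it are those of
  \<^theory>\<open>HOL-Algebra.Polynomials\<close>, which are coefficient lists with the leading coefficient first.
\<close>

definition poly_iterate :: "'a::comm_semiring_1 poly \<Rightarrow> nat \<Rightarrow> 'a poly" where
  "poly_iterate f n = ((\<lambda>h. pcompose f h) ^^ n) [:0, 1:]"

definition preperiodic :: "'a::comm_semiring_1 poly \<Rightarrow> 'a \<Rightarrow> bool" where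
  "preperiodic f x \<longleftrightarrow> finite {poly (poly_iterate f n) x |n. True}"

text \<open>The composition \<open>f(g)\<close> evaluates \<open>f\<close>, read as a polynomial over the ring \<open>R[X]\<close>, at \<open>g\<close>.\<close>

definition list_pcompose :: "('a, 'b) ring_scheme \<Rightarrow> 'a list \<Rightarrow> 'a list \<Rightarrow> 'a list" where
  "list_pcompose R f g = ring.eval (poly_ring R) (map (ring.poly_of_const R) f) g"

definition list_poly_iterate :: "('a, 'b) ring_scheme \<Rightarrow> 'a list \<Rightarrow> nat \<Rightarrow> 'a list" where
  "list_poly_iterate R f n = ((\<lambda>h. list_pcompose R f h) ^^ n) (var R)"

definition dynamically_irreducible :: "('a, 'b) ring_scheme \<Rightarrow> 'a list \<Rightarrow> bool" where
  "dynamically_irreducible R f \<longleftrightarrow>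
     (\<forall>n\<ge>1. pirreducible\<^bsub>R\<^esub> (carrier R) (list_poly_iterate R f n))"

text \<open>
  Normalisation drops the leading coefficients divisible by the modulus, so the degree of the
  reduction may be smaller than that of \<open>f\<close>.
\<close>

definition reduce_poly :: "int \<Rightarrow> int poly \<Rightarrow> int list" where
  "reduce_poly m f = ring.normalize (residue_ring m) (map (\<lambda>c. c mod m) (rev (coeffs f)))"

definition dyn_irred_prime_count :: "int poly \<Rightarrow> real \<Rightarrow> nat" where
  "dyn_irred_prime_count f Q =
     card {p::nat. Factorial_Ring.prime p \<and> real p \<in> {Q..2 * Q} \<and>
       dynamically_irreducible (residue_ring (int p)) (reduce_poly (int p) f)}"

end

theory Submission
  imports
    Defs
    "HOL-Algebra.Algebraic_Closure_Type"
    "Berlekamp_Zassenhaus.Finite_Field"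
    "HOL-Real_Asymp.Real_Asymp"
    "HOL-Analysis.Harmonic_Numbers"
    "HOL-Computational_Algebra.Squarefree"
    "HOL-Number_Theory.Number_Theory"
begin

text \<open>
  Write \<open>u\<^sub>n\<close> for the orbit of \<open>\<gamma>\<close>. If \<open>f\<^sub>p\<close> is dynamically irreducible, then Frobenius permutes the roots of the
  \<open>n\<close>-th iterate in a single cycle of even length, so it negates the square root
  \<open>\<Prod>\<^bsub>i<j\<^esub> (\<beta>\<^sub>i - \<beta>\<^sub>j)\<close> of its discriminant, which is therefore not a square in \<open>F\<^sub>p\<close>. As the
  derivative of \<open>f\<close> is a square times \<open>aX + b\<close>, this discriminant is a square times the leading
  coefficient times \<open>u\<^sub>n\<close>, so the Legendre symbols of all \<open>u\<^sub>n\<close> with \<open>n \<ge> 2\<close> are equal.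

  A second moment of the character sum over a window of indices \<open>n\<close>, with Selberg's weights in place
  of the primes, bounds the number of such \<open>p\<close> once few pairs \<open>u\<^sub>i u\<^sub>j\<close> are squares. To see this, let
  \<open>S\<close> be the infinite place together with the primes dividing \<open>2ac\<close>, where \<open>c\<close> is the leading coefficient of
  \<open>f\<close>. At each place of \<open>S\<close> the orbit is bounded or escapes doubly exponentially. If
  more than \<open>2\<^sup>r\<close> indices in a window lie in one square class, where \<open>r\<close> is the number of
  escaping places, then two of them share a pattern of signs and give an \<open>S\<close>-integral point on
  \<open>y\<^sup>2 = f(x) f\<^sup>(\<^sup>k\<^sup>+\<^sup>1\<^sup>)(x)\<close>, up to a constant, for which \<open>y\<close> is close to the polynomial part \<open>H(x)\<close> of the square
  root at all escaping places simultaneously. By the product formula \<open>y = H(x)\<close>, which for \<open>x\<close> large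
  makes the right-hand side the square of a polynomial; modulo a \<open>p\<close> with \<open>f\<^sub>p\<close> dynamically irreducible
  this is impossible.
\<close>

section \<open>Iterates modulo a prime\<close>

text \<open>In the second moment only pairs with square product cost a main term, of order Q / log
  Q. If a square class meets a window of L indices in O(1) of them, the count is O(Q / (L log Q));
  so the class bound must be uniform in L. It rests on comparing two growth rates, with d the degree
  of f: the Runge constant for two indices of the window is exponential in (d+1)^(2L), while the
  integral point exceeds 2^(2^m), where m is the distance of the window from the start of the
  escape. Hence L is a small fraction of the starting index of the window.

  The curve is taken at the predecessor of the smaller index, because X times an iterate has odd
  degree and so no square root at infinity. The pigeonhole on signs is needed because y may be near
  H(x) at one place and near -H(x) at another; then neither y - H(x) nor y + H(x) is small at all
  escaping places.

  The odd parts of the orbit integers are kept below Q^(1/8), so cancellation over full periods is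
  enough for the character sums. If no prime beyond a fixed bound is dynamically irreducible, the
  count vanishes for large Q; otherwise one such prime makes all Runge curves
  non-degenerate.\<close>

lemma poly_iterate_0 [simp]: "poly_iterate f 0 = [:0, 1:]"
  by (simp add: poly_iterate_def)

lemma poly_iterate_Suc [simp]: "poly_iterate f (Suc n) = f \<circ>\<^sub>p poly_iterate f n"
  by (simp add: poly_iterate_def)

context residues_prime
begin

interpretation field R
  by (rule is_field)

lemma coeff_reduce_poly: "coeff (reduce_poly (int p) A) i = poly.coeff A i mod int p"
proof -
  define l where "l = map (\<lambda>c. c mod int p) (rev (coeffs A))"
  have "coeff (reduce_poly (int p) A) = coeff l"
    unfolding reduce_poly_def l_def R_def[symmetric] by (rule normalize_coeff[symmetric])
  moreover have "coeff l i = poly.coeff A i mod int p"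
  proof (cases "i < length l")
    case True
    then have A: "A \<noteq> 0" by (auto simp: l_def)
    have "coeff l i = l ! (length l - 1 - i)" by (rule coeff_nth[OF True])
    also have "\<dots> = (coeffs A ! i) mod int p"
      using True by (simp add: l_def) (subst rev_nth, auto)
    also have "coeffs A ! i = poly.coeff A i"
      using True A by (simp add: l_def coeffs_nth length_coeffs_degree)
    finally show ?thesis .
  next
    case False
    then have "poly.coeff A i = 0"
      by (cases "A = 0") (auto simp: l_def length_coeffs_degree intro: coeff_eq_0)
    moreover have "coeff l i = \<zero>" using coeff_length False by simp
    ultimately show ?thesis by (simp add: res_zero_eq)
  qed
  ultimately show ?thesis by simp
qed

lemma reduce_poly_set: "set (reduce_poly (int p) A) \<subseteq> carrier R"
proof -
  have "set (normalize (map (\<lambda>c. c mod int p) (rev (coeffs A)))) \<subseteq> carrier R"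
    by (rule normalize_in_carrier) auto
  then show ?thesis unfolding reduce_poly_def R_def[symmetric] .
qed

lemma reduce_poly_polynomial: "polynomial\<^bsub>R\<^esub> (carrier R) (reduce_poly (int p) A)"
  unfolding reduce_poly_def R_def[symmetric] by (rule normalize_gives_polynomial) auto

lemma reduce_poly_carrier: "reduce_poly (int p) A \<in> carrier (poly_ring R)"
  using reduce_poly_polynomial by (simp add: univ_poly_carrier[symmetric])

lemma reduce_poly_eqI:
  assumes "l \<in> carrier (poly_ring R)" "\<And>i. coeff l i = poly.coeff A i mod int p"
  shows "reduce_poly (int p) A = l"
  using assms coeff_iff_polynomial_cond[OF reduce_poly_polynomial, of l A]
  by (auto simp: univ_poly_carrier[symmetric] coeff_reduce_poly)

lemma PR_domain: "domain (poly_ring R)"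
  by (rule univ_poly_is_domain[OF carrier_is_subring])

lemma PR_ring: "ring (poly_ring R)"
  using PR_domain by (simp add: domain_def cring_def)

lemma reduce_poly_add:
  "reduce_poly (int p) (A + B) = reduce_poly (int p) A \<oplus>\<^bsub>poly_ring R\<^esub> reduce_poly (int p) B"
proof (rule reduce_poly_eqI)
  interpret PR: ring "poly_ring R" by (rule PR_ring)
  show "reduce_poly (int p) A \<oplus>\<^bsub>poly_ring R\<^esub> reduce_poly (int p) B \<in> carrier (poly_ring R)"
    by (intro PR.add.m_closed reduce_poly_carrier)
qed (simp del: poly_add.simps add: univ_poly_add poly_add_coeff[OF reduce_poly_set reduce_poly_set]
       coeff_reduce_poly res_add_eq mod_simps)

lemma reduce_poly_mult:
  "reduce_poly (int p) (A * B) = reduce_poly (int p) A \<otimes>\<^bsub>poly_ring R\<^esub> reduce_poly (int p) B"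
proof (rule reduce_poly_eqI)
  interpret PR: ring "poly_ring R" by (rule PR_ring)
  show "reduce_poly (int p) A \<otimes>\<^bsub>poly_ring R\<^esub> reduce_poly (int p) B \<in> carrier (poly_ring R)"
    by (intro PR.m_closed reduce_poly_carrier)
  fix i
  have "coeff (reduce_poly (int p) A \<otimes>\<^bsub>poly_ring R\<^esub> reduce_poly (int p) B) i =
     (\<Oplus>k\<in>{..i}. (poly.coeff A k mod int p) \<otimes> (poly.coeff B (i - k) mod int p))"
    by (simp del: poly_mult.simps add: univ_poly_mult poly_mult_coeff[OF reduce_poly_set reduce_poly_set]
       coeff_reduce_poly)
  also have "\<dots> = (\<Oplus>k\<in>{..i}. (poly.coeff A k * poly.coeff B (i - k)) mod int p)"
    by (simp add: mult_cong)
  also have "\<dots> = poly.coeff (A * B) i mod int p"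
    by (simp add: sum_cong coeff_mult)
  finally show "coeff (reduce_poly (int p) A \<otimes>\<^bsub>poly_ring R\<^esub> reduce_poly (int p) B) i =
    poly.coeff (A * B) i mod int p" .
qed

lemma poly_of_const_mod: "poly_of_const (c mod int p) = reduce_poly (int p) [:c:]"
proof (rule sym, rule reduce_poly_eqI)
  show "poly_of_const (c mod int p) \<in> carrier (poly_ring R)"
    unfolding poly_of_const_def univ_poly_carrier[symmetric]
    by (rule normalize_gives_polynomial) auto
  show "coeff (poly_of_const (c mod int p)) i = poly.coeff [:c:] i mod int p" for i
    unfolding poly_of_const_def normalize_coeff[symmetric]
    by (cases i) (auto simp: res_zero_eq)
qed

lemma poly_of_const_closed: "c \<in> carrier R \<Longrightarrow> poly_of_const c \<in> carrier (poly_ring R)"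
  unfolding poly_of_const_def univ_poly_carrier[symmetric]
  by (rule normalize_gives_polynomial) auto

text \<open>Leading zeros contribute nothing to Horner evaluation. Compositions may therefore be
  evaluated on the list before normalisation, which \<open>pCons\<close> simply extends by one
  entry.\<close>

lemma eval_map_const_normalize:
  assumes "set l \<subseteq> carrier R" "x \<in> carrier (poly_ring R)"
  shows "ring.eval (poly_ring R) (map poly_of_const (normalize l)) x =
    ring.eval (poly_ring R) (map poly_of_const l) x"
  using assms(1)
proof (induction l)
  case Nil
  then show ?case by simp
next
  case (Cons c l)
  interpret PR: domain "poly_ring R" by (rule PR_domain)
  have "set (map poly_of_const l) \<subseteq> carrier (poly_ring R)"
    using Cons.prems poly_of_const_closed by auto
  then have *: "PR.eval (map poly_of_const l) x \<in> carrier (poly_ring R)"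
    by (rule PR.eval_in_carrier[OF _ assms(2)])
  have 0: "poly_of_const \<zero> = \<zero>\<^bsub>poly_ring R\<^esub>"
    by (simp add: poly_of_const_def univ_poly_zero)
  show ?case using Cons * assms(2) by (simp add: 0)
qed

lemma reduce_poly_pcompose:
  "reduce_poly (int p) (A \<circ>\<^sub>p B) = list_pcompose R (reduce_poly (int p) A) (reduce_poly (int p) B)"
proof (induction A rule: pCons_induct)
  case 0
  show ?case
    by (simp add: list_pcompose_def reduce_poly_def)
      (simp add: R_def[symmetric] univ_poly_zero ring.eval.simps[OF PR_ring])
next
  case (pCons c A)
  interpret PR: domain "poly_ring R" by (rule PR_domain)
  define x where "x = reduce_poly (int p) B"
  have x: "x \<in> carrier (poly_ring R)" unfolding x_def by (rule reduce_poly_carrier)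
  define l where "l = map (\<lambda>c. c mod int p) (rev (coeffs A))"
  have l: "set l \<subseteq> carrier R" by (auto simp: l_def)
  have E: "list_pcompose R (reduce_poly (int p) A) x = PR.eval (map poly_of_const l) x"
    unfolding list_pcompose_def reduce_poly_def R_def[symmetric] l_def[symmetric]
    by (rule eval_map_const_normalize[OF l x])
  have E': "PR.eval (map poly_of_const l) x = reduce_poly (int p) (A \<circ>\<^sub>p B)"
    using E pCons.IH by (simp add: x_def)
  have l': "map (\<lambda>c. c mod int p) (rev (coeffs (pCons c A))) = l @ [c mod int p]"
    using pCons.hyps by (auto simp: l_def cCons_def)
  have "list_pcompose R (reduce_poly (int p) (pCons c A)) x =
      PR.eval (map poly_of_const (l @ [c mod int p])) x"
    unfolding list_pcompose_def reduce_poly_def R_def[symmetric] l'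
    by (rule eval_map_const_normalize[OF _ x]) (use l in auto)
  also have "\<dots> = PR.eval (map poly_of_const l) x \<otimes>\<^bsub>poly_ring R\<^esub> x \<oplus>\<^bsub>poly_ring R\<^esub> poly_of_const (c mod int p)"
    unfolding map_append list.map
    by (rule PR.eval_append_aux)
      (use l x in \<open>auto intro!: poly_of_const_closed\<close>)
  also have "\<dots> = reduce_poly (int p) ((A \<circ>\<^sub>p B) * B + [:c:])"
    by (simp add: E'[unfolded x_def] x_def poly_of_const_mod reduce_poly_add reduce_poly_mult)
  also have "(A \<circ>\<^sub>p B) * B + [:c:] = pCons c A \<circ>\<^sub>p B"
    by (simp add: pcompose_pCons algebra_simps)
  finally show ?case by (simp add: x_def)
qed

lemma list_poly_iterate_reduce_poly:
  "list_poly_iterate R (reduce_poly (int p) f) n = reduce_poly (int p) (poly_iterate f n)"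
proof (induction n)
  case 0
  have "reduce_poly (int p) [:0, 1:] = var R"
  proof (rule reduce_poly_eqI)
    show "var R \<in> carrier (poly_ring R)" by (rule var_closed(1)[OF carrier_is_subring])
    show "coeff (var R) i = poly.coeff [:0, 1:] i mod int p" for i
      using one_cong zero_cong by (auto simp: var_def coeff_pCons res_zero_eq res_one_eq split: nat.splits)
  qed
  then show ?case by (simp add: list_poly_iterate_def)
next
  case (Suc n)
  then show ?case by (simp add: list_poly_iterate_def reduce_poly_pcompose)
qed

end

section \<open>Irreducibility over the type \<open>'p mod_ring\<close>\<close>

lemma of_int_mod_ring_eq_0_iff:
  "(of_int c :: 'p::prime_card mod_ring) = 0 \<longleftrightarrow> int CARD('p) dvd c"
  by (simp add: of_int_eq_0_iff_char_dvd semiring_char_mod_ring)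

text \<open>\<open>reduce_poly\<close> and \<open>of_int_poly\<close> map \<open>int poly\<close>
  onto two models of the polynomials over the field with p elements and identify the same integer
  polynomials. A factorisation in the typed model is lifted to integer coefficients and read off in
  the other model.\<close>

lemma irreducible_of_int_poly:
  fixes F :: "int poly"
  assumes irr: "ring_irreducible\<^bsub>poly_ring (residue_ring (int CARD('p::prime_card)))\<^esub> (reduce_poly (int CARD('p)) F)"
  shows "irreducible (of_int_poly F :: 'p mod_ring poly)"
proof -
  define R where "R = residue_ring (int CARD('p))"
  interpret residues_prime "CARD('p)" R
    unfolding R_def by unfold_locales (simp_all add: prime_card)
  interpret field R by (rule is_field)
  let ?red = "reduce_poly (int CARD('p))"
  let ?h = "of_int_poly :: int poly \<Rightarrow> 'p mod_ring poly"
  have irr': "pirreducible\<^bsub>R\<^esub> (carrier R) (?red F)" using irr by (simp add: R_def)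
  note E = pirreducibleE[OF carrier_is_subring reduce_poly_carrier irr']
  \<comment> \<open>In both models the units are the non-zero constants.\<close>
  have units: "?red A \<in> Units (poly_ring R) \<longleftrightarrow> ?h A dvd 1" for A
  proof -
    have "?red A \<in> Units (poly_ring R) \<longleftrightarrow> ?h A \<noteq> 0 \<and> degree (?h A) = 0"
    proof
      assume "?red A \<in> Units (poly_ring R)"
      then obtain k where k: "?red A = [k]" "k \<noteq> 0" by (auto simp: univ_poly_carrier_units res_zero_eq)
      have c: "poly.coeff A i mod int CARD('p) = (if i = 0 then k else 0)" for i
        using coeff_reduce_poly[of A i] k by (auto simp: res_zero_eq)
      have "poly.coeff (?h A) i = 0" if "i > 0" for i
        using c[of i] that by (simp add: of_int_mod_ring_eq_0_iff mod_eq_0_iff_dvd)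
      moreover have "poly.coeff (?h A) 0 \<noteq> 0"
        using c[of 0] k by (auto simp: of_int_mod_ring_eq_0_iff mod_eq_0_iff_dvd res_zero_eq)
      ultimately show "?h A \<noteq> 0 \<and> degree (?h A) = 0"
        by (metis degree_0 leading_coeff_0_iff coeff_0 gr0I)
    next
      assume h: "?h A \<noteq> 0 \<and> degree (?h A) = 0"
      let ?k = "poly.coeff A 0 mod int CARD('p)"
      have c0: "poly.coeff (?h A) 0 \<noteq> 0" using h by (metis leading_coeff_0_iff)
      have "?red A = [?k]"
      proof (rule reduce_poly_eqI)
        have "?k \<noteq> 0" using c0 by (simp add: of_int_mod_ring_eq_0_iff mod_eq_0_iff_dvd)
        then show "[?k] \<in> carrier (poly_ring R)"
          by (auto simp: univ_poly_carrier[symmetric] polynomial_def res_zero_eq)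
        fix i
        have "poly.coeff (?h A) i = 0" if "i > 0" using h that by (intro coeff_eq_0) simp
        then show "coeff [?k] i = poly.coeff A i mod int CARD('p)"
          by (auto simp: of_int_mod_ring_eq_0_iff mod_eq_0_iff_dvd res_zero_eq)
      qed
      moreover have "?k \<noteq> 0" using c0 by (simp add: of_int_mod_ring_eq_0_iff mod_eq_0_iff_dvd res_zero_eq)
      ultimately show "?red A \<in> Units (poly_ring R)"
        by (auto simp: univ_poly_carrier_units res_zero_eq)
    qed
    also have "\<dots> \<longleftrightarrow> ?h A dvd 1"
      using is_unit_iff_degree by (cases "?h A = 0") auto
    finally show ?thesis .
  qed
  show ?thesis
  proof (rule irreducibleI)
    show "?h F \<noteq> 0"
    proof
      assume "?h F = 0"
      then have "poly.coeff F i mod int CARD('p) = 0" for i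
        by (metis coeff_0 coeff_map_poly of_int_0 of_int_mod_ring_eq_0_iff mod_eq_0_iff_dvd)
      then have "?red F = []"
        by (intro reduce_poly_eqI) (auto simp: univ_poly_carrier[symmetric] polynomial_def res_zero_eq)
      then show False using E(1) by simp
    qed
    show "\<not> ?h F dvd 1" using E(2) units by simp
    fix A B :: "'p mod_ring poly"
    assume AB: "?h F = A * B"
    define A' where "A' = map_poly to_int_mod_ring A"
    define B' where "B' = map_poly to_int_mod_ring B"
    have [simp]: "?h A' = A" "?h B' = B"
      by (auto simp: A'_def B'_def poly_eq_iff coeff_map_poly of_int_of_int_mod_ring)
    have "?h F = ?h (A' * B')" using AB by (simp add: of_int_poly_hom.hom_mult)
    then have "poly.coeff F i mod int CARD('p) = poly.coeff (A' * B') i mod int CARD('p)" for i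
    proof -
      assume "?h F = ?h (A' * B')"
      then have "of_int (poly.coeff F i - poly.coeff (A' * B') i) = (0 :: 'p mod_ring)"
        by (metis (no_types) coeff_map_poly of_int_0 of_int_diff right_minus_eq)
      then have "int CARD('p) dvd poly.coeff F i - poly.coeff (A' * B') i"
        by (simp only: of_int_mod_ring_eq_0_iff)
      then show ?thesis by (simp add: mod_eq_dvd_iff)
    qed
    then have "?red F = ?red (A' * B')"
      by (intro reduce_poly_eqI reduce_poly_carrier) (simp add: coeff_reduce_poly)
    then have "?red F = ?red A' \<otimes>\<^bsub>poly_ring R\<^esub> ?red B'" by (simp add: reduce_poly_mult)
    from E(3)[OF reduce_poly_carrier reduce_poly_carrier this]
    show "A dvd 1 \<or> B dvd 1" by (simp add: units)
  qed
qed

section \<open>The Frobenius action on roots of iterates\<close>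

lemma of_int_power_CHAR:
  fixes p :: nat
  assumes "prime p" "CHAR('k::field) = p"
  shows "(of_int c :: 'k) ^ p = of_int c"
proof -
  have n: "(of_nat m :: 'k) ^ p = of_nat m" for m
  proof (induction m)
    case 0
    then show ?case using assms prime_gt_0_nat by auto
  next
    case (Suc m)
    have "(1 + of_nat m :: 'k) ^ p = 1 ^ p + of_nat m ^ p"
      by (rule freshmans_dream) (use assms in auto)
    then show ?case using Suc by simp
  qed
  have "(of_int c :: 'k) = of_int (c mod int p) + of_int (int p) * of_int (c div int p)"
    by (metis add.commute div_mult_mod_eq mult.commute of_int_add of_int_mult)
  also have "(of_int (int p) :: 'k) = 0" using assms of_nat_CHAR by auto
  also have "(of_int (c mod int p) :: 'k) = of_nat (nat (c mod int p))"
    using assms prime_gt_0_nat by (simp add: of_nat_nat)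
  finally show ?thesis using n by simp
qed

lemma diff_power_CHAR:
  fixes x y :: "'k::field"
  assumes "prime p" "CHAR('k) = p"
  shows "(x - y) ^ p = x ^ p - y ^ p"
proof -
  have "((x - y) + y) ^ p = (x - y) ^ p + y ^ p"
    by (rule freshmans_dream) (use assms in auto)
  then show ?thesis by simp
qed

text \<open>The images of \<open>0, ..., p - 1\<close> already are p roots of
  \<open>X^p - X\<close>, hence all of them. Being fixed by Frobenius thus means lying in the prime
  field.\<close>

lemma power_CHAR_fixed:
  fixes x :: "'k::field"
  assumes p: "prime p" "CHAR('k) = p" and x: "x ^ p = x"
  obtains c :: int where "x = of_int c"
proof -
  define P :: "'k poly" where "P = Polynomial.monom 1 p - Polynomial.monom 1 1"
  have p1: "p > 1" using p prime_gt_1_nat by auto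
  have cP: "poly.coeff P p = 1" using p1 by (simp add: P_def)
  then have P0: "P \<noteq> 0" by auto
  have "degree P \<le> p"
    unfolding P_def by (intro degree_diff_le) (use p1 in \<open>auto simp: degree_monom_eq\<close>)
  then have c: "card {z. poly P z = 0} \<le> p" using card_poly_roots_bound[OF P0] by linarith
  have fin: "finite {z. poly P z = 0}" using poly_roots_finite[OF P0] .
  let ?I = "(\<lambda>c. of_int c :: 'k) ` {0..<int p}"
  have sub: "?I \<subseteq> {z. poly P z = 0}"
    using of_int_power_CHAR[OF p] by (auto simp: P_def poly_monom)
  have "inj_on (\<lambda>c. of_int c :: 'k) {0..<int p}"
  proof (rule inj_onI)
    fix c d assume cd: "c \<in> {0..<int p}" "d \<in> {0..<int p}" "(of_int c :: 'k) = of_int d"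
    then have "(of_int (c - d) :: 'k) = 0" by simp
    then have "int p dvd c - d" using of_int_eq_0_iff_char_dvd p by metis
    then have "c mod int p = d mod int p" by (simp add: mod_eq_dvd_iff)
    then show "c = d" using cd by simp
  qed
  then have "card ?I = p" by (simp add: card_image)
  then have "?I = {z. poly P z = 0}" using card_seteq[OF fin sub] c by simp
  moreover have "x \<in> {z. poly P z = 0}" using x by (simp add: P_def poly_monom)
  ultimately show ?thesis using that by auto
qed

lemma poly_of_int_poly_power_CHAR:
  fixes x :: "'k::field"
  assumes "prime p" "CHAR('k) = p"
  shows "poly (of_int_poly A) x ^ (p ^ i) = poly (of_int_poly A) (x ^ (p ^ i))"
proof (induction i)
  case 0
  show ?case by simp
next
  case (Suc i)
  have *: "poly (of_int_poly A) y ^ p = poly (of_int_poly A) (y ^ p)" for y :: 'k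
  proof (induction A)
    case 0
    then show ?case using assms prime_gt_0_nat by auto
  next
    case (pCons c A)
    have "(of_int c + y * poly (of_int_poly A) y) ^ p = of_int c ^ p + (y * poly (of_int_poly A) y) ^ p"
      by (rule freshmans_dream) (use assms in auto)
    then show ?case using pCons of_int_power_CHAR[OF assms]
      by (simp add: map_poly_pCons power_mult_distrib)
  qed
  show ?case using Suc * by (simp add: power_mult mult.commute[of p])
qed

text \<open>Says that \<open>\<beta>\<close> has degree at least \<open>D\<close> over the prime
  field. The prime field is not a type of its own, so its polynomials are represented by integer
  polynomials, those that reduce to 0 standing for the zero polynomial.\<close>

definition min_root :: "'k::field \<Rightarrow> nat \<Rightarrow> bool" where
  "min_root \<beta> D \<longleftrightarrow> (\<forall>A::int poly. poly (of_int_poly A) \<beta> = 0 \<longrightarrow>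
     of_int_poly A = (0 :: 'k poly) \<or> D \<le> degree (of_int_poly A :: 'k poly))"

text \<open>Makes a product over a full Frobenius cycle of conjugates invariant under Frobenius,
  which only rotates the factors.\<close>

lemma prod_shift_cyclic:
  fixes c :: "nat \<Rightarrow> 'a::comm_monoid_mult"
  assumes "c m = c 0"
  shows "(\<Prod>j<m. c (Suc j)) = (\<Prod>j<m. c j)"
proof (cases m)
  case (Suc m')
  then show ?thesis
    using assms prod.lessThan_Suc_shift[of c m'] by (simp add: mult.commute)
qed simp

text \<open>The product over the Frobenius orbit of \<open>\<beta>\<close> is fixed by Frobenius, so
  it is a polynomial over the prime field and \<open>min_root\<close> makes the orbit at least
  \<open>D\<close> long. The orbit consists of roots of \<open>F\<close>, so it is at most
  \<open>D\<close> long.\<close>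

lemma frobenius_conjugates:
  fixes \<beta> :: "'k::field" and F :: "int poly"
  assumes p: "prime p" "CHAR('k) = p"
    and D: "D = degree (of_int_poly F :: 'k poly)" "D > 0"
    and root: "poly (of_int_poly F) \<beta> = 0" and min: "min_root \<beta> D"
  shows "\<beta> ^ (p ^ D) = \<beta>" "inj_on (\<lambda>i. \<beta> ^ (p ^ i)) {..<D}"
    "of_int_poly F = smult (lead_coeff (of_int_poly F)) (\<Prod>i<D. [:- (\<beta> ^ (p ^ i)), 1:])"
proof -
  define b where "b i = \<beta> ^ (p ^ i)" for i
  define F' where "F' = (of_int_poly F :: 'k poly)"
  have F'0: "F' \<noteq> 0" using D by (auto simp: F'_def)
  have bS: "b (Suc i) = b i ^ p" for i by (simp add: b_def power_mult mult.commute[of p])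
  have b0: "b 0 = \<beta>" by (simp add: b_def)
  have p0: "p > 0" using p prime_gt_0_nat by auto
  have inj: "x = y" if "x ^ p = y ^ p" for x y :: 'k
    using diff_power_CHAR[OF p, of x y] that p0 by simp
  \<comment> \<open>Frobenius is injective, so a coincidence in the orbit can be moved back to its
    start: the orbit is purely periodic.\<close>
  have shift: "b i = b (i + k) \<Longrightarrow> b 0 = b k" for i k
  proof (induction i)
    case (Suc i)
    then show ?case using inj[of "b i" "b (i + k)"] by (simp add: bS)
  qed simp
  have rt: "poly F' (b i) = 0" for i
    using poly_of_int_poly_power_CHAR[OF p, of F \<beta> i] root p0
    by (simp add: F'_def b_def power_0_left)
  have finr: "finite {x. poly F' x = 0}" using poly_roots_finite[OF F'0] .
  have "\<not> inj b"
    using finite_subset[of "range b", OF _ finr] rt finite_imageD[of b UNIV] by auto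
  then obtain i j where ij: "i \<noteq> j" "b i = b j" by (auto simp: inj_def)
  have ex: "\<exists>r. r > 0 \<and> b r = b 0"
  proof (cases "i < j")
    case True
    then show ?thesis using shift[of i "j - i"] ij by (intro exI[of _ "j - i"]) auto
  next
    case False
    then show ?thesis using shift[of j "i - j"] ij by (intro exI[of _ "i - j"]) auto
  qed
  define r where "r = (LEAST r. r > 0 \<and> b r = b 0)"
  have r: "r > 0" "b r = b 0" using LeastI_ex[OF ex] by (simp_all add: r_def)
  have rmin: "r \<le> s" if "s > 0" "b s = b 0" for s
    unfolding r_def by (rule Least_le) (use that in auto)
  have injr: "inj_on b {..<r}"
  proof -
    have "False" if "i < j" "j < r" "b i = b j" for i j
      using shift[of i "j - i"] rmin[of "j - i"] that by auto
    then show ?thesis by (metis inj_onI lessThan_iff nat_neq_iff)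
  qed
  define G where "G = (\<Prod>i<r. [:- b i, 1:])"
  interpret fr: map_poly_comm_ring_hom "\<lambda>x::'k. x ^ p"
    by unfold_locales
      (use p p0 in \<open>auto simp: power_mult_distrib intro: freshmans_dream\<close>)
  have degG: "degree G = r"
    unfolding G_def by (subst degree_prod_eq_sum_degree) auto
  have lcG: "lead_coeff G = 1" unfolding G_def by (simp add: lead_coeff_prod)
  have frG: "map_poly (\<lambda>x. x ^ p) G = G"
  proof -
    have minus: "(- x) ^ p = - (x ^ p)" for x :: 'k
      using diff_power_CHAR[OF p, of 0 x] p0 by simp
    have "map_poly (\<lambda>x. x ^ p) G = (\<Prod>i<r. map_poly (\<lambda>x. x ^ p) [:- b i, 1:])"
      unfolding G_def by (rule fr.hom_prod)
    also have "\<dots> = (\<Prod>i<r. [:- b (Suc i), 1:])"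
      using p0 by (intro prod.cong) (auto simp: map_poly_pCons bS minus)
    also have "\<dots> = G"
      unfolding G_def by (rule prod_shift_cyclic) (simp add: r(2))
    finally show ?thesis .
  qed
  have "\<exists>c::int. poly.coeff G i = of_int c" for i
  proof -
    have "poly.coeff G i ^ p = poly.coeff G i"
      using arg_cong[OF frG, of "\<lambda>q. poly.coeff q i"] p0 by (simp add: coeff_map_poly)
    then show ?thesis using power_CHAR_fixed[OF p] by metis
  qed
  then obtain h :: "nat \<Rightarrow> int" where h: "\<And>i. poly.coeff G i = of_int (h i)" by metis
  define A where "A = Poly (map h [0..<Suc (degree G)])"
  have A: "of_int_poly A = G"
  proof (rule poly_eqI)
    fix n
    show "poly.coeff (of_int_poly A) n = poly.coeff G n"
      by (cases "n < Suc (degree G)")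
        (auto simp: A_def coeff_map_poly coeff_Poly_eq nth_default_def h coeff_eq_0 simp del: upt_Suc
              simp flip: h)
  qed
  have "poly G (b 0) = 0" unfolding G_def using r(1) by (auto simp: poly_prod)
  then have "D \<le> r"
    using min A lcG degG unfolding min_root_def b0 by (metis leading_coeff_0_iff zero_neq_one)
  moreover have "r \<le> D"
  proof -
    have "card (b ` {..<r}) \<le> card {x. poly F' x = 0}"
      by (rule card_mono[OF finr]) (use rt in auto)
    also have "\<dots> \<le> degree F'" by (rule card_poly_roots_bound[OF F'0])
    finally show ?thesis using injr D by (simp add: card_image F'_def)
  qed
  ultimately have rD: "r = D" by simp
  show "\<beta> ^ (p ^ D) = \<beta>" using r(2) rD by (simp add: b_def)
  show "inj_on (\<lambda>i. \<beta> ^ (p ^ i)) {..<D}" using injr rD unfolding b_def by simp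
  \<comment> \<open>The difference loses its coefficient of degree \<open>D\<close> but keeps the
    \<open>D\<close> distinct conjugates as roots.\<close>
  have "F' = smult (lead_coeff F') G"
  proof (rule ccontr)
    define H where "H = F' - smult (lead_coeff F') G"
    assume "F' \<noteq> smult (lead_coeff F') G"
    then have H0: "H \<noteq> 0" by (simp add: H_def)
    have "degree H \<le> D"
      unfolding H_def using degG rD D by (intro degree_diff_le) (auto simp: F'_def)
    moreover have "poly.coeff H D = 0"
      using lcG degG rD D by (simp add: H_def F'_def)
    ultimately have "degree H < D" using H0 by (metis leading_coeff_0_iff le_neq_implies_less)
    moreover have "D \<le> card {x. poly H x = 0}"
    proof -
      have "poly G (b i) = 0" if "i < D" for i
        unfolding G_def using that rD by (auto simp: poly_prod)
      then have "b ` {..<D} \<subseteq> {x. poly H x = 0}" using rt by (auto simp: H_def)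
      then have "card (b ` {..<D}) \<le> card {x. poly H x = 0}"
        by (rule card_mono[OF poly_roots_finite[OF H0]])
      then show ?thesis using injr rD by (simp add: card_image)
    qed
    ultimately show False using card_poly_roots_bound[OF H0] by linarith
  qed
  then show "of_int_poly F = smult (lead_coeff (of_int_poly F)) (\<Prod>i<D. [:- (\<beta> ^ (p ^ i)), 1:])"
    using rD by (simp add: F'_def G_def b_def)
qed

text \<open>A cycle of even length is an odd permutation. Concretely, the factors involving
  \<open>b 0\<close> reappear with their two entries exchanged, and there are D - 1 of them, an odd
  number.\<close>

lemma vandermonde_shift:
  fixes b :: "nat \<Rightarrow> 'k::comm_ring_1"
  assumes "b D = b 0" "even D" "D > 0"
  shows "(\<Prod>j<D. \<Prod>i<j. b (Suc i) - b (Suc j)) = - (\<Prod>j<D. \<Prod>i<j. b i - b j)"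
proof -
  obtain E where E: "D = Suc E" using assms(3) gr0_conv_Suc by blast
  have oE: "odd E" using assms(2) E by simp
  define Y where "Y = (\<Prod>j<E. \<Prod>i<j. b (Suc i) - b (Suc j))"
  have "(\<Prod>i<E. b (Suc i) - b 0) = (\<Prod>i<E. - 1 * (b 0 - b (Suc i)))"
    by (intro prod.cong) auto
  also have "\<dots> = (- 1) ^ E * (\<Prod>i<E. b 0 - b (Suc i))"
    by (simp only: prod.distrib) simp
  finally have 1: "(\<Prod>i<E. b (Suc i) - b 0) = - (\<Prod>i<E. b 0 - b (Suc i))" using oE by simp
  have "(\<Prod>j<D. \<Prod>i<j. b i - b j) = (\<Prod>j<E. \<Prod>i<Suc j. b i - b (Suc j))"
    unfolding E by (subst prod.lessThan_Suc_shift) simp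
  also have "\<dots> = (\<Prod>j<E. (b 0 - b (Suc j)) * (\<Prod>i<j. b (Suc i) - b (Suc j)))"
    by (intro prod.cong refl) (subst prod.lessThan_Suc_shift, simp)
  also have "\<dots> = (\<Prod>j<E. b 0 - b (Suc j)) * Y" by (simp add: prod.distrib Y_def)
  finally have 2: "(\<Prod>j<D. \<Prod>i<j. b i - b j) = (\<Prod>j<E. b 0 - b (Suc j)) * Y" .
  have "(\<Prod>j<D. \<Prod>i<j. b (Suc i) - b (Suc j)) = Y * (\<Prod>i<E. b (Suc i) - b 0)"
    using assms(1) by (simp add: E Y_def)
  then show ?thesis using 1 2 by simp
qed

text \<open>Each unordered pair gives two factors that differ in sign, and there are
  \<open>\<Sum>i<D. i\<close> pairs. The left-hand side is the form in which the derivative of a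
  product of linear factors delivers the discriminant.\<close>

lemma vandermonde_square:
  fixes b :: "nat \<Rightarrow> 'k::comm_ring_1"
  shows "(\<Prod>i<D. \<Prod>j\<in>{..<D} - {i}. b i - b j) = (- 1) ^ (\<Sum>i<D. i) * (\<Prod>j<D. \<Prod>i<j. b i - b j) ^ 2"
proof (induction D)
  case (Suc D)
  have "(\<Prod>j\<in>{..<Suc D} - {i}. b i - b j) = (\<Prod>j\<in>{..<D} - {i}. b i - b j) * (b i - b D)" if "i < D" for i
  proof -
    have "{..<Suc D} - {i} = insert D ({..<D} - {i})" using that by auto
    then show ?thesis by (simp add: mult.commute)
  qed
  then have "(\<Prod>i<D. \<Prod>j\<in>{..<Suc D} - {i}. b i - b j) =
      (\<Prod>i<D. \<Prod>j\<in>{..<D} - {i}. b i - b j) * (\<Prod>i<D. b i - b D)"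
    by (simp add: prod.distrib)
  moreover have "(\<Prod>j\<in>{..<Suc D} - {D}. b D - b j) = (- 1) ^ D * (\<Prod>i<D. b i - b D)"
  proof -
    have "{..<Suc D} - {D} = {..<D}" by auto
    then have "(\<Prod>j\<in>{..<Suc D} - {D}. b D - b j) = (\<Prod>i<D. - 1 * (b i - b D))"
      by (intro prod.cong) auto
    then show ?thesis by (simp only: prod.distrib) simp
  qed
  ultimately show ?case
    by (simp add: Suc power_add power2_eq_square algebra_simps)
qed simp

section \<open>Discriminants of iterates\<close>

lemma degree_poly_iterate:
  fixes f :: "'a::idom poly"
  shows "degree (poly_iterate f n) = degree f ^ n"
  by (induction n) (auto simp: degree_pcompose)

text \<open>Each step replaces the exponent \<open>k\<close> by \<open>k * degree f + 1\<close>,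
  which is odd for even degree. Up to squares, all iterates with \<open>n > 0\<close> then have the
  leading coefficient of \<open>f\<close> itself.\<close>

lemma lead_coeff_poly_iterate_dvd:
  fixes f :: "'a::idom poly"
  assumes "degree f > 0"
  shows "\<exists>k. lead_coeff (poly_iterate f n) = lead_coeff f ^ k \<and> (even (degree f) \<longrightarrow> n > 0 \<longrightarrow> odd k)"
proof (induction n)
  case 0
  then show ?case by (intro exI[of _ 0]) auto
next
  case (Suc n)
  then obtain k where "lead_coeff (poly_iterate f n) = lead_coeff f ^ k" by auto
  moreover have "lead_coeff (poly_iterate f (Suc n)) = lead_coeff f * lead_coeff (poly_iterate f n) ^ degree f"
    unfolding poly_iterate_Suc by (rule lead_coeff_comp) (use assms in \<open>simp add: degree_poly_iterate\<close>)
  ultimately have "lead_coeff (poly_iterate f (Suc n)) = lead_coeff f ^ Suc (k * degree f)"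
    by (simp add: power_mult)
  then show ?case by (intro exI[of _ "Suc (k * degree f)"]) auto
qed

lemma poly_iterate_add: "poly_iterate f (m + n) = poly_iterate f m \<circ>\<^sub>p poly_iterate f n"
  by (induction m) (auto simp: pcompose_pCons pcompose_assoc)

lemma poly_of_int_poly_pcompose:
  "poly (of_int_poly (A \<circ>\<^sub>p B)) (x::'k::comm_ring_1) = poly (of_int_poly A) (poly (of_int_poly B) x)"
  by (induction A) (auto simp: pcompose_pCons of_int_hom.map_poly_pCons_hom of_int_poly_hom.hom_mult of_int_poly_hom.hom_add)

lemma pderiv_of_int_poly: "pderiv (of_int_poly A :: 'k::idom poly) = of_int_poly (pderiv A)"
  by (rule poly_eqI) (simp add: coeff_pderiv coeff_map_poly)

lemma pderiv_poly_iterate: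
  fixes f :: "'a::idom poly"
  shows "pderiv (poly_iterate f n) = (\<Prod>i<n. pderiv f \<circ>\<^sub>p poly_iterate f i)"
  by (induction n) (auto simp: pderiv_pCons pderiv_pcompose mult.commute)

lemma prod_lessThan_add:
  fixes c :: "nat \<Rightarrow> 'a::comm_monoid_mult"
  shows "(\<Prod>j<a + b. c j) = (\<Prod>j<a. c j) * (\<Prod>j<b. c (a + j))"
  by (induction b) (auto simp: mult.assoc)

lemma prod_periodic:
  fixes c :: "nat \<Rightarrow> 'a::comm_monoid_mult"
  assumes "\<And>j. c (j + m) = c j"
  shows "(\<Prod>j<m * k. c j) = (\<Prod>j<m. c j) ^ k"
proof (induction k)
  case (Suc k)
  have "c (m * k + j) = c j" for j
    by (induction k) (use assms in \<open>auto simp: algebra_simps\<close>, metis add.assoc add.commute assms)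
  moreover have "m * Suc k = m * k + m" by simp
  ultimately show ?case using Suc by (simp only: prod_lessThan_add) (simp add: mult.commute)
qed simp

text \<open>The norm of the derivative at a root is computed twice. As a product over pairs of roots
  it is a power of \<open>c\<close> times the square of the Vandermonde product
  \<open>\<delta>\<close>. By the chain rule it is a square times the norms of \<open>aX + b\<close>
  at the iterates \<open>i < n\<close>; those with \<open>i \<ge> 1\<close> are squares, and the one
  with \<open>i = 0\<close> is, up to \<open>c\<close>, the value in question. Were that value a
  square after multiplication by \<open>c\<close>, Frobenius would fix \<open>\<delta>\<close>
  instead of negating it.\<close>

lemma iterate_value_not_square:
  fixes f g :: "int poly" and a b :: int and \<beta> :: "'k::field"
  defines "d \<equiv> degree f"
  assumes p: "prime p" "p \<noteq> 2" "CHAR('k) = p"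
    and d: "even d" "d > 0"
    and f': "pderiv f = g ^ 2 * [:b, a:]"
    and lc: "\<not> int p dvd lead_coeff f" and a: "\<not> int p dvd a"
    and irr: "\<And>m \<beta>::'k. m \<ge> 1 \<Longrightarrow> poly (of_int_poly (poly_iterate f m)) \<beta> = 0 \<Longrightarrow> min_root \<beta> (d ^ m)"
    and n: "n \<ge> 2" and root: "poly (of_int_poly (poly_iterate f n)) \<beta> = 0"
  shows "\<not> (\<exists>t. of_int (lead_coeff (poly_iterate f n)) *
    (of_int a ^ (d ^ n) * poly (of_int_poly (poly_iterate f n)) (- of_int b / of_int a)) = (of_int t :: 'k)\<^sup>2)"
proof
  note pC = p(1,3)
  define P where "P = poly_iterate f"
  define D where "D = d ^ n"
  define F where "F = (of_int_poly (P n) :: 'k poly)"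
  \<comment> \<open>With \<open>4 dvd D\<close> the number of pairs of roots is even and the
    discriminant formula carries no sign; for \<open>n = 1\<close> this can fail.\<close>
  have D4: "4 dvd D"
  proof -
    obtain k where "d = 2 * k" using d by auto
    then have "d ^ 2 = 4 * k ^ 2" by (simp add: power_mult_distrib)
    moreover have "d ^ 2 dvd d ^ n" using n by (rule le_imp_power_dvd)
    ultimately show ?thesis unfolding D_def using dvd_trans by (metis dvd_triv_left)
  qed
  have D0: "D > 0" using d by (simp add: D_def)
  have nz: "of_int (lead_coeff (P m)) \<noteq> (0::'k)" for m
  proof -
    obtain k where k: "lead_coeff (P m) = lead_coeff f ^ k"
      using lead_coeff_poly_iterate_dvd[of f m] d by (auto simp: P_def d_def)
    have "\<not> int p dvd lead_coeff f ^ k"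
      using lc p(1) prime_dvd_power[of "int p"] by auto
    then show ?thesis using k p(3) of_int_eq_0_iff_char_dvd[where 'a='k] by metis
  qed
  have degP: "degree (of_int_poly (P m) :: 'k poly) = d ^ m" for m
    using nz[of m] degree_poly_iterate[of f m] by (subst degree_map_poly) (auto simp: P_def d_def)
  have lcP: "lead_coeff (of_int_poly (P m) :: 'k poly) = of_int (lead_coeff (P m))" for m
    using degP[of m] degree_poly_iterate[of f m] by (simp add: coeff_map_poly P_def d_def)
  define c where "c = (of_int (lead_coeff (P n)) :: 'k)"
  have c0: "c \<noteq> 0" using nz by (simp add: c_def)
  have a0: "(of_int a :: 'k) \<noteq> 0" using a p(3) of_int_eq_0_iff_char_dvd[where 'a='k] by metis
  \<comment> \<open>\<open>fx\<close> singles out the prime field as the fixed field of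
    Frobenius.\<close>
  define fx where "fx x \<longleftrightarrow> x ^ p = x" for x :: 'k
  have fx_mult: "fx x \<Longrightarrow> fx y \<Longrightarrow> fx (x * y)" for x y by (simp add: fx_def power_mult_distrib)
  have fx_power: "fx x \<Longrightarrow> fx (x ^ k)" for x k by (induction k) (auto simp: fx_def power_mult_distrib)
  have fx_int: "fx (of_int k)" for k using of_int_power_CHAR[OF pC] by (simp add: fx_def)
  have fx_prod: "fx (prod s I)" if "\<And>i. i \<in> I \<Longrightarrow> fx (s i)" for s and I :: "nat set"
    using that by (induction I rule: infinite_finite_induct) (auto simp: fx_def power_mult_distrib)
  have fx_minus: "fx x \<Longrightarrow> fx (- x)" for x
    using diff_power_CHAR[OF pC, of 0 x] prime_gt_0_nat[OF p(1)] by (simp add: fx_def)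
  define B where "B i = \<beta> ^ (p ^ i)" for i
  have Bfun: "B = (\<lambda>i. \<beta> ^ (p ^ i))" by (auto simp: B_def)
  have BS: "B (Suc i) = B i ^ p" for i by (simp add: B_def power_mult mult.commute[of p])
  have B0: "B 0 = \<beta>" by (simp add: B_def)
  have DP: "D = degree (of_int_poly (P n) :: 'k poly)" using degP[of n] by (simp add: D_def)
  have min: "min_root \<beta> D" using irr[of n \<beta>] root n by (simp add: D_def)
  note conj = frobenius_conjugates[OF pC DP D0 root[folded P_def] min]
  have BD: "B D = B 0" using conj(1) by (simp add: B_def)
  have injB: "inj_on B {..<D}" using conj(2) by (simp add: Bfun)
  have F: "F = smult c (\<Prod>i<D. [:- B i, 1:])"
    using conj(3) unfolding lcP c_def[symmetric] by (simp only: F_def B_def)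
  define nrm where "nrm A = (\<Prod>i<D. poly (of_int_poly A) (B i))" for A :: "int poly"
  have ev: "poly (of_int_poly A) (B i) = poly (of_int_poly A) \<beta> ^ (p ^ i)" for A i
    using poly_of_int_poly_power_CHAR[OF pC, of A \<beta> i] by (simp add: B_def)
  have nrm_mult: "nrm (A * A') = nrm A * nrm A'" for A A'
    by (simp add: nrm_def of_int_poly_hom.hom_mult prod.distrib)
  have nrm_prod: "nrm (prod G I) = (\<Prod>i\<in>I. nrm (G i))" for G and I :: "nat set"
    by (induction I rule: infinite_finite_induct) (auto simp: nrm_mult, auto simp: nrm_def)
  have fx_nrm: "fx (nrm A)" for A
  proof -
    have "nrm A ^ p = (\<Prod>i<D. poly (of_int_poly A) (B (Suc i)))"
      using poly_of_int_poly_power_CHAR[OF pC, of A _ 1]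
      by (simp add: nrm_def prod_power_distrib BS)
    also have "\<dots> = nrm A" unfolding nrm_def
      by (rule prod_shift_cyclic) (simp add: BD)
    finally show ?thesis by (simp add: fx_def)
  qed
  define L where "L i = [:b, a:] \<circ>\<^sub>p P i" for i
  \<comment> \<open>The value of \<open>P i\<close> at \<open>\<beta>\<close> is a root of
    \<open>P (n - i)\<close>, hence lies in a subfield of degree \<open>d ^ (n - i)\<close>. The
    norm from the big field is the norm \<open>s\<close> from this subfield raised to the power
    \<open>d ^ i\<close>, which is even for \<open>i \<ge> 1\<close>.\<close>
  have sq: "\<exists>s. fx s \<and> nrm (L i) = s ^ 2" if i: "i \<ge> 1" "i < n" for i
  proof -
    define w where "w = poly (of_int_poly (P i)) \<beta>"
    define z where "z = poly (of_int_poly (L i)) \<beta>"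
    have zw: "z = of_int b + of_int a * w"
      by (simp add: z_def w_def L_def poly_of_int_poly_pcompose mult.commute of_int_hom.map_poly_pCons_hom del: pcompose_pCons)
    have "P n = P (n - i) \<circ>\<^sub>p P i"
      using poly_iterate_add[of f "n - i" i] i by (simp add: P_def)
    then have wr: "poly (of_int_poly (P (n - i))) w = 0"
      using root by (simp add: w_def poly_of_int_poly_pcompose P_def)
    define D' where "D' = d ^ (n - i)"
    have mw: "min_root w D'" using irr[of "n - i" w] wr i by (simp add: D'_def P_def)
    have "w ^ (p ^ D') = w"
      using frobenius_conjugates(1)[OF pC, of D' "P (n - i)" w] degP[of "n - i"] wr mw d
      by (simp add: D'_def)
    then have "z ^ (p ^ D') = z"
      using poly_of_int_poly_power_CHAR[OF pC, of "[:b, a:]" w D'] zw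
      by (simp add: of_int_hom.map_poly_pCons_hom mult.commute)
    then have zper: "z ^ (p ^ (j + D')) = z ^ (p ^ j)" for j
      by (metis add.commute mult.commute power_add power_mult)
    define s where "s = (\<Prod>j<D'. z ^ (p ^ j))"
    have DD: "D = D' * d ^ i" using i by (simp add: D_def D'_def flip: power_add)
    have "nrm (L i) = (\<Prod>j<D. z ^ (p ^ j))" by (simp add: nrm_def ev z_def)
    also have "\<dots> = s ^ (d ^ i)" unfolding DD s_def by (rule prod_periodic) (rule zper)
    also have "\<dots> = (s ^ (d ^ i div 2)) ^ 2"
    proof -
      have "even (d ^ i)" using d i by simp
      then show ?thesis by (simp flip: power_mult)
    qed
    finally have "nrm (L i) = (s ^ (d ^ i div 2)) ^ 2" .
    moreover have "fx s"
    proof -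
      have "s ^ p = (\<Prod>j<D'. z ^ (p ^ Suc j))"
        by (simp add: s_def prod_power_distrib flip: power_mult) (simp add: mult.commute)
      also have "\<dots> = s" unfolding s_def
        by (rule prod_shift_cyclic) (use zper[of 0] in simp)
      finally show ?thesis by (simp add: fx_def)
    qed
    ultimately show ?thesis using fx_power by blast
  qed
  then obtain s where s: "\<And>i. i \<ge> 1 \<Longrightarrow> i < n \<Longrightarrow> fx (s i) \<and> nrm (L i) = s i ^ 2" by metis
  define S where "S = (\<Prod>i<n. g \<circ>\<^sub>p P i)"
  define T where "T = nrm S * (\<Prod>i\<in>{1..<n}. s i)"
  have fxT: "fx T" unfolding T_def using s by (intro fx_mult fx_nrm fx_prod) auto
  have n1: "nrm (pderiv (P n)) = T ^ 2 * nrm (L 0)"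
  proof -
    have "pderiv (P n) = S ^ 2 * (\<Prod>i<n. L i)"
      unfolding P_def pderiv_poly_iterate f' S_def L_def
      by (simp only: pcompose_mult prod.distrib power2_eq_square)
    then have "nrm (pderiv (P n)) = nrm S ^ 2 * (\<Prod>i<n. nrm (L i))"
      by (simp add: nrm_mult nrm_prod power2_eq_square)
    also have "(\<Prod>i<n. nrm (L i)) = nrm (L 0) * (\<Prod>i\<in>{1..<n}. nrm (L i))"
    proof -
      have "{..<n} = insert 0 {1..<n}" using n by auto
      then show ?thesis by simp
    qed
    also have "(\<Prod>i\<in>{1..<n}. nrm (L i)) = (\<Prod>i\<in>{1..<n}. s i) ^ 2"
      using s by (simp add: prod_power_distrib)
    finally show ?thesis by (simp add: T_def power_mult_distrib mult_ac)
  qed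
  define \<gamma> where "\<gamma> = - of_int b / (of_int a :: 'k)"
  define v where "v = of_int a ^ D * poly F \<gamma>"
  have n2: "c * nrm (L 0) = v"
  proof -
    have "nrm (L 0) = (\<Prod>i<D. of_int b + of_int a * B i)"
      by (simp add: nrm_def L_def P_def of_int_hom.map_poly_pCons_hom mult.commute)
    also have "\<dots> = (\<Prod>i<D. (- of_int a) * (\<gamma> - B i))"
      using a0 by (intro prod.cong) (auto simp: \<gamma>_def field_simps)
    also have "\<dots> = of_int a ^ D * (\<Prod>i<D. \<gamma> - B i)"
    proof -
      have "even D" using D4 by (meson dvd_trans even_numeral)
      then show ?thesis by (simp only: prod.distrib) simp
    qed
    finally show ?thesis by (simp add: v_def F poly_prod)
  qed
  define \<delta> where "\<delta> = (\<Prod>j<D. \<Prod>i<j. B i - B j)"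
  have \<delta>0: "\<delta> \<noteq> 0"
  proof -
    have "B i \<noteq> B j" if "i < j" "j < D" for i j
      using injB that by (auto dest!: inj_onD)
    then show ?thesis by (auto simp: \<delta>_def)
  qed
  have \<delta>p: "\<delta> ^ p = - \<delta>"
  proof -
    have "\<delta> ^ p = (\<Prod>j<D. \<Prod>i<j. B (Suc i) - B (Suc j))"
      by (simp add: \<delta>_def prod_power_distrib diff_power_CHAR[OF pC] BS)
    also have "\<dots> = - \<delta>" unfolding \<delta>_def
      by (rule vandermonde_shift) (use BD D4 D0 in \<open>auto intro: dvd_trans[OF _ D4]\<close>)
    finally show ?thesis .
  qed
  have n3: "nrm (pderiv (P n)) = c ^ D * \<delta> ^ 2"
  proof -
    have "poly (pderiv F) (B i) = c * (\<Prod>j\<in>{..<D} - {i}. B i - B j)" if "i < D" for i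
    proof -
      define Q where "Q = (\<Prod>j\<in>{..<D} - {i}. [:- B j, 1:])"
      have "F = smult c ([:- B i, 1:] * Q)"
        unfolding F Q_def using that by (subst prod.remove[of _ i]) auto
      then have "pderiv F = smult c ([:- B i, 1:] * pderiv Q + Q * pderiv [:- B i, 1:])"
        by (simp only: pderiv_smult pderiv_mult)
      then show ?thesis by (simp add: pderiv_pCons Q_def poly_prod)
    qed
    then have "nrm (pderiv (P n)) = (\<Prod>i<D. c * (\<Prod>j\<in>{..<D} - {i}. B i - B j))"
      by (simp add: nrm_def F_def pderiv_of_int_poly)
    also have "\<dots> = c ^ D * ((- 1) ^ (\<Sum>i<D. i) * \<delta> ^ 2)"
      by (simp add: prod.distrib vandermonde_square \<delta>_def)
    finally have eq: "nrm (pderiv (P n)) = c ^ D * ((- 1) ^ (\<Sum>i<D. i) * \<delta> ^ 2)" .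
    have "even (\<Sum>i<D. i)"
    proof -
      obtain k where "D = 4 * k" using D4 by auto
      then have "(\<Sum>i<D. i) = 2 * k * (4 * k - 1)"
        by (simp add: lessThan_atLeast0 Sum_Ico_nat)
      then show ?thesis by simp
    qed
    then show ?thesis using eq by simp
  qed
  assume "\<exists>t. of_int (lead_coeff (poly_iterate f n)) *
    (of_int a ^ (d ^ n) * poly (of_int_poly (poly_iterate f n)) (- of_int b / of_int a)) = (of_int t :: 'k)\<^sup>2"
  then obtain t where t: "c * v = (of_int t)\<^sup>2"
    unfolding c_def v_def P_def D_def F_def \<gamma>_def by blast
  \<comment> \<open>The square of \<open>y\<close> is \<open>c^2\<close> times the norm of the
    derivative. The additional factor \<open>c\<close> is there because the assumption concerns
    \<open>c * v\<close>, whereas \<open>nrm (L 0)\<close> is \<open>v / c\<close>.\<close>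
  define y where "y = c ^ (D div 2 + 1) * \<delta>"
  have eD: "even D" using D4 by (meson dvd_trans even_numeral)
  have "y ^ 2 = c ^ 2 * (c ^ D * \<delta> ^ 2)"
  proof -
    have "(c ^ (D div 2)) ^ 2 = c ^ D" using eD by (simp flip: power_mult)
    then show ?thesis by (simp add: y_def power_mult_distrib mult_ac)
  qed
  also have "\<dots> = (T * of_int t) ^ 2"
    using n1 n2 n3 t by (simp add: power_mult_distrib power2_eq_square mult_ac)
  finally have "y = T * of_int t \<or> y = - (T * of_int t)" by (simp add: power2_eq_iff)
  then have "fx y" using fx_mult[OF fxT fx_int[of t]] fx_minus by auto
  moreover have "y ^ p = - y"
  proof -
    have "fx (c ^ (D div 2 + 1))" unfolding c_def by (intro fx_power fx_int)
    then show ?thesis by (simp add: y_def power_mult_distrib \<delta>p fx_def del: power_Suc)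
  qed
  ultimately have "2 * y = 0" by (simp add: fx_def)
  moreover have "(2::'k) \<noteq> 0"
  proof
    assume "(2::'k) = 0"
    then have "(of_nat 2 :: 'k) = 0" by simp
    then have "p dvd 2" using p(3) of_nat_eq_0_iff_char_dvd by metis
    then show False using p(1,2) primes_dvd_imp_eq two_is_prime_nat by blast
  qed
  ultimately show False using c0 \<delta>0 by (simp add: y_def)
qed

text \<open>The homogenisation of \<open>A\<close> in degree \<open>D\<close> at \<open>(-b, a)\<close>, that is \<open>a\<^sup>D A(-b/a)\<close>.\<close>

definition hval :: "int poly \<Rightarrow> nat \<Rightarrow> int \<Rightarrow> int \<Rightarrow> int" where
  "hval A D a b = (\<Sum>i\<le>D. poly.coeff A i * (- b) ^ i * a ^ (D - i))"

lemma of_int_hval: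
  assumes "(of_int a :: 'k::field) \<noteq> 0" "degree A \<le> D"
  shows "(of_int (hval A D a b) :: 'k) = of_int a ^ D * poly (of_int_poly A) (- of_int b / of_int a)"
proof -
  let ?x = "- of_int b / of_int a :: 'k"
  define Q where "Q = (of_int_poly A :: 'k poly)"
  have "degree Q \<le> D"
    using assms(2) degree_map_poly_le[of "of_int :: int \<Rightarrow> 'k" A] by (simp add: Q_def)
  then have "(\<Sum>i\<le>degree Q. poly.coeff Q i * ?x ^ i) = (\<Sum>i\<le>D. poly.coeff Q i * ?x ^ i)"
    by (intro sum.mono_neutral_left) (auto simp: coeff_eq_0)
  then have "poly (of_int_poly A) ?x = (\<Sum>i\<le>D. of_int (poly.coeff A i) * ?x ^ i)"
    by (simp add: poly_altdef flip: Q_def) (simp add: Q_def)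
  then have "of_int a ^ D * poly (of_int_poly A) ?x =
      (\<Sum>i\<le>D. of_int a ^ D * (of_int (poly.coeff A i) * ?x ^ i))"
    by (simp add: sum_distrib_left)
  also have "\<dots> = (\<Sum>i\<le>D. of_int (poly.coeff A i * (- b) ^ i * a ^ (D - i)))"
  proof (rule sum.cong)
    fix i assume i: "i \<in> {..D}"
    then have "of_int a ^ D = of_int a ^ (D - i) * (of_int a ^ i :: 'k)" by (simp flip: power_add)
    moreover have "of_int a ^ i * ?x ^ i = (of_int (- b)) ^ i"
      using assms(1) by (simp flip: power_mult_distrib)
    ultimately show "of_int a ^ D * (of_int (poly.coeff A i) * ?x ^ i) =
        of_int (poly.coeff A i * (- b) ^ i * a ^ (D - i))"
      by (simp add: algebra_simps)
  qed simp
  finally show ?thesis by (simp add: hval_def)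
qed

lemma degree_map_poly_to_ac: "degree (map_poly to_ac q) = degree q"
  by (cases "q = 0") (simp_all add: degree_map_poly)

text \<open>Both parts are phrased over \<open>int\<close> alone, with no type depending on p: only
  a closed predicate of the number \<open>p\<close> can be carried from type cardinalities to all
  primes. The second part keeps the curves of Runge's method non-degenerate.\<close>

definition iterate_obstruction :: "nat \<Rightarrow> bool" where
  "iterate_obstruction p \<longleftrightarrow> (\<forall>f g a b.
     p \<noteq> 2 \<and> even (degree f) \<and> degree f > 0 \<and> pderiv f = g ^ 2 * [:b, a:] \<and>
     \<not> int p dvd lead_coeff f \<and> \<not> int p dvd a \<and>
     dynamically_irreducible (residue_ring (int p)) (reduce_poly (int p) f) \<longrightarrow>
     (\<forall>n\<ge>2. \<forall>t.
        \<not> [lead_coeff (poly_iterate f n) * hval (poly_iterate f n) (degree f ^ n) a b = t\<^sup>2] (mod int p)) \<and>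
     (\<forall>k\<ge>1. \<forall>H s. \<not> int p dvd s \<longrightarrow> H\<^sup>2 \<noteq> smult s (f * poly_iterate f (Suc k))))"

text \<open>Roots live in the algebraic closure of \<open>'p mod_ring\<close>. For the second part,
  the irreducible \<open>f\<close> divides \<open>H\<close> and hence, after cancelling one factor,
  divides a later iterate, which is itself irreducible but of larger degree.\<close>

lemma iterate_obstruction_CARD: "iterate_obstruction CARD('p::prime_card)"
  unfolding iterate_obstruction_def
proof (intro allI impI, elim conjE)
  let ?p = "CARD('p)"
  fix f g :: "int poly" and a b :: int
  assume p2: "?p \<noteq> 2" and d: "even (degree f)" "degree f > 0"
    and f': "pderiv f = g ^ 2 * [:b, a:]"
    and lc: "\<not> int ?p dvd lead_coeff f" and a: "\<not> int ?p dvd a"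
    and dyn: "dynamically_irreducible (residue_ring (int ?p)) (reduce_poly (int ?p) f)"
  have p: "prime ?p" by (rule prime_card)
  define P where "P = poly_iterate f"
  let ?h = "of_int_poly :: int poly \<Rightarrow> 'p mod_ring poly"
  have rp: "residues_prime ?p" using p by unfold_locales
  have irr: "irreducible (?h (P m))" if "m \<ge> 1" for m
  proof (rule irreducible_of_int_poly)
    show "ring_irreducible\<^bsub>poly_ring (residue_ring (int CARD('p)))\<^esub> (reduce_poly (int CARD('p)) (P m))"
      using dyn that residues_prime.list_poly_iterate_reduce_poly[OF rp, of f m]
      by (auto simp: dynamically_irreducible_def P_def
           ring.univ_poly_consistent residue_ring_def)
  qed
  have nz: "of_int (lead_coeff (P m)) \<noteq> (0::'p mod_ring)" for m
  proof -
    obtain k where k: "lead_coeff (P m) = lead_coeff f ^ k"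
      using lead_coeff_poly_iterate_dvd[of f m] d by (auto simp: P_def)
    have "\<not> int ?p dvd lead_coeff f ^ k"
      using lc p prime_dvd_power[of "int ?p"] by auto
    then show ?thesis using k of_int_mod_ring_eq_0_iff by metis
  qed
  have degP: "degree (?h (P m)) = degree f ^ m" for m
    using nz[of m] degree_poly_iterate[of f m] by (subst degree_map_poly) (auto simp: P_def)
  have ac: "(of_int_poly A :: 'p mod_ring alg_closure poly) = map_poly to_ac (?h A)" for A
    by (rule poly_eqI) (simp add: coeff_map_poly)
  interpret ac: map_poly_comm_ring_hom "to_ac :: 'p mod_ring \<Rightarrow> _"
    by unfold_locales auto
  have min: "min_root \<beta> (degree f ^ m)"
    if m: "m \<ge> 1" and r: "poly (of_int_poly (P m)) \<beta> = 0" for m and \<beta> :: "'p mod_ring alg_closure"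
    unfolding min_root_def
  proof (intro allI impI)
    fix A assume A: "poly (of_int_poly A) \<beta> = 0"
    show "of_int_poly A = (0 :: 'p mod_ring alg_closure poly) \<or>
      degree f ^ m \<le> degree (of_int_poly A :: 'p mod_ring alg_closure poly)"
    \<comment> \<open>If the irreducible \<open>P m\<close> does not divide \<open>A\<close>, a
      Bezout identity evaluated at \<open>\<beta>\<close> reads 0 = 1.\<close>
    proof (cases "?h (P m) dvd ?h A")
      case True
      have "degree (map_poly to_ac (?h A)) = degree (?h A)" by (rule degree_map_poly_to_ac)
      then show ?thesis using dvd_imp_degree_le[OF True] degP[of m] by (cases "?h A = 0") (auto simp: ac)
    next
      case False
      have "prime_elem (?h (P m))" using irr[OF m] by (simp add: prime_elem_iff_irreducible)
      then have "coprime (?h (P m)) (?h A)" using False prime_elem_imp_coprime by blast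
      then obtain u v where "u * ?h (P m) + v * ?h A = 1"
        by (metis bezout_coefficients_fst_snd coprime_iff_gcd_eq_1)
      then have "map_poly to_ac (u * ?h (P m) + v * ?h A) = map_poly to_ac 1" by simp
      then have "map_poly to_ac u * of_int_poly (P m) + map_poly to_ac v * of_int_poly A = 1"
        by (simp add: ac.hom_add ac.hom_mult ac)
      from arg_cong[OF this, of "\<lambda>q. poly q \<beta>"] have False using A r by simp
      then show ?thesis ..
    qed
  qed
  have C: "CHAR('p mod_ring alg_closure) = ?p" by (simp add: semiring_char_mod_ring)
  have aK: "(of_int a :: 'p mod_ring alg_closure) \<noteq> 0"
    using a C of_int_eq_0_iff_char_dvd by metis
  have "\<not> [lead_coeff (P n) * hval (P n) (degree f ^ n) a b = t\<^sup>2] (mod int ?p)"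
    if n: "n \<ge> 2" for n t
  proof
    assume c: "[lead_coeff (P n) * hval (P n) (degree f ^ n) a b = t\<^sup>2] (mod int ?p)"
    have "degree (of_int_poly (P n) :: 'p mod_ring alg_closure poly) = degree (?h (P n))"
      unfolding ac by (rule degree_map_poly_to_ac)
    then have "degree (of_int_poly (P n) :: 'p mod_ring alg_closure poly) > 0" using degP[of n] d by simp
    then obtain \<beta> where \<beta>: "poly (of_int_poly (P n)) (\<beta> :: 'p mod_ring alg_closure) = 0"
      using alg_closed_imp_poly_has_root by blast
    have "int ?p dvd lead_coeff (P n) * hval (P n) (degree f ^ n) a b - t\<^sup>2"
      using c by (simp add: cong_iff_dvd_diff)
    then have "(of_int (lead_coeff (P n) * hval (P n) (degree f ^ n) a b - t\<^sup>2) :: 'p mod_ring alg_closure) = 0"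
      using C of_int_eq_0_iff_char_dvd by metis
    then have "of_int (lead_coeff (P n)) * (of_int a ^ (degree f ^ n) *
        poly (of_int_poly (P n)) (- of_int b / of_int a)) = (of_int t :: 'p mod_ring alg_closure)\<^sup>2"
      using of_int_hval[OF aK, of "P n" "degree f ^ n" b] degree_poly_iterate[of f n] by (simp add: P_def)
    then show False
      using iterate_value_not_square[OF p p2 C d f' lc a min[unfolded P_def] n \<beta>[unfolded P_def]]
      unfolding P_def by blast
  qed
  moreover have "H\<^sup>2 \<noteq> smult s (f * P (Suc k))" if k: "k \<ge> 1" and s: "\<not> int ?p dvd s" for k H s
  proof
    assume "H\<^sup>2 = smult s (f * P (Suc k))"
    then have "?h H ^ 2 = ?h (smult s (f * P (Suc k)))" by (simp flip: of_int_poly_hom.hom_power)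
    also have "\<dots> = smult (of_int s) (?h f * ?h (P (Suc k)))"
      by (simp add: of_int_hom.map_poly_hom_smult of_int_poly_hom.hom_mult)
    finally have eq: "?h H ^ 2 = smult (of_int s) (?h f * ?h (P (Suc k)))" .
    have s0: "of_int s \<noteq> (0 :: 'p mod_ring)" using s of_int_mod_ring_eq_0_iff by metis
    have P1: "P 1 = f" by (simp add: P_def)
    have pr: "prime_elem (?h f)" using irr[of 1] P1 by (simp add: prime_elem_iff_irreducible)
    then have "?h f dvd ?h H ^ 2" unfolding eq by (simp add: dvd_smult)
    then obtain G where G: "?h H = ?h f * G" using pr prime_elem_dvd_power by blast
    have "?h f * (?h f * G ^ 2) = ?h f * smult (of_int s) (?h (P (Suc k)))"
      using eq by (simp add: G power2_eq_square mult_ac)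
    moreover have "?h f \<noteq> 0" using pr by (simp add: prime_elem_def)
    ultimately have "?h f * G ^ 2 = smult (of_int s) (?h (P (Suc k)))"
      by (rule mult_left_cancel[THEN iffD1, rotated])
    then have "?h f dvd smult (of_int s) (?h (P (Suc k)))" by (metis dvd_triv_left)
    then have dv: "?h f dvd ?h (P (Suc k))" using s0 by (simp add: dvd_smult_iff)
    then obtain Q where Q: "?h (P (Suc k)) = ?h f * Q" by blast
    have "\<not> ?h f dvd 1" using pr by (rule prime_elem_not_unit)
    moreover have "irreducible (?h (P (Suc k)))" by (rule irr) simp
    ultimately have "Q dvd 1" using irreducibleD[OF _ Q] by blast
    then have "degree (?h (P (Suc k))) = degree (?h f)"
      using Q pr by (subst Q, subst degree_mult_eq) (auto simp: prime_elem_def is_unit_iff_degree)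
    moreover have "degree (?h f) = degree f ^ 1" using degP[of 1] P1 by simp
    ultimately have "degree f ^ Suc k = degree f ^ 1" using degP[of "Suc k"] by simp
    moreover have "degree f > 1" using d by (cases "degree f = 1") auto
    ultimately show False using k by (simp only: power_inject_exp) 
  qed
  ultimately show "(\<forall>n\<ge>2. \<forall>t.
        \<not> [lead_coeff (poly_iterate f n) * hval (poly_iterate f n) (degree f ^ n) a b = t\<^sup>2] (mod int ?p)) \<and>
     (\<forall>k\<ge>1. \<forall>H s. \<not> int ?p dvd s \<longrightarrow> H\<^sup>2 \<noteq> smult s (f * poly_iterate f (Suc k)))"
    by (auto simp: P_def)
qed

text \<open>
  The typed argument applies to every prime that is the cardinality of a type. A type whose
  cardinality is a counterexample, if there is one, therefore rules out counterexamples
  among all primes.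
\<close>

definition obstruction_prime :: nat where
  "obstruction_prime =
     (if \<exists>p. prime p \<and> \<not> iterate_obstruction p then SOME p. prime p \<and> \<not> iterate_obstruction p else 2)"

lemma prime_obstruction_prime: "prime obstruction_prime"
  using someI_ex[of "\<lambda>p. prime p \<and> \<not> iterate_obstruction p"] by (auto simp: obstruction_prime_def)

typedef obstruction_index = "{0..<obstruction_prime}"
  using prime_gt_0_nat[OF prime_obstruction_prime] by auto

instance obstruction_index :: prime_card
  by standard
    (simp add: type_definition.card[OF type_definition_obstruction_index] prime_obstruction_prime)

theorem iterate_obstruction_prime:
  assumes "prime p"
  shows "iterate_obstruction p"
proof (rule ccontr)
  assume "\<not> iterate_obstruction p"
  then have ex: "\<exists>p. prime p \<and> \<not> iterate_obstruction p" using assms by auto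
  have "\<not> iterate_obstruction obstruction_prime"
    using someI_ex[OF ex] ex by (simp add: obstruction_prime_def)
  moreover have "CARD(obstruction_index) = obstruction_prime"
    by (simp add: type_definition.card[OF type_definition_obstruction_index])
  ultimately show False using iterate_obstruction_CARD[where 'p = obstruction_index] by simp
qed

section \<open>Selberg weights\<close>

definition mu :: "nat \<Rightarrow> real" where
  "mu n = (if squarefree n then (- 1) ^ card (prime_factors n) else 0)"

lemma mu_1 [simp]: "mu 1 = 1" "mu (Suc 0) = 1"
  by (simp_all add: mu_def)

lemma abs_mu_le: "\<bar>mu n\<bar> \<le> 1"
  by (simp add: mu_def)

lemma mu_square: "mu n ^ 2 = (if squarefree n then 1 else 0)"
  by (simp add: mu_def flip: power_mult)

lemma mu_prime_mult:
  assumes q: "prime q" and d: "\<not> q dvd d"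
  shows "mu (q * d) = - mu d"
proof -
  have d0: "d \<noteq> 0" using d by (metis dvd_0_right)
  have cop: "coprime q d" using q d by (rule prime_imp_coprime)
  have sq: "squarefree (q * d) \<longleftrightarrow> squarefree d"
    using cop q squarefree_mult_coprime[of q d] squarefree_prime[of q]
    by (auto intro: squarefree_multD)
  have "prime_factors (q * d) = insert q (prime_factors d)"
    using q d0 by (simp add: prime_factorization_mult prime_factorization_prime)
  moreover have "q \<notin> prime_factors d" using d by auto
  ultimately show ?thesis by (simp add: mu_def sq)
qed

text \<open>For a prime \<open>q\<close> of \<open>n\<close>, multiplication by \<open>q\<close>
  flips the sign and pairs the divisors prime to \<open>q\<close> with those divisible by it exactly
  once; \<open>mu\<close> vanishes at the rest.\<close>

lemma sum_mu_divisors: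
  assumes n: "n > 0"
  shows "(\<Sum>d | d dvd n. mu d) = (if n = 1 then 1 else 0)"
proof (cases "n = 1")
  case False
  then obtain q where q: "prime q" "q dvd n" using prime_factor_nat by auto
  have fin: "finite {d. d dvd n}" using n by simp
  define A where "A = {d. d dvd n \<and> \<not> q dvd d}"
  define B where "B = {d. d dvd n \<and> q dvd d}"
  have AB: "{d. d dvd n} = A \<union> B" "A \<inter> B = {}" by (auto simp: A_def B_def)
  have finAB: "finite A" "finite B" using fin by (auto simp: A_def B_def)
  have "(\<Sum>d\<in>B. mu d) = (\<Sum>d\<in>(\<lambda>d. q * d) ` A. mu d)"
  proof (rule sum.mono_neutral_right[OF finAB(2)])
    show "(\<lambda>d. q * d) ` A \<subseteq> B"
      using q by (auto simp: A_def B_def prime_imp_coprime intro!: divides_mult)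
    show "\<forall>i\<in>B - (\<lambda>d. q * d) ` A. mu i = 0"
    proof
      fix i assume i: "i \<in> B - (\<lambda>d. q * d) ` A"
      then obtain d where d: "i = q * d" by (auto simp: B_def)
      have "d dvd n" using i d by (auto simp: B_def intro: dvd_trans)
      then have "q dvd d" using i d by (auto simp: A_def)
      then have "q ^ 2 dvd i" using d by (simp add: power2_eq_square mult_dvd_mono)
      then have "\<not> squarefree i" using q squarefreeD[of i q] by (auto simp: prime_nat_iff)
      then show "mu i = 0" by (simp add: mu_def)
    qed
  qed
  also have "\<dots> = (\<Sum>d\<in>A. mu (q * d))"
    using q by (subst sum.reindex) (auto simp: inj_on_def)
  also have "\<dots> = (\<Sum>d\<in>A. - mu d)"
    using mu_prime_mult[OF q(1)] by (intro sum.cong) (auto simp: A_def)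
  finally show ?thesis using False
    by (simp add: AB sum.union_disjoint[OF finAB AB(2)] sum_negf)
qed (simp add: )

lemma sum_inverse_squares_le: "(\<Sum>k=1..n. 1 / real k ^ 2) \<le> 2"
proof -
  have *: "(\<Sum>k=1..n. 1 / real k ^ 2) \<le> 2 - 1 / real n" if "n > 0" for n
    using that
  proof (induction n rule: nat_induct_non_zero)
    case (Suc n)
    have "1 / real (Suc n) ^ 2 \<le> 1 / real n - 1 / real (Suc n)"
    proof -
      have "1 / real (Suc n) ^ 2 \<le> 1 / (real n * real (Suc n))"
        using Suc.hyps by (intro divide_left_mono) (auto simp: power2_eq_square)
      also have "\<dots> = 1 / real n - 1 / real (Suc n)"
        using Suc.hyps by (simp add: field_simps)
      finally show ?thesis .
    qed
    then show ?case using Suc by simp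
  qed simp
  have "1 / real n \<ge> 0" by simp
  then show ?thesis using *[of n] by (cases "n = 0") (simp, linarith)
qed

text \<open>Every integer up to \<open>z\<close> is a squarefree number times a square, so the
  harmonic sum is at most the squarefree sum times a partial sum of \<open>1 / k^2\<close>, which is
  at most 2.\<close>

lemma sum_squarefree_ge:
  "ln (real z) / 2 \<le> (\<Sum>e\<in>{1..z}. mu e ^ 2 / real e)" if z: "z > 0"
proof -
  define S where "S = {e \<in> {1..z}. squarefree e}"
  have "ln (real z) \<le> ln (real z + 1)" using z by simp
  also have "\<dots> \<le> (\<Sum>n=1..z. 1 / real n)"
    using harm_ge_ln[of z] by (simp add: harm_def inverse_eq_divide)
  also have "\<dots> \<le> (\<Sum>x\<in>S \<times> {1..z}. 1 / (real (fst x) * real (snd x) ^ 2))"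
  proof -
    define h where "h n = (squarefree_part n, square_part n)" for n :: nat
    have dec: "n = fst (h n) * snd (h n) ^ 2" for n
      unfolding h_def using squarefree_decompose[of n] by simp
    have inj: "inj_on h {1..z}" using dec by (metis inj_onI)
    have sub: "h ` {1..z} \<subseteq> S \<times> {1..z}"
    proof
      fix x assume "x \<in> h ` {1..z}"
      then obtain n where n: "n \<in> {1..z}" "x = h n" by auto
      have "fst (h n) dvd n" "snd (h n) dvd n" using dec[of n]
        by (metis dvd_triv_left, metis dec dvd_mult dvd_triv_left power2_eq_square)
      moreover have "n > 0" using n by simp
      ultimately have "fst (h n) \<le> n" "snd (h n) \<le> n" "fst (h n) > 0" "snd (h n) > 0"
        by (simp_all add: dvd_imp_le dvd_pos_nat)
      moreover have "squarefree (fst (h n))" using n by (simp add: h_def)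
      ultimately show "x \<in> S \<times> {1..z}" using n by (auto simp: S_def mem_Times_iff)
    qed
    have "(\<Sum>n=1..z. 1 / real n) = (\<Sum>n=1..z. 1 / (real (fst (h n)) * real (snd (h n)) ^ 2))"
      by (intro sum.cong refl) (metis dec of_nat_mult of_nat_power)
    also have "\<dots> = (\<Sum>x\<in>h ` {1..z}. 1 / (real (fst x) * real (snd x) ^ 2))"
      using inj by (simp add: sum.reindex)
    also have "\<dots> \<le> (\<Sum>x\<in>S \<times> {1..z}. 1 / (real (fst x) * real (snd x) ^ 2))"
      by (rule sum_mono2) (use sub in \<open>auto simp: S_def\<close>)
    finally show ?thesis .
  qed
  also have "\<dots> = (\<Sum>e\<in>S. 1 / real e) * (\<Sum>k=1..z. 1 / real k ^ 2)"
    by (simp add: sum_product sum.cartesian_product case_prod_beta)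
  also have "\<dots> \<le> (\<Sum>e\<in>S. 1 / real e) * 2"
    by (intro mult_left_mono sum_inverse_squares_le sum_nonneg) auto
  also have "(\<Sum>e\<in>S. 1 / real e) = (\<Sum>e\<in>{1..z}. mu e ^ 2 / real e)"
    unfolding S_def by (subst sum.inter_filter) (auto simp: mu_square intro!: sum.cong)
  finally show ?thesis by simp
qed

text \<open>Selberg's diagonalisation: writing the gcd as a sum of totients over common divisors
  turns the form into \<open>\<Sum> totient e * y e ^ 2\<close>. The \<open>y\<close> chosen here
  has \<open>e\<close> where the optimal choice has the totient of \<open>e\<close>. It still gives
  \<open>lam 1 = 1\<close> and a value at most \<open>1 / G\<close>, and it keeps the lower bound
  for \<open>G\<close> elementary. The pointwise bound on \<open>lam\<close> is crude because it
  enters only error terms.\<close>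

lemma selberg_weights:
  assumes z: "z \<ge> 2"
  obtains lam :: "nat \<Rightarrow> real" where
    "lam 1 = 1" "\<And>d. d \<in> {1..z} \<Longrightarrow> \<bar>lam d\<bar> \<le> real z * real z * 2 / ln z"
    "(\<Sum>d\<in>{1..z}. \<Sum>d'\<in>{1..z}. lam d * lam d' / real (lcm d d')) \<le> 2 / ln z"
proof -
  define G where "G = (\<Sum>e\<in>{1..z}. mu e ^ 2 / real e)"
  have lnz: "ln (real z) > 0" using z by simp
  have G: "G \<ge> ln z / 2" unfolding G_def using z by (intro sum_squarefree_ge) auto
  then have G0: "G > 0" using lnz by linarith
  define y where "y e = mu e / (real e * G)" for e
  define lam where "lam d = real d * (\<Sum>t | t \<in> {1..z} \<and> d dvd t. mu (t div d) * y t)" for d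
  \<comment> \<open>Moebius inversion over multiples recovers \<open>y\<close> from
    \<open>lam\<close>.\<close>
  have inv: "(\<Sum>d | d \<in> {1..z} \<and> e dvd d. lam d / real d) = y e" if e: "e \<in> {1..z}" for e
  proof -
    have "(\<Sum>d | d \<in> {1..z} \<and> e dvd d. lam d / real d) =
      (\<Sum>d | d \<in> {1..z} \<and> e dvd d. \<Sum>t | t \<in> {1..z} \<and> d dvd t. mu (t div d) * y t)"
      by (intro sum.cong) (auto simp: lam_def)
    also have "\<dots> = (\<Sum>d\<in>{1..z}. \<Sum>t\<in>{1..z}. if e dvd d \<and> d dvd t then mu (t div d) * y t else 0)"
      by (simp only: sum.inter_filter finite_atLeastAtMost) (intro sum.cong refl, auto)
    also have "\<dots> = (\<Sum>t\<in>{1..z}. \<Sum>d\<in>{1..z}. if e dvd d \<and> d dvd t then mu (t div d) * y t else 0)"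
      by (rule sum.swap)
    also have "\<dots> = (\<Sum>t\<in>{1..z}. if t = e then y t else 0)"
    proof (rule sum.cong)
      fix t assume t: "t \<in> {1..z}"
      have "(\<Sum>d\<in>{1..z}. if e dvd d \<and> d dvd t then mu (t div d) * y t else 0) =
        (\<Sum>d | d \<in> {1..z} \<and> e dvd d \<and> d dvd t. mu (t div d)) * y t"
        by (simp only: sum.inter_filter[symmetric] finite_atLeastAtMost sum_distrib_right)
      also have "(\<Sum>d | d \<in> {1..z} \<and> e dvd d \<and> d dvd t. mu (t div d)) = (if t = e then 1 else 0)"
      proof (cases "e dvd t")
        case True
        then obtain m where m: "t = e * m" by auto
        have m0: "m > 0" "e > 0" using t m e by auto
        have "(\<Sum>d | d \<in> {1..z} \<and> e dvd d \<and> d dvd t. mu (t div d)) = (\<Sum>k | k dvd m. mu k)"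
        proof (rule sum.reindex_bij_witness[of _ "\<lambda>k. e * (m div k)" "\<lambda>d. t div d"])
          fix d assume d: "d \<in> {d. d \<in> {1..z} \<and> e dvd d \<and> d dvd t}"
          then obtain k where k: "d = e * k" by auto
          have km: "k dvd m" using d k m m0 by auto
          then obtain l where l: "m = k * l" by auto
          have k0: "k > 0" "l > 0" using l m0 by auto
          have td: "t div d = l" using m l k m0 k0 by simp
          show "e * (m div (t div d)) = d" using td l k k0 by simp
          show "t div d \<in> {k. k dvd m}" using td l by simp
        next
          fix k assume k: "k \<in> {k. k dvd m}"
          then obtain l where l: "m = k * l" by auto
          have k0: "k > 0" "l > 0" using l m0 by auto
          show "t div (e * (m div k)) = k" using m l k0 m0 by simp
          have "e * l dvd t" using m l by simp
          then have "e * l \<le> t" using t by (intro dvd_imp_le) auto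
          then have "e * l \<le> z" using t by simp
          then show "e * (m div k) \<in> {d. d \<in> {1..z} \<and> e dvd d \<and> d dvd t}"
            using m l k0 m0 by simp
        qed simp
        then show ?thesis using sum_mu_divisors[OF m0(1)] m m0 by simp
      next
        case False
        then have "{d. d \<in> {1..z} \<and> e dvd d \<and> d dvd t} = {}" by (auto intro: dvd_trans)
        moreover have "t \<noteq> e" using False by auto
        ultimately show ?thesis by (simp only: sum.empty if_False)
      qed
      finally show "(\<Sum>d\<in>{1..z}. if e dvd d \<and> d dvd t then mu (t div d) * y t else 0) =
        (if t = e then y t else 0)" by simp
    qed simp
    also have "\<dots> = y e" using e by simp
    finally show ?thesis .
  qed
  show thesis
  proof
    have "lam 1 = (\<Sum>t\<in>{1..z}. mu t * y t)"
    proof -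
      have "{t. t \<in> {1..z} \<and> 1 dvd t} = {1..z}" by auto
      then show ?thesis by (simp only: lam_def of_nat_1 mult_1 div_by_1)
    qed
    also have "\<dots> = G / G"
      unfolding y_def G_def sum_divide_distrib by (intro sum.cong) (auto simp: power2_eq_square)
    finally show "lam 1 = 1" using G0 by simp
  next
    fix d assume d: "d \<in> {1..z}"
    have "\<bar>\<Sum>t | t \<in> {1..z} \<and> d dvd t. mu (t div d) * y t\<bar> \<le> (\<Sum>t | t \<in> {1..z} \<and> d dvd t. \<bar>mu (t div d) * y t\<bar>)"
      by (rule sum_abs)
    also have "\<dots> \<le> (\<Sum>t | t \<in> {1..z} \<and> d dvd t. 2 / ln z)"
    proof (rule sum_mono)
      fix t assume t: "t \<in> {t. t \<in> {1..z} \<and> d dvd t}"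
      have "\<bar>y t\<bar> = \<bar>mu t\<bar> / (real t * G)" using G0 by (simp add: y_def abs_mult)
      also have "\<dots> \<le> 1 / (1 * (ln z / 2))"
        using t G lnz abs_mu_le by (intro frac_le mult_mono) auto
      finally have y: "\<bar>y t\<bar> \<le> 2 / ln z" by simp
      have "\<bar>mu (t div d)\<bar> * \<bar>y t\<bar> \<le> 1 * (2 / ln z)"
        using y abs_mu_le by (intro mult_mono) auto
      then show "\<bar>mu (t div d) * y t\<bar> \<le> 2 / ln z" by (simp add: abs_mult)
    qed
    also have "\<dots> = real (card {t. t \<in> {1..z} \<and> d dvd t}) * (2 / ln z)" by simp
    also have "\<dots> \<le> real z * (2 / ln z)"
    proof -
      have "card {t. t \<in> {1..z} \<and> d dvd t} \<le> card {1..z}" by (rule card_mono) auto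
      then show ?thesis using lnz by (intro mult_right_mono) auto
    qed
    finally have "real d * \<bar>\<Sum>t | t \<in> {1..z} \<and> d dvd t. mu (t div d) * y t\<bar> \<le> real d * (real z * (2 / ln z))"
      by (rule mult_left_mono) simp
    then have "\<bar>lam d\<bar> \<le> real d * (real z * (2 / ln z))"
      by (simp only: lam_def abs_mult abs_of_nat)
    also have "\<dots> \<le> real z * (real z * (2 / ln z))"
      using d lnz by (intro mult_right_mono) auto
    finally show "\<bar>lam d\<bar> \<le> real z * real z * 2 / ln z" by simp
  next
    have "(\<Sum>d\<in>{1..z}. \<Sum>d'\<in>{1..z}. lam d * lam d' / real (lcm d d')) =
      (\<Sum>d\<in>{1..z}. \<Sum>d'\<in>{1..z}. \<Sum>e\<in>{1..z}. if e dvd d \<and> e dvd d' then real (totient e) * (lam d / real d) * (lam d' / real d') else 0)"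
    proof (intro sum.cong refl)
      fix d d' assume dd: "d \<in> {1..z}" "d' \<in> {1..z}"
      have g0: "gcd d d' > 0" using dd by auto
      have "real (gcd d d') = (\<Sum>e | e dvd gcd d d'. real (totient e))"
        using totient_divisor_sum[of "gcd d d'"] by (metis of_nat_sum)
      also have "\<dots> = (\<Sum>e | e \<in> {1..z} \<and> e dvd d \<and> e dvd d'. real (totient e))"
      proof -
        have "e \<in> {1..z}" if "e dvd d" for e
          using that dd dvd_imp_le[OF that] by (auto intro!: Suc_leI dvd_pos_nat[OF _ that])
        then have "{e. e dvd gcd d d'} = {e. e \<in> {1..z} \<and> e dvd d \<and> e dvd d'}" by auto
        then show ?thesis by simp
      qed
      finally have g: "real (gcd d d') = (\<Sum>e | e \<in> {1..z} \<and> e dvd d \<and> e dvd d'. real (totient e))" .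
      have "real (gcd d d') * real (lcm d d') = real d * real d'"
        by (metis of_nat_mult prod_gcd_lcm_nat)
      moreover have "real (lcm d d') > 0" using dd by (simp add: lcm_pos_nat)
      ultimately have "lam d * lam d' / real (lcm d d') = real (gcd d d') * (lam d / real d) * (lam d' / real d')"
        using dd by (simp add: field_simps)
      then show "lam d * lam d' / real (lcm d d') =
        (\<Sum>e\<in>{1..z}. if e dvd d \<and> e dvd d' then real (totient e) * (lam d / real d) * (lam d' / real d') else 0)"
        unfolding g by (simp only: sum.inter_filter[symmetric] finite_atLeastAtMost sum_distrib_right)
    qed
    also have "\<dots> = (\<Sum>d\<in>{1..z}. \<Sum>e\<in>{1..z}. \<Sum>d'\<in>{1..z}. if e dvd d \<and> e dvd d' then real (totient e) * (lam d / real d) * (lam d' / real d') else 0)"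
      by (intro sum.cong refl sum.swap)
    also have "\<dots> = (\<Sum>e\<in>{1..z}. \<Sum>d\<in>{1..z}. \<Sum>d'\<in>{1..z}. if e dvd d \<and> e dvd d' then real (totient e) * (lam d / real d) * (lam d' / real d') else 0)"
      by (rule sum.swap)
    also have "\<dots> = (\<Sum>e\<in>{1..z}. real (totient e) * y e ^ 2)"
    proof (intro sum.cong refl)
      fix e assume e: "e \<in> {1..z}"
      have y: "y e = (\<Sum>d\<in>{1..z}. if e dvd d then lam d / real d else 0)"
        using inv[OF e] by (simp only: sum.inter_filter finite_atLeastAtMost)
      show "(\<Sum>d\<in>{1..z}. \<Sum>d'\<in>{1..z}. if e dvd d \<and> e dvd d' then real (totient e) * (lam d / real d) * (lam d' / real d') else 0)
          = real (totient e) * y e ^ 2"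
        unfolding y power2_eq_square sum_product
        unfolding sum_distrib_left by (intro sum.cong refl) auto
    qed
    also have "\<dots> \<le> (\<Sum>e\<in>{1..z}. mu e ^ 2 / real e / G ^ 2)"
    proof (rule sum_mono)
      fix e assume e: "e \<in> {1..z}"
      have "real (totient e) * y e ^ 2 \<le> real e * y e ^ 2"
        by (intro mult_right_mono) (auto simp: totient_le)
      also have "\<dots> = mu e ^ 2 / real e / G ^ 2"
        using e by (simp add: y_def power_divide power_mult_distrib field_simps power2_eq_square)
      finally show "real (totient e) * y e ^ 2 \<le> mu e ^ 2 / real e / G ^ 2" .
    qed
    also have "\<dots> = G / G ^ 2" by (simp add: G_def sum_divide_distrib)
    also have "\<dots> = 1 / G" using G0 by (simp add: power2_eq_square)
    also have "\<dots> \<le> 1 / (ln z / 2)" using G lnz by (intro divide_left_mono) auto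
    finally show "(\<Sum>d\<in>{1..z}. \<Sum>d'\<in>{1..z}. lam d * lam d' / real (lcm d d')) \<le> 2 / ln z" by simp
  qed
qed

section \<open>Sieve-weighted character sums\<close>

text \<open>Full periods cancel, which leaves a segment shorter than \<open>M\<close> at either end.
  Nothing finer is used, since the moduli will be at most Q^(1/4).\<close>

lemma periodic_sum_bound:
  fixes \<psi> :: "nat \<Rightarrow> real"
  assumes M: "M > 0" and per: "\<And>n. \<psi> (n + M) = \<psi> n" and zero: "(\<Sum>n<M. \<psi> n) = 0"
    and bd: "\<And>n. \<bar>\<psi> n\<bar> \<le> 1"
  shows "\<bar>\<Sum>n\<in>{A<..B}. \<psi> n\<bar> \<le> 2 * real M"
proof -
  have split: "(\<Sum>n<a + b. \<psi> n) = (\<Sum>n<a. \<psi> n) + (\<Sum>n<b. \<psi> (a + n))" for a b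
    by (induction b) auto
  have per': "\<psi> (M * k + n) = \<psi> n" for k n
  proof (induction k)
    case (Suc k)
    have "M * Suc k + n = (M * k + n) + M" by simp
    then show ?case using Suc per by metis
  qed simp
  have *: "\<bar>\<Sum>n<N. \<psi> n\<bar> \<le> real M" for N
  proof -
    have z: "(\<Sum>n<M * k. \<psi> n) = 0" for k
    proof (induction k)
      case (Suc k)
      have "M * Suc k = M * k + M" by simp
      then show ?case using Suc zero by (simp only: split per')
    qed simp
    have "(\<Sum>n<N. \<psi> n) = (\<Sum>n<M * (N div M) + N mod M. \<psi> n)" by simp
    also have "\<dots> = (\<Sum>n<N mod M. \<psi> n)" unfolding split by (simp only: z per' add_0)
    finally have "\<bar>\<Sum>n<N. \<psi> n\<bar> \<le> (\<Sum>n<N mod M. \<bar>\<psi> n\<bar>)" by (simp add: sum_abs)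
    also have "\<dots> \<le> (\<Sum>n<N mod M. 1)" by (intro sum_mono bd)
    also have "\<dots> \<le> real M" using M by (simp add: less_imp_le)
    finally show ?thesis .
  qed
  show ?thesis
  proof (cases "A \<le> B")
    case True
    have "{..<Suc B} = {..<Suc A} \<union> {A<..B}" "{..<Suc A} \<inter> {A<..B} = {}" using True by auto
    then have "(\<Sum>n<Suc B. \<psi> n) = (\<Sum>n<Suc A. \<psi> n) + (\<Sum>n\<in>{A<..B}. \<psi> n)"
      by (simp only: sum.union_disjoint finite_lessThan finite_greaterThanAtMost)
    then show ?thesis using *[of "Suc A"] *[of "Suc B"] by linarith
  next
    case False
    then have "{A<..B} = {}" by auto
    then show ?thesis by (simp only: sum.empty)
  qed
qed

lemma multiples_interval:
  fixes l :: nat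
  assumes "l > 0"
  shows "{n \<in> {A<..B}. l dvd n} = (\<lambda>k. l * k) ` {A div l<..B div l}"
proof (intro equalityI subsetI)
  fix n assume n: "n \<in> {n \<in> {A<..B}. l dvd n}"
  then obtain k where k: "n = l * k" by auto
  have "A < k * l" "k * l \<le> B" using n k by (auto simp: mult.commute)
  then have "k \<in> {A div l<..B div l}"
    using assms by (simp add: div_less_iff_less_mult less_eq_div_iff_mult_less_eq)
  then show "n \<in> (\<lambda>k. l * k) ` {A div l<..B div l}" using k by blast
next
  fix n assume "n \<in> (\<lambda>k. l * k) ` {A div l<..B div l}"
  then show "n \<in> {n \<in> {A<..B}. l dvd n}"
    using assms by (auto simp: div_less_iff_less_mult less_eq_div_iff_mult_less_eq mult.commute)
qed

lemma card_multiples_interval: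
  fixes l :: nat
  assumes "l > 0" "A \<le> B"
  shows "\<bar>real (card {n \<in> {A<..B}. l dvd n}) - (real B - real A) / real l\<bar> \<le> 1"
proof -
  have "card {n \<in> {A<..B}. l dvd n} = B div l - A div l"
    unfolding multiples_interval[OF assms(1)] using assms by (subst card_image) (auto simp: inj_on_def)
  moreover have "A div l \<le> B div l" using assms by (simp add: div_le_mono)
  ultimately have c: "real (card {n \<in> {A<..B}. l dvd n}) = real (B div l) - real (A div l)" by simp
  have "real (B div l) = real_of_int \<lfloor>real B / real l\<rfloor>" "real (A div l) = real_of_int \<lfloor>real A / real l\<rfloor>"
    by (simp_all add: floor_divide_of_nat_eq)
  then show ?thesis unfolding c diff_divide_distrib by linarith
qed

text \<open>The weight \<open>w\<close> is left arbitrary so that one expansion serves both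
  character sums and plain counts.\<close>

lemma sieve_quadratic_form:
  fixes lam w :: "nat \<Rightarrow> real"
  shows "(\<Sum>n\<in>{A<..B}. (\<Sum>d | d \<in> {1..z} \<and> d dvd n. lam d)\<^sup>2 * w n) =
    (\<Sum>d\<in>{1..z}. \<Sum>d'\<in>{1..z}. lam d * lam d' * (\<Sum>n | n \<in> {A<..B} \<and> lcm d d' dvd n. w n))"
proof -
  have "(\<Sum>n\<in>{A<..B}. (\<Sum>d | d \<in> {1..z} \<and> d dvd n. lam d)\<^sup>2 * w n) =
    (\<Sum>n\<in>{A<..B}. \<Sum>d\<in>{1..z}. \<Sum>d'\<in>{1..z}. if d dvd n \<and> d' dvd n then lam d * lam d' * w n else 0)"
  proof (rule sum.cong[OF refl])
    fix n
    have "(\<Sum>d | d \<in> {1..z} \<and> d dvd n. lam d) = (\<Sum>d\<in>{1..z}. if d dvd n then lam d else 0)"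
      by (simp only: sum.inter_filter finite_atLeastAtMost)
    then have "(\<Sum>d | d \<in> {1..z} \<and> d dvd n. lam d)\<^sup>2 * w n =
      (\<Sum>d\<in>{1..z}. \<Sum>d'\<in>{1..z}. (if d dvd n then lam d else 0) * (if d' dvd n then lam d' else 0)) * w n"
      by (simp only: power2_eq_square sum_product)
    also have "\<dots> = (\<Sum>d\<in>{1..z}. \<Sum>d'\<in>{1..z}. (if d dvd n then lam d else 0) * (if d' dvd n then lam d' else 0) * w n)"
      by (simp only: sum_distrib_right)
    also have "\<dots> = (\<Sum>d\<in>{1..z}. \<Sum>d'\<in>{1..z}. if d dvd n \<and> d' dvd n then lam d * lam d' * w n else 0)"
      by (intro sum.cong refl) auto
    finally show "(\<Sum>d | d \<in> {1..z} \<and> d dvd n. lam d)\<^sup>2 * w n =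
      (\<Sum>d\<in>{1..z}. \<Sum>d'\<in>{1..z}. if d dvd n \<and> d' dvd n then lam d * lam d' * w n else 0)" .
  qed
  also have "\<dots> = (\<Sum>d\<in>{1..z}. \<Sum>n\<in>{A<..B}. \<Sum>d'\<in>{1..z}. if d dvd n \<and> d' dvd n then lam d * lam d' * w n else 0)"
    by (rule sum.swap)
  also have "\<dots> = (\<Sum>d\<in>{1..z}. \<Sum>d'\<in>{1..z}. \<Sum>n\<in>{A<..B}. if d dvd n \<and> d' dvd n then lam d * lam d' * w n else 0)"
    by (intro sum.cong refl sum.swap)
  also have "\<dots> = (\<Sum>d\<in>{1..z}. \<Sum>d'\<in>{1..z}. lam d * lam d' * (\<Sum>n | n \<in> {A<..B} \<and> lcm d d' dvd n. w n))"
    by (simp only: sum.inter_filter finite_greaterThanAtMost sum_distrib_left)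
      (intro sum.cong refl, auto)
  finally show ?thesis .
qed

text \<open>Complete multiplicativity takes the factor \<open>\<psi> (lcm d d')\<close> out of the
  sum over multiples and leaves a sum of \<open>\<psi>\<close> over consecutive integers.\<close>

lemma sieve_character_sum:
  fixes lam \<psi> :: "nat \<Rightarrow> real"
  assumes lam: "\<And>d. d \<in> {1..z} \<Longrightarrow> \<bar>lam d\<bar> \<le> \<Lambda>" and "\<Lambda> \<ge> 0"
    and M: "M > 0" "\<And>n. \<psi> (n + M) = \<psi> n" "(\<Sum>n<M. \<psi> n) = 0" "\<And>n. \<bar>\<psi> n\<bar> \<le> 1"
    and mult: "\<And>m n. \<psi> (m * n) = \<psi> m * \<psi> n"
  shows "(\<Sum>n\<in>{A<..B}. (\<Sum>d | d \<in> {1..z} \<and> d dvd n. lam d)\<^sup>2 * \<psi> n) \<le> (real z * \<Lambda>)\<^sup>2 * (2 * real M)"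
proof -
  have *: "\<bar>\<Sum>n | n \<in> {A<..B} \<and> l dvd n. \<psi> n\<bar> \<le> 2 * real M" if l: "l > 0" for l
  proof -
    have "(\<Sum>n | n \<in> {A<..B} \<and> l dvd n. \<psi> n) = (\<Sum>k\<in>{A div l<..B div l}. \<psi> (l * k))"
      unfolding multiples_interval[OF l] using l by (subst sum.reindex) (auto simp: inj_on_def)
    also have "\<dots> = \<psi> l * (\<Sum>k\<in>{A div l<..B div l}. \<psi> k)"
      by (simp add: mult sum_distrib_left)
    finally have "\<bar>\<Sum>n | n \<in> {A<..B} \<and> l dvd n. \<psi> n\<bar> = \<bar>\<psi> l\<bar> * \<bar>\<Sum>k\<in>{A div l<..B div l}. \<psi> k\<bar>"
      by (simp add: abs_mult)
    also have "\<dots> \<le> 1 * (2 * real M)"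
      by (intro mult_mono M(4) periodic_sum_bound[OF M]) auto
    finally show ?thesis by simp
  qed
  have "(\<Sum>n\<in>{A<..B}. (\<Sum>d | d \<in> {1..z} \<and> d dvd n. lam d)\<^sup>2 * \<psi> n) \<le>
    (\<Sum>d\<in>{1..z}. \<Sum>d'\<in>{1..z}. \<Lambda> * \<Lambda> * (2 * real M))"
    unfolding sieve_quadratic_form
  proof (intro sum_mono)
    fix d d' assume d: "d \<in> {1..z}" "d' \<in> {1..z}"
    have "\<bar>lam d * lam d' * (\<Sum>n | n \<in> {A<..B} \<and> lcm d d' dvd n. \<psi> n)\<bar> \<le> \<Lambda> * \<Lambda> * (2 * real M)"
      unfolding abs_mult using d assms(2)
      by (intro mult_mono lam *) (auto simp: lcm_pos_nat)
    then show "lam d * lam d' * (\<Sum>n | n \<in> {A<..B} \<and> lcm d d' dvd n. \<psi> n) \<le> \<Lambda> * \<Lambda> * (2 * real M)"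
      by linarith
  qed
  also have "\<dots> = (real z * \<Lambda>)\<^sup>2 * (2 * real M)" by (simp add: power2_eq_square)
  finally show ?thesis .
qed

text \<open>For pairs without cancellation. Counting the multiples of \<open>lcm d d'\<close> costs
  an error of at most 1, hence at most the square of \<open>\<Lambda>\<close> for each of the
  \<open>z^2\<close> pairs \<open>d\<close>, \<open>d'\<close>.\<close>

lemma sieve_main_sum:
  fixes lam w :: "nat \<Rightarrow> real"
  assumes lam: "\<And>d. d \<in> {1..z} \<Longrightarrow> \<bar>lam d\<bar> \<le> \<Lambda>" and "\<Lambda> \<ge> 0" and AB: "A \<le> B"
    and form: "(\<Sum>d\<in>{1..z}. \<Sum>d'\<in>{1..z}. lam d * lam d' / real (lcm d d')) \<le> g"
    and w: "\<And>n. w n \<le> 1"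
  shows "(\<Sum>n\<in>{A<..B}. (\<Sum>d | d \<in> {1..z} \<and> d dvd n. lam d)\<^sup>2 * w n) \<le>
    (real B - real A) * g + (real z * \<Lambda>)\<^sup>2"
proof -
  have "(\<Sum>n\<in>{A<..B}. (\<Sum>d | d \<in> {1..z} \<and> d dvd n. lam d)\<^sup>2 * w n) \<le>
    (\<Sum>n\<in>{A<..B}. (\<Sum>d | d \<in> {1..z} \<and> d dvd n. lam d)\<^sup>2 * 1)"
    by (intro sum_mono mult_left_mono w) auto
  also have "\<dots> \<le> (\<Sum>d\<in>{1..z}. \<Sum>d'\<in>{1..z}. (real B - real A) * (lam d * lam d' / real (lcm d d')) + \<Lambda> * \<Lambda>)"
    unfolding sieve_quadratic_form
  proof (intro sum_mono)
    fix d d' assume d: "d \<in> {1..z}" "d' \<in> {1..z}"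
    define c where "c = real (card {n \<in> {A<..B}. lcm d d' dvd n})"
    define c' where "c' = (real B - real A) / real (lcm d d')"
    have "\<bar>c - c'\<bar> \<le> 1"
      unfolding c_def c'_def by (rule card_multiples_interval[OF _ AB]) (use d in \<open>auto simp: lcm_pos_nat\<close>)
    then have "\<bar>lam d * lam d' * (c - c')\<bar> \<le> \<Lambda> * \<Lambda> * 1"
      unfolding abs_mult using d assms(2) by (intro mult_mono lam) auto
    moreover have "lam d * lam d' * (\<Sum>n | n \<in> {A<..B} \<and> lcm d d' dvd n. 1) =
      lam d * lam d' * c' + lam d * lam d' * (c - c')"
      by (simp add: c_def algebra_simps)
    moreover have "lam d * lam d' * c' = (real B - real A) * (lam d * lam d' / real (lcm d d'))"
      by (simp add: c'_def)
    ultimately show "lam d * lam d' * (\<Sum>n | n \<in> {A<..B} \<and> lcm d d' dvd n. 1) \<le>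
      (real B - real A) * (lam d * lam d' / real (lcm d d')) + \<Lambda> * \<Lambda>" by linarith
  qed
  also have "\<dots> = (real B - real A) * (\<Sum>d\<in>{1..z}. \<Sum>d'\<in>{1..z}. lam d * lam d' / real (lcm d d')) + (real z * \<Lambda>)\<^sup>2"
    by (simp add: sum.distrib sum_distrib_left power2_eq_square)
  also have "\<dots> \<le> (real B - real A) * g + (real z * \<Lambda>)\<^sup>2"
    using form AB by (intro add_right_mono mult_left_mono) auto
  finally show ?thesis .
qed

text \<open>Selberg's square is non-negative and equals 1 at primes beyond \<open>z\<close>, so the
  sum over \<open>P\<close> can be enlarged to the whole interval and the second moment expanded. A
  pair in \<open>R\<close> costs the sieve bound for the interval, any other pair only the error of
  a character sum.\<close>

lemma prime_large_values_bound:
  fixes \<psi> :: "'j \<Rightarrow> nat \<Rightarrow> real"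
  assumes z: "z \<ge> 2" and AB: "A \<le> B" and M: "M \<ge> 1"
    and J: "finite J" and R: "R \<subseteq> J \<times> J"
    and bd: "\<And>j n. j \<in> J \<Longrightarrow> \<bar>\<psi> j n\<bar> \<le> 1"
    and mult: "\<And>j m n. j \<in> J \<Longrightarrow> \<psi> j (m * n) = \<psi> j m * \<psi> j n"
    and per: "\<And>i j. (i, j) \<in> J \<times> J - R \<Longrightarrow> \<exists>m>0. real m \<le> M \<and>
       (\<forall>n. \<psi> i (n + m) * \<psi> j (n + m) = \<psi> i n * \<psi> j n) \<and> (\<Sum>n<m. \<psi> i n * \<psi> j n) = 0"
    and P: "\<And>p. p \<in> P \<Longrightarrow> prime p \<and> p \<in> {A<..B} \<and> p > z \<and> (\<Sum>j\<in>J. \<psi> j p)\<^sup>2 = real (card J) ^ 2"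
  shows "real (card P) * real (card J) ^ 2 \<le>
    real (card R) * ((real B - real A) * 2 / ln z) + real (card J) ^ 2 * (8 * real z ^ 6 / (ln z)\<^sup>2 * M)"
proof -
  obtain lam :: "nat \<Rightarrow> real" where lam: "lam 1 = 1"
    "\<And>d. d \<in> {1..z} \<Longrightarrow> \<bar>lam d\<bar> \<le> real z * real z * 2 / ln z"
    "(\<Sum>d\<in>{1..z}. \<Sum>d'\<in>{1..z}. lam d * lam d' / real (lcm d d')) \<le> 2 / ln z"
    by (rule selberg_weights[OF z]) (rule that)
  define \<Lambda> where "\<Lambda> = real z * real z * 2 / ln z"
  have \<Lambda>0: "\<Lambda> \<ge> 0" using z by (simp add: \<Lambda>_def)
  define W where "W n = (\<Sum>d | d \<in> {1..z} \<and> d dvd n. lam d)\<^sup>2" for n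
  define E where "E = (real z * \<Lambda>)\<^sup>2 * (2 * M)"
  have E: "E = 8 * real z ^ 6 / (ln z)\<^sup>2 * M"
  proof -
    have "real z * \<Lambda> = 2 * real z ^ 3 / ln z" by (simp add: \<Lambda>_def power3_eq_cube)
    then show ?thesis by (simp add: E_def power_divide power_mult_distrib flip: power_mult)
  qed
  have E1: "(real z * \<Lambda>)\<^sup>2 * (2 * real m) \<le> E" if "real m \<le> M" for m
    unfolding E_def using that by (intro mult_left_mono) auto
  have E2: "(real z * \<Lambda>)\<^sup>2 \<le> E"
    using mult_left_mono[of 1 "2 * M" "(real z * \<Lambda>)\<^sup>2"] M by (simp add: E_def)
  have finP: "finite P" by (rule finite_subset[of _ "{A<..B}"]) (use P in auto)
  have "real (card P) * real (card J) ^ 2 = (\<Sum>p\<in>P. W p * (\<Sum>j\<in>J. \<psi> j p)\<^sup>2)"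
  proof -
    have "W p * (\<Sum>j\<in>J. \<psi> j p)\<^sup>2 = real (card J) ^ 2" if p: "p \<in> P" for p
    proof -
      have "{d. d \<in> {1..z} \<and> d dvd p} = {1}"
        using P[OF p] z by (auto simp: prime_nat_iff)
      then have "W p = 1" unfolding W_def using lam(1) by (simp only:) simp
      then show ?thesis using P[OF p] by simp
    qed
    then show ?thesis by simp
  qed
  also have "\<dots> \<le> (\<Sum>n\<in>{A<..B}. W n * (\<Sum>j\<in>J. \<psi> j n)\<^sup>2)"
    by (rule sum_mono2) (use P in \<open>auto simp: W_def\<close>)
  also have "\<dots> = (\<Sum>n\<in>{A<..B}. \<Sum>i\<in>J. \<Sum>j\<in>J. W n * (\<psi> i n * \<psi> j n))"
    by (simp only: power2_eq_square sum_product) (simp only: sum_distrib_left)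
  also have "\<dots> = (\<Sum>i\<in>J. \<Sum>n\<in>{A<..B}. \<Sum>j\<in>J. W n * (\<psi> i n * \<psi> j n))"
    by (rule sum.swap)
  also have "\<dots> = (\<Sum>i\<in>J. \<Sum>j\<in>J. \<Sum>n\<in>{A<..B}. W n * (\<psi> i n * \<psi> j n))"
    by (intro sum.cong refl sum.swap)
  also have "\<dots> \<le> (\<Sum>i\<in>J. \<Sum>j\<in>J. (if (i, j) \<in> R then (real B - real A) * 2 / ln z else 0) + E)"
  proof (intro sum_mono)
    fix i j assume ij: "i \<in> J" "j \<in> J"
    show "(\<Sum>n\<in>{A<..B}. W n * (\<psi> i n * \<psi> j n)) \<le> (if (i, j) \<in> R then (real B - real A) * 2 / ln z else 0) + E"
    proof (cases "(i, j) \<in> R")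
      case True
      have "\<psi> i n * \<psi> j n \<le> 1" for n
      proof -
        have "\<bar>\<psi> i n\<bar> * \<bar>\<psi> j n\<bar> \<le> 1 * 1" using ij by (intro mult_mono bd) auto
        then show ?thesis by (simp flip: abs_mult)
      qed
      then have "(\<Sum>n\<in>{A<..B}. W n * (\<psi> i n * \<psi> j n)) \<le> (real B - real A) * (2 / ln z) + (real z * \<Lambda>)\<^sup>2"
        unfolding W_def by (intro sieve_main_sum lam(3) AB \<Lambda>0) (use lam(2) in \<open>auto simp: \<Lambda>_def\<close>)
      then show ?thesis using True E2 by simp
    next
      case False
      then obtain m where m: "m > 0" "real m \<le> M" "\<And>n. \<psi> i (n + m) * \<psi> j (n + m) = \<psi> i n * \<psi> j n"
        "(\<Sum>n<m. \<psi> i n * \<psi> j n) = 0" using per[of i j] ij by blast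
      have "\<bar>\<psi> i n * \<psi> j n\<bar> \<le> 1" for n
        using mult_mono[OF bd[OF ij(1), of n] bd[OF ij(2), of n]] by (simp add: abs_mult)
      then have "(\<Sum>n\<in>{A<..B}. W n * (\<psi> i n * \<psi> j n)) \<le> (real z * \<Lambda>)\<^sup>2 * (2 * real m)"
        unfolding W_def
        by (intro sieve_character_sum[where \<psi> = "\<lambda>n. \<psi> i n * \<psi> j n"] m \<Lambda>0)
          (use lam(2) ij in \<open>auto simp: \<Lambda>_def mult\<close>)
      then show ?thesis using False E1[OF m(2)] by simp
    qed
  qed
  also have "\<dots> = (\<Sum>x\<in>J \<times> J. if x \<in> R then (real B - real A) * 2 / ln z else 0) + real (card J) ^ 2 * E"
    by (simp add: sum.distrib sum.cartesian_product power2_eq_square case_prod_beta)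
  also have "(\<Sum>x\<in>J \<times> J. if x \<in> R then (real B - real A) * 2 / ln z else 0) =
      real (card R) * ((real B - real A) * 2 / ln z)"
    using R J by (subst sum.inter_restrict[symmetric]) (auto simp: Int_absorb1)
  finally show ?thesis unfolding E .
qed

section \<open>Legendre and Jacobi symbols\<close>

lemma Legendre_values: "Legendre a p = 0 \<or> Legendre a p = 1 \<or> Legendre a p = - 1"
  by (simp add: Legendre_def)

lemma Legendre_cong: "[a = b] (mod p) \<Longrightarrow> Legendre a p = Legendre b p"
  by (simp add: Legendre_def QuadRes_def unique_euclidean_semiring_class.cong_def)

lemma Legendre_1: "p > 2 \<Longrightarrow> Legendre 1 (int p) = 1"
  by (auto simp: Legendre_def QuadRes_def unique_euclidean_semiring_class.cong_def intro!: exI[of _ 1])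

lemma Legendre_eq_0_iff: "Legendre a p = 0 \<longleftrightarrow> p dvd a"
  by (simp add: Legendre_def cong_0_iff)

lemma cong_Legendre_values_imp_eq:
  fixes p :: nat and x y :: int
  assumes "p > 2" "x \<in> {- 1, 0, 1}" "y \<in> {- 1, 0, 1}" "[x = y] (mod int p)"
  shows "x = y"
proof -
  have "int p dvd x - y" using assms(4) by (simp add: cong_iff_dvd_diff)
  moreover have "\<bar>x - y\<bar> \<le> 2" using assms by auto
  ultimately show ?thesis using assms(1) zdvd_imp_le[of "int p" "\<bar>x - y\<bar>"] by fastforce
qed

lemma Legendre_mult:
  fixes p :: nat
  assumes "prime p" "p > 2"
  shows "Legendre (a * b) (int p) = Legendre a (int p) * Legendre b (int p)"
proof (rule cong_Legendre_values_imp_eq[OF assms(2)])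
  note E = euler_criterion[OF assms]
  have "[Legendre a (int p) * Legendre b (int p) = a ^ ((p - 1) div 2) * b ^ ((p - 1) div 2)] (mod int p)"
    by (intro cong_mult E)
  then show "[Legendre (a * b) (int p) = Legendre a (int p) * Legendre b (int p)] (mod int p)"
    using E[of "a * b"] by (metis power_mult_distrib cong_sym cong_trans)
qed (use Legendre_values[of a p] Legendre_values[of b p] Legendre_values[of "a * b" p] in auto)

text \<open>The residues 1 and q - 1 have the same square, so squaring is not injective on the
  residues and therefore misses one of them.\<close>

lemma exists_nonresidue:
  fixes q :: nat
  assumes q: "prime q" "q > 2"
  shows "\<exists>r. Legendre (int r) (int q) = - 1"
proof -
  define s where "s x = x ^ 2 mod q" for x :: nat
  have "\<not> inj_on s {..<q}"
  proof
    assume inj: "inj_on s {..<q}"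
    have "(q - 1) ^ 2 = q * (q - 2) + 1"
    proof -
      obtain k where "q = k + 2" using q(2) by (metis add.commute le_Suc_ex less_imp_le)
      then show ?thesis by (simp add: power2_eq_square algebra_simps)
    qed
    then have "s (q - 1) = s 1" by (simp only: s_def mod_mult_self4 power_one)
    then have "q - 1 = 1" by (rule inj_onD[OF inj]) (use q(2) in auto)
    then show False using q(2) by simp
  qed
  moreover have sub: "s ` {..<q} \<subseteq> {..<q}" using q by (auto simp: s_def)
  ultimately have "s ` {..<q} \<noteq> {..<q}" using eq_card_imp_inj_on[of "{..<q}" s] by auto
  then obtain r where r: "r < q" "r \<notin> s ` {..<q}" using sub by auto
  have "\<not> QuadRes (int q) (int r)"
  proof
    assume "QuadRes (int q) (int r)"
    then obtain y where y: "[y\<^sup>2 = int r] (mod int q)" by (auto simp: QuadRes_def)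
    define x where "x = nat (y mod int q)"
    have "int x = y mod int q" using q by (simp add: x_def)
    then have "int (x ^ 2 mod q) = y ^ 2 mod int q" by (simp add: zmod_int power_mod)
    also have "\<dots> = int r" using y r by (simp add: unique_euclidean_semiring_class.cong_def)
    finally have "s x = r" by (simp add: s_def)
    moreover have "x < q" using q by (simp add: x_def nat_less_iff)
    ultimately show False using r by auto
  qed
  moreover have "r \<noteq> 0"
  proof
    assume "r = 0"
    moreover have "s 0 = 0" by (simp add: s_def)
    ultimately show False using r(2) q by (metis image_eqI lessThan_iff prime_gt_0_nat)
  qed
  then have "\<not> [int r = 0] (mod int q)" using r by (simp add: cong_0_iff nat_dvd_not_less)
  ultimately show ?thesis by (auto simp: Legendre_def)
qed

text \<open>The Jacobi symbol of \<open>n\<close> over \<open>m\<close>, with the modulus as first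
  argument. For odd \<open>m\<close> it is a periodic, completely multiplicative function of all
  \<open>n\<close>, which the Legendre symbol modulo a varying prime is not.\<close>

definition jacobi :: "nat \<Rightarrow> nat \<Rightarrow> int" where
  "jacobi m n = (\<Prod>q\<in>#prime_factorization m. Legendre (int n) (int q))"

lemma jacobi_mult_left:
  "m > 0 \<Longrightarrow> m' > 0 \<Longrightarrow> jacobi (m * m') n = jacobi m n * jacobi m' n"
  by (simp add: jacobi_def prime_factorization_mult)

lemma prod_mset_mult_cong:
  assumes "\<And>q. q \<in># A \<Longrightarrow> f q = g q * h q"
  shows "(\<Prod>q\<in>#A. f q) = (\<Prod>q\<in>#A. g q) * (\<Prod>q\<in>#A. h q :: 'a::comm_monoid_mult)"
  using assms by (induction A) (auto simp: mult_ac)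

lemma odd_prime_factor:
  assumes "odd (m::nat)" "q \<in># prime_factorization m"
  shows "prime q" "q > 2" "q dvd m"
proof -
  show "prime q" "q dvd m" using assms(2) by auto
  then have "q \<noteq> 2" using assms(1) by auto
  then show "q > 2" using prime_ge_2_nat[OF \<open>prime q\<close>] by simp
qed

lemma jacobi_mult_right:
  assumes "odd m"
  shows "jacobi m (n * n') = jacobi m n * jacobi m n'"
  unfolding jacobi_def
  by (rule prod_mset_mult_cong) (simp add: Legendre_mult odd_prime_factor[OF assms])

lemma jacobi_cong:
  assumes "[n = n'] (mod m)"
  shows "jacobi m n = jacobi m n'"
proof -
  have "Legendre (int n) (int q) = Legendre (int n') (int q)" if "q \<in># prime_factorization m" for q
  proof (rule Legendre_cong)
    have "q dvd m" using that by auto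
    then have "[n = n'] (mod q)" using assms cong_dvd_modulus_nat by blast
    then show "[int n = int n'] (mod int q)" by (simp add: cong_int_iff)
  qed
  then show ?thesis unfolding jacobi_def by (intro arg_cong[of _ _ prod_mset] image_mset_cong) auto
qed

lemma abs_jacobi_le: "\<bar>jacobi m n\<bar> \<le> 1"
proof -
  have "\<bar>\<Prod>q\<in>#A. Legendre (int n) (int q)\<bar> \<le> 1" for A
  proof (induction A)
    case (add q A)
    have "\<bar>Legendre (int n) (int q)\<bar> \<le> 1" using Legendre_values[of "int n" "int q"] by auto
    then have "\<bar>Legendre (int n) (int q)\<bar> * \<bar>\<Prod>q\<in>#A. Legendre (int n) (int q)\<bar> \<le> 1 * 1"
      using add by (intro mult_mono) auto
    then show ?case by (simp add: abs_mult)
  qed simp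
  then show ?thesis by (simp add: jacobi_def)
qed

lemma jacobi_eq_1:
  assumes "odd m" "[k = 1] (mod m)"
  shows "jacobi m k = 1"
proof -
  have "Legendre 1 (int q) = 1" if "q \<in># prime_factorization m" for q
    using odd_prime_factor[OF assms(1) that]
    by (auto simp: Legendre_def QuadRes_def unique_euclidean_semiring_class.cong_def intro!: exI[of _ 1])
  then have "jacobi m 1 = (\<Prod>q\<in>#prime_factorization m. 1)"
    unfolding jacobi_def by (intro arg_cong[of _ _ prod_mset] image_mset_cong) auto
  then show ?thesis using jacobi_cong[OF assms(2)] by simp
qed

text \<open>A non-square has a prime \<open>q\<close> of odd exponent \<open>e\<close>. A
  non-residue modulo \<open>q\<close> that is 1 modulo the remaining part of \<open>m\<close> has
  symbol \<open>(- 1) ^ e\<close>.\<close>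

lemma exists_jacobi_minus_1:
  assumes m: "odd m" and ns: "\<not> (\<exists>x. m = x ^ 2)"
  shows "\<exists>k. coprime k m \<and> jacobi m k = - 1"
proof -
  have m0: "m > 0" using m by (auto intro: Nat.gr0I)
  have "\<not> is_nth_power 2 m" using ns by (auto simp: is_nth_power_def)
  then obtain q where q: "prime q" "odd (multiplicity q m)"
    using is_nth_power_conv_multiplicity_nat[of 2 m] m0 by auto
  define e where "e = multiplicity q m"
  define m' where "m' = m div q ^ e"
  have me: "m = q ^ e * m'" by (simp add: m'_def e_def multiplicity_dvd)
  have m'0: "m' > 0" using me m0 by (auto intro: Nat.gr0I)
  have e0: "e > 0" using q by (auto simp: e_def intro: Nat.gr0I)
  have "q dvd m" using me e0 by simp
  then have q2: "q > 2" using odd_prime_factor[OF m, of q] q m0 by (simp add: prime_factors_dvd)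
  have nd: "\<not> q dvd m'"
    unfolding m'_def e_def
    by (rule multiplicity_decompose) (use q(1) m0 not_prime_unit[of q] in auto)
  have cop: "coprime (q ^ e) m'" using q nd by (simp add: prime_imp_coprime)
  obtain r where r: "Legendre (int r) (int q) = - 1" using exists_nonresidue[OF q(1) q2] by blast
  obtain k where k: "[k = r] (mod q ^ e)" "[k = 1] (mod m')"
    using binary_chinese_remainder_nat[OF cop] by blast
  have odd': "odd m'" using m me by auto
  have "[k = r] (mod q)" using k(1) e0 cong_dvd_modulus_nat dvd_power by blast
  then have L: "Legendre (int k) (int q) = - 1" using r Legendre_cong by (metis cong_int_iff)
  have "prime_factorization (q ^ e) = replicate_mset e q"
    using q(1) by (simp add: prime_factorization_prime_power)
  then have "jacobi (q ^ e) k = (- 1) ^ e" by (simp add: jacobi_def L)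
  then have "jacobi m k = - 1"
    unfolding me using q m'0 by (subst jacobi_mult_left) (auto simp: jacobi_eq_1[OF odd' k(2)] e_def prime_gt_0_nat)
  moreover have "coprime k (q ^ e)"
  proof -
    have "\<not> q dvd k" using L Legendre_eq_0_iff[of "int k" "int q"] by auto
    then show ?thesis using q prime_imp_coprime[of q k] by (simp add: coprime_commute)
  qed
  moreover have "coprime k m'" using k(2) by (metis cong_imp_coprime cong_sym coprime_1_left)
  ultimately show ?thesis using me by auto
qed

text \<open>Multiplication by a unit of symbol -1 permutes the residues and negates the sum.\<close>

lemma sum_jacobi_eq_0:
  assumes m: "odd m" and ns: "\<not> (\<exists>x. m = x ^ 2)"
  shows "(\<Sum>n<m. jacobi m n) = 0"
proof -
  obtain k where k: "coprime k m" "jacobi m k = - 1" using exists_jacobi_minus_1[OF assms] by blast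
  have m0: "m > 0" using m by (auto intro: Nat.gr0I)
  define h where "h n = (k * n) mod m" for n
  have "inj_on h {..<m}"
  proof (rule inj_onI)
    fix x y assume xy: "x \<in> {..<m}" "y \<in> {..<m}" "h x = h y"
    then have "[k * x = k * y] (mod m)" by (simp add: h_def unique_euclidean_semiring_class.cong_def)
    then have "[x = y] (mod m)" using k(1) by (simp add: cong_mult_lcancel_nat)
    then show "x = y" using xy by (simp add: unique_euclidean_semiring_class.cong_def)
  qed
  moreover have "h ` {..<m} \<subseteq> {..<m}" using m0 by (auto simp: h_def)
  ultimately have bij: "bij_betw h {..<m} {..<m}"
    by (simp add: bij_betw_def endo_inj_surj)
  have "(\<Sum>n<m. jacobi m n) = (\<Sum>n<m. jacobi m (h n))"
    using bij by (rule sum.reindex_bij_betw[symmetric])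
  also have "\<dots> = (\<Sum>n<m. - jacobi m n)"
  proof (rule sum.cong)
    fix n
    have "jacobi m (h n) = jacobi m (k * n)" by (rule jacobi_cong) (simp add: h_def unique_euclidean_semiring_class.cong_def)
    then show "jacobi m (h n) = - jacobi m n" using k by (simp add: jacobi_mult_right[OF m])
  qed simp
  finally show ?thesis by (simp add: sum_negf)
qed

text \<open>For odd \<open>m\<close> this is the condition \<open>m mod 4 = 1\<close>. It is stated
  through prime factors because quadratic reciprocity, applied to one factor at a time, delivers it
  in this form.\<close>

definition recip_parity :: "nat \<Rightarrow> bool" where
  "recip_parity m \<longleftrightarrow> even (size (filter_mset (\<lambda>q. q mod 4 = 3) (prime_factorization m)))"

lemma Legendre_jacobi:
  fixes p :: nat
  assumes p: "prime p" "p > 2" and m: "odd m" "\<not> p dvd m"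
  shows "Legendre (int m) (int p) =
    (if recip_parity m then 1 else (- 1) ^ ((p - 1) div 2)) * jacobi m p"
proof -
  define s :: int where "s = (- 1) ^ ((p - 1) div 2)"
  have s2: "s * s = 1" by (simp add: s_def flip: power_mult_distrib)
  have ss: "s ^ t = (if even t then 1 else s)" for t
    by (auto simp: power_mult power2_eq_square s2 elim!: evenE oddE)
  have *: "Legendre (int (prod_mset A)) (int p) =
     s ^ size (filter_mset (\<lambda>q. q mod 4 = 3) A) * (\<Prod>q\<in>#A. Legendre (int p) (int q))"
    if "\<And>q. q \<in># A \<Longrightarrow> prime q \<and> q > 2 \<and> q \<noteq> p" for A
    using that
  proof (induction A)
    case empty
    show ?case using p by (auto simp: Legendre_def QuadRes_def unique_euclidean_semiring_class.cong_def intro!: exI[of _ 1])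
  next
    case (add q A)
    have q: "prime q" "q > 2" "q \<noteq> p" using add.prems by auto
    have odd: "odd q" using q prime_odd_nat by auto
    have "Legendre (int p) (int q) * Legendre (int q) (int p) = (- 1) ^ ((p - 1) div 2 * ((q - 1) div 2))"
      using Quadratic_Reciprocity[of p q] p q by simp
    also have "\<dots> = s ^ ((q - 1) div 2)" by (simp add: s_def power_mult)
    also have "\<dots> = (if q mod 4 = 3 then s else 1)"
    proof -
      have "even ((q - 1) div 2) \<longleftrightarrow> q mod 4 \<noteq> 3" using odd by presburger
      then show ?thesis by (simp add: ss)
    qed
    finally have R: "Legendre (int p) (int q) * Legendre (int q) (int p) = (if q mod 4 = 3 then s else 1)" .
    have "\<not> q dvd p" using p q primes_dvd_imp_eq by blast
    then have "Legendre (int p) (int q) \<noteq> 0" using Legendre_eq_0_iff by simp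
    then have "Legendre (int p) (int q) * Legendre (int p) (int q) = 1"
      using Legendre_values[of "int p" "int q"] by auto
    then have R': "Legendre (int q) (int p) = (if q mod 4 = 3 then s else 1) * Legendre (int p) (int q)"
    proof -
      assume x: "Legendre (int p) (int q) * Legendre (int p) (int q) = 1"
      have "Legendre (int q) (int p) =
          (Legendre (int p) (int q) * Legendre (int p) (int q)) * Legendre (int q) (int p)" unfolding x by simp
      also have "\<dots> = (Legendre (int p) (int q) * Legendre (int q) (int p)) * Legendre (int p) (int q)"
        by (simp only: mult_ac)
      finally show ?thesis unfolding R .
    qed
    show ?case using add by (simp add: Legendre_mult[OF p] R')
  qed
  have "m > 0" using m by (auto intro: Nat.gr0I)
  then have pf: "prod_mset (prime_factorization m) = m" by (simp add: prod_mset_prime_factorization_nat)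
  have pq: "prime q \<and> q > 2 \<and> q \<noteq> p" if "q \<in># prime_factorization m" for q
    using odd_prime_factor[OF m(1) that] m(2) by blast
  have "Legendre (int (prod_mset (prime_factorization m))) (int p) =
     s ^ size (filter_mset (\<lambda>q. q mod 4 = 3) (prime_factorization m)) *
     (\<Prod>q\<in>#prime_factorization m. Legendre (int p) (int q))"
    by (rule *) (rule pq)
  then show ?thesis
    unfolding pf ss unfolding recip_parity_def jacobi_def s_def by simp
qed

section \<open>Square classes of integers\<close>

definition odd_part :: "int \<Rightarrow> nat" where
  "odd_part v = nat \<bar>v\<bar> div 2 ^ multiplicity 2 (nat \<bar>v\<bar>)"

text \<open>
  By quadratic reciprocity, for a fixed prime \<open>p\<close> the ratio of the Legendre symbol of \<open>v\<close> modulo \<open>p\<close>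
  and the Jacobi symbol of \<open>p\<close> modulo the odd part of \<open>v\<close> depends only on this triple.
\<close>

definition square_class_type :: "int \<Rightarrow> bool \<times> bool \<times> bool" where
  "square_class_type v = (v > 0, even (multiplicity 2 (nat \<bar>v\<bar>)), recip_parity (odd_part v))"

lemma odd_part_decompose:
  assumes "v \<noteq> 0"
  shows "v = sgn v * (2 ^ multiplicity 2 (nat \<bar>v\<bar>) * int (odd_part v))" "odd (odd_part v)"
    "odd_part v \<le> nat \<bar>v\<bar>"
proof -
  define n where "n = nat \<bar>v\<bar>"
  have n0: "n \<noteq> 0" using assms by (simp add: n_def)
  have "n = 2 ^ multiplicity 2 n * (n div 2 ^ multiplicity 2 n)" by (simp add: multiplicity_dvd)
  then have "int n = 2 ^ multiplicity 2 n * int (n div 2 ^ multiplicity 2 n)"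
    by (metis of_nat_mult of_nat_numeral of_nat_power)
  moreover have "v = sgn v * int n" by (simp add: n_def mult_sgn_abs)
  ultimately show "v = sgn v * (2 ^ multiplicity 2 (nat \<bar>v\<bar>) * int (odd_part v))"
    unfolding odd_part_def n_def by simp
  show "odd (odd_part v)" unfolding odd_part_def n_def[symmetric]
    using multiplicity_decompose[of n 2] n0 by simp
  show "odd_part v \<le> nat \<bar>v\<bar>" by (simp add: odd_part_def)
qed

text \<open>Each component of \<open>T\<close> decides one factor of \<open>C\<close>: the symbol of
  the sign, that of the power of 2, and the reciprocity sign. Since \<open>C * C = 1\<close>, the
  relation can be read in either direction.\<close>

lemma Legendre_eq_jacobi_odd_part:
  fixes p :: nat
  assumes p: "prime p" "p > 2"
  shows "\<exists>C. \<forall>v. v \<noteq> 0 \<longrightarrow> \<not> int p dvd v \<longrightarrow> square_class_type v = T \<longrightarrow>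
    jacobi (odd_part v) p = C * Legendre v (int p) \<and> jacobi (odd_part v) p \<noteq> 0"
proof -
  let ?L = "\<lambda>x. Legendre x (int p)"
  define C where "C = (if fst T then ?L 1 else ?L (- 1)) * (if fst (snd T) then 1 else ?L 2) *
    (if snd (snd T) then 1 else (- 1) ^ ((p - 1) div 2))"
  have unit: "?L x * ?L x = 1" if "\<not> int p dvd x" for x
    using that Legendre_values[of x "int p"] Legendre_eq_0_iff[of x "int p"] by auto
  have n1: "\<not> int p dvd 1" "\<not> int p dvd - 1" "\<not> int p dvd 2"
    using p zdvd_imp_le[of "int p" 2] by auto
  have CC: "C * C = 1"
    using unit[OF n1(1)] unit[OF n1(2)] unit[OF n1(3)]
    by (auto simp: C_def mult_ac simp flip: power_mult_distrib)
  have "jacobi (odd_part v) p = C * ?L v \<and> jacobi (odd_part v) p \<noteq> 0"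
    if v: "v \<noteq> 0" "\<not> int p dvd v" "square_class_type v = T" for v
  proof -
    define e where "e = multiplicity 2 (nat \<bar>v\<bar>)"
    define m where "m = odd_part v"
    have dec: "v = sgn v * (2 ^ e * int m)" and om: "odd m"
      using odd_part_decompose[OF v(1)] by (simp_all add: e_def m_def)
    have "\<not> int p dvd int m" using v(2) dec by (metis dvd_mult)
    then have pm: "\<not> p dvd m" by simp
    have pow: "?L (x ^ k) = ?L x ^ k" for x k
      by (induction k) (auto simp: Legendre_mult[OF p] Legendre_1 p)
    have sg: "?L (sgn v) = (if fst T then ?L 1 else ?L (- 1))"
      using v by (auto simp: square_class_type_def sgn_if)
    have tw: "?L 2 ^ e = (if fst (snd T) then 1 else ?L 2)"
    proof -
      have "even e \<longleftrightarrow> fst (snd T)" using v by (auto simp: square_class_type_def e_def)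
      moreover have "?L 2 ^ (2 * k) = 1" for k using unit[OF n1(3)]
        by (simp add: power_mult power2_eq_square)
      ultimately show ?thesis by (auto elim!: evenE oddE)
    qed
    have "?L v = ?L (sgn v) * (?L 2 ^ e * ?L (int m))"
      by (subst dec) (simp only: Legendre_mult[OF p] pow)
    also have "?L (int m) = (if snd (snd T) then 1 else (- 1) ^ ((p - 1) div 2)) * jacobi m p"
      using Legendre_jacobi[OF p om pm] v by (auto simp: square_class_type_def m_def)
    finally have L: "?L v = C * jacobi m p" by (simp add: C_def sg tw)
    then have "C * ?L v = jacobi m p" using CC by (metis mult.assoc mult_1)
    moreover have "?L v \<noteq> 0" using v Legendre_eq_0_iff by simp
    ultimately show ?thesis using L by (auto simp: m_def)
  qed
  then show ?thesis by blast
qed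

text \<open>Equal types make the product positive and its exponent of 2 even, so only the odd parts
  could prevent it from being a square.\<close>

lemma mult_square_of_odd_part:
  assumes v: "v \<noteq> 0" "w \<noteq> 0" and T: "square_class_type v = square_class_type w"
    and sq: "odd_part v * odd_part w = x ^ 2"
  shows "\<exists>y::int. v * w = y ^ 2"
proof -
  define e where "e = multiplicity 2 (nat \<bar>v\<bar>)"
  define e' where "e' = multiplicity 2 (nat \<bar>w\<bar>)"
  have "even (e + e')" using T by (auto simp: square_class_type_def e_def e'_def)
  then obtain k where k: "e + e' = 2 * k" by blast
  have sg: "sgn v * sgn w = 1" using T v by (auto simp: square_class_type_def sgn_if)
  have prod4: "v = s * (2 ^ e * m) \<Longrightarrow> w = s' * (2 ^ e' * m') \<Longrightarrow> v * w = (s * s') * (2 ^ (e + e') * (m * m'))"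
    for s s' m m' :: int by (simp add: power_add)
  have "v * w = (sgn v * sgn w) * (2 ^ (e + e') * (int (odd_part v) * int (odd_part w)))"
    using odd_part_decompose(1)[OF v(1)] odd_part_decompose(1)[OF v(2)]
    unfolding e_def[symmetric] e'_def[symmetric] using prod4 by metis
  also have "int (odd_part v) * int (odd_part w) = int x ^ 2"
    using sq by (metis of_nat_mult of_nat_power)
  finally have "v * w = (2 ^ k * int x) ^ 2" by (simp add: sg k power_mult_distrib power_mult mult.commute)
  then show ?thesis by blast
qed

section \<open>Absolute values of the rationals\<close>

text \<open>The axiom is the triangle inequality and not the ultrametric one, so that each estimate
  is proved once for the archimedean and the p-adic places together.\<close>

locale abs_value =
  fixes v :: "rat \<Rightarrow> real"
  assumes nonneg: "v x \<ge> 0" and eq_0_iff [simp]: "v x = 0 \<longleftrightarrow> x = 0"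
    and mult: "v (x * y) = v x * v y" and triangle: "v (x + y) \<le> v x + v y"
begin

lemma pos_iff: "v x > 0 \<longleftrightarrow> x \<noteq> 0"
  using nonneg[of x] eq_0_iff[of x] by linarith

lemma zero [simp]: "v 0 = 0"
  using eq_0_iff[of 0] by blast

lemma one [simp]: "v 1 = 1"
  using mult[of 1 1] eq_0_iff[of 1] by simp

lemma minus [simp]: "v (- x) = v x"
proof -
  have "v (- 1) * v (- 1) = 1" using mult[of "- 1" "- 1"] by simp
  then have "v (- 1) = 1" using nonneg[of "- 1"] by (smt (verit) mult_less_cancel_right2 mult_cancel_left1 mult_le_cancel_right2)
  then show ?thesis using mult[of "- 1" x] by simp
qed

lemma power: "v (x ^ n) = v x ^ n"
  by (induction n) (auto simp: mult)

lemma inverse: "v (inverse x) = inverse (v x)"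
proof (cases "x = 0")
  case False
  then have "v x * v (inverse x) = 1" using mult[of x "inverse x"] by simp
  then show ?thesis by (metis inverse_unique)
qed auto

lemma divide: "v (x / y) = v x / v y"
  by (simp add: divide_inverse mult inverse)

lemma triangle_diff: "v (x - y) \<le> v x + v y"
  using triangle[of x "- y"] by simp

lemma diff_commute: "v (x - y) = v (y - x)"
  using minus[of "x - y"] by simp

lemma le_add_diff: "v x \<le> v y + v (x - y)"
  using triangle[of y "x - y"] by simp

lemma sum_le: "v (sum f A) \<le> (\<Sum>i\<in>A. v (f i))"
proof (induction A rule: infinite_finite_induct)
  case (insert x A)
  then show ?case using triangle[of "f x" "sum f A"] by simp
qed auto

end

lemma multiplicity_int: "multiplicity (int p) (int n) = multiplicity p n"
proof -
  have "int p ^ k dvd int n \<longleftrightarrow> p ^ k dvd n" for k by (metis of_nat_dvd_iff of_nat_power)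
  then show ?thesis by (simp add: multiplicity_def)
qed

definition padic :: "nat \<Rightarrow> rat \<Rightarrow> real" where
  "padic p x = (if x = 0 then 0 else
     real p ^ multiplicity (int p) (snd (quotient_of x)) / real p ^ multiplicity (int p) (fst (quotient_of x)))"

lemma padic_frac:
  assumes p: "prime p" and mk: "m \<noteq> 0" "k \<noteq> 0"
  shows "padic p (of_int m / of_int k) = real p ^ multiplicity (int p) k / real p ^ multiplicity (int p) m"
proof -
  define x :: rat where "x = of_int m / of_int k"
  obtain n d where nd: "quotient_of x = (n, d)" by (cases "quotient_of x")
  have d: "d > 0" using quotient_of_denom_pos[OF nd] .
  have x: "x = of_int n / of_int d" using quotient_of_div[OF nd] .
  have x0: "x \<noteq> 0" using mk by (simp add: x_def)
  then have n0: "n \<noteq> 0" using x by auto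
  have "(of_int m / of_int k :: rat) = of_int n / of_int d" using x by (simp add: x_def)
  then have "(of_int (n * k) :: rat) = of_int (m * d)" using mk d by (simp add: field_simps)
  then have "n * k = m * d" by (simp only: of_int_eq_iff)
  then have "multiplicity (int p) (n * k) = multiplicity (int p) (m * d)" by simp
  then have "multiplicity (int p) n + multiplicity (int p) k = multiplicity (int p) m + multiplicity (int p) d"
    using p mk n0 d by (simp add: prime_elem_multiplicity_mult_distrib)
  then have "real p ^ multiplicity (int p) n * real p ^ multiplicity (int p) k =
      real p ^ multiplicity (int p) m * real p ^ multiplicity (int p) d"
    by (metis power_add)
  then show ?thesis
    using x0 prime_gt_0_nat[OF p] by (simp add: padic_def nd flip: x_def) (simp add: field_simps)
qed

lemma padic_of_int:
  assumes "prime p" "m \<noteq> 0"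
  shows "padic p (of_int m) = 1 / real p ^ multiplicity (int p) m"
  using padic_frac[OF assms, of 1] by simp

lemma abs_value_padic:
  assumes p: "prime p"
  shows "abs_value (padic p)"
proof
  have p0: "real p > 0" and p1: "real p \<ge> 1" using prime_gt_0_nat[OF p] by auto
  fix x y :: rat
  show "padic p x \<ge> 0" by (simp add: padic_def)
  show "padic p x = 0 \<longleftrightarrow> x = 0" using p0 by (simp add: padic_def)
  have frac: "\<exists>n d. d \<noteq> 0 \<and> x = of_int n / of_int d \<and> (x \<noteq> 0 \<longrightarrow> n \<noteq> 0)" for x :: rat
    using quotient_of_div[of x "fst (quotient_of x)" "snd (quotient_of x)"]
      quotient_of_denom_pos[of x "fst (quotient_of x)" "snd (quotient_of x)"]
    by (intro exI[of _ "fst (quotient_of x)"] exI[of _ "snd (quotient_of x)"]) auto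
  obtain n d where x: "d \<noteq> 0" "x = of_int n / of_int d" "x \<noteq> 0 \<longrightarrow> n \<noteq> 0" using frac by blast
  obtain n' d' where y: "d' \<noteq> 0" "y = of_int n' / of_int d'" "y \<noteq> 0 \<longrightarrow> n' \<noteq> 0" using frac by blast
  show "padic p (x * y) = padic p x * padic p y"
  proof (cases "x = 0 \<or> y = 0")
    case True
    then show ?thesis by (auto simp: padic_def)
  next
    case False
    have "x * y = of_int (n * n') / of_int (d * d')" using x y by simp
    then show ?thesis
      using False x y p by (simp add: padic_frac prime_elem_multiplicity_mult_distrib power_add
        del: of_int_mult)
  qed
  show "padic p (x + y) \<le> padic p x + padic p y"
  proof (cases "x = 0 \<or> y = 0 \<or> x + y = 0")
    case True
    then show ?thesis by (auto simp: padic_def)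
  next
    case False
    define A where "A = n * d'"
    define B where "B = n' * d"
    define D where "D = d * d'"
    have D: "D \<noteq> 0" and A: "A \<noteq> 0" and B: "B \<noteq> 0" using x y False by (auto simp: D_def A_def B_def)
    have xy: "x = of_int A / of_int D" "y = of_int B / of_int D" "x + y = of_int (A + B) / of_int D"
      using x y by (simp_all add: A_def B_def D_def field_simps)
    have AB: "A + B \<noteq> 0" using xy(3) False by auto
    define i where "i = multiplicity (int p) A"
    define j where "j = multiplicity (int p) B"
    define l where "l = multiplicity (int p) (A + B)"
    have nu: "\<not> is_unit (int p)" using p not_prime_unit[of "int p"] by auto
    have "min i j \<le> l"
    proof -
      have "int p ^ min i j dvd A" "int p ^ min i j dvd B"
        unfolding i_def j_def by (simp_all add: multiplicity_dvd')
      then have "int p ^ min i j dvd A + B" by simp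
      then show ?thesis unfolding l_def using nu AB by (simp add: power_dvd_iff_le_multiplicity)
    qed
    then have "real p ^ min i j \<le> real p ^ l" using p1 by (intro power_increasing)
    then have "1 / real p ^ l \<le> 1 / real p ^ min i j" using p0 by (intro divide_left_mono) auto
    also have "\<dots> \<le> 1 / real p ^ i + 1 / real p ^ j"
      using p0 by (cases "i \<le> j") (auto simp: min_def)
    finally have "real p ^ multiplicity (int p) D * (1 / real p ^ l) \<le>
        real p ^ multiplicity (int p) D * (1 / real p ^ i + 1 / real p ^ j)"
      using p0 by (intro mult_left_mono) auto
    then show ?thesis
      unfolding xy(1,2) xy(3)[unfolded xy(1,2)] using p A B D AB
      by (simp add: padic_frac distrib_left i_def j_def l_def del: of_int_add)
  qed
qed

lemma abs_value_abs: "abs_value (\<lambda>x. \<bar>real_of_rat x\<bar>)"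
  by unfold_locales (auto simp: of_rat_mult of_rat_add abs_mult simp del: abs_of_rat)

text \<open>The index \<open>0\<close> stands for the archimedean place.\<close>

definition val :: "nat \<Rightarrow> rat \<Rightarrow> real" where
  "val w x = (if w = 0 then \<bar>real_of_rat x\<bar> else padic w x)"

definition places :: "nat \<Rightarrow> nat set" where
  "places N = insert 0 (prime_factors N)"

lemma finite_places [simp]: "finite (places N)"
  by (simp add: places_def)

lemma abs_value_val:
  assumes "w \<in> places N"
  shows "abs_value (val w)"
proof (cases "w = 0")
  case True
  then have "val w = (\<lambda>x. \<bar>real_of_rat x\<bar>)" by (auto simp: val_def)
  then show ?thesis using abs_value_abs by simp
next
  case False
  then have "val w = padic w" by (auto simp: val_def)
  moreover have "prime w" using False assms by (auto simp: places_def)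
  ultimately show ?thesis using abs_value_padic by simp
qed

text \<open>The \<open>S\<close>-integers, where \<open>S\<close> consists of the prime factors of \<open>N\<close>.\<close>

definition sint :: "nat \<Rightarrow> rat \<Rightarrow> bool" where
  "sint N x \<longleftrightarrow> (\<exists>j. x * of_nat N ^ j \<in> \<int>)"

lemma sint_of_int [simp]: "sint N (of_int m)"
  unfolding sint_def by (intro exI[of _ 0]) auto

lemma sint_0 [simp]: "sint N 0" and sint_1 [simp]: "sint N 1"
  using sint_of_int[of N 0] sint_of_int[of N 1] by auto

lemma sint_mult:
  assumes "sint N x" "sint N y"
  shows "sint N (x * y)"
proof -
  obtain i j where "x * of_nat N ^ i \<in> \<int>" "y * of_nat N ^ j \<in> \<int>" using assms by (auto simp: sint_def)
  then have "(x * of_nat N ^ i) * (y * of_nat N ^ j) \<in> \<int>" by (rule Ints_mult)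
  moreover have "(x * of_nat N ^ i) * (y * of_nat N ^ j) = (x * y) * of_nat N ^ (i + j)"
    by (simp add: power_add)
  ultimately show ?thesis unfolding sint_def by metis
qed

lemma sint_add:
  assumes "sint N x" "sint N y"
  shows "sint N (x + y)"
proof -
  obtain i j where ij: "x * of_nat N ^ i \<in> \<int>" "y * of_nat N ^ j \<in> \<int>" using assms by (auto simp: sint_def)
  have "(x * of_nat N ^ i) * of_nat N ^ j + (y * of_nat N ^ j) * of_nat N ^ i \<in> \<int>"
    by (rule Ints_add[OF Ints_mult[OF ij(1) Ints_power[OF Ints_of_nat]] Ints_mult[OF ij(2) Ints_power[OF Ints_of_nat]]])
  moreover have "(x * of_nat N ^ i) * of_nat N ^ j + (y * of_nat N ^ j) * of_nat N ^ i = (x + y) * of_nat N ^ (i + j)"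
    by (simp add: power_add algebra_simps)
  ultimately show ?thesis unfolding sint_def by metis
qed

lemma sint_minus: "sint N x \<Longrightarrow> sint N (- x)"
  using sint_mult[of N "- 1" x] sint_of_int[of N "- 1"] by simp

lemma sint_diff: "sint N x \<Longrightarrow> sint N y \<Longrightarrow> sint N (x - y)"
  using sint_add[of N x "- y"] sint_minus by simp

lemma sint_power: "sint N x \<Longrightarrow> sint N (x ^ k)"
  by (induction k) (auto intro: sint_mult)

lemma sint_sum: "(\<And>i. i \<in> A \<Longrightarrow> sint N (f i)) \<Longrightarrow> sint N (sum f A)"
  by (induction A rule: infinite_finite_induct) (auto intro: sint_add)

lemma sint_inverse_dvd:
  assumes "m dvd int N" "m \<noteq> 0"
  shows "sint N (1 / of_int m)"
proof -
  obtain k where "int N = m * k" using assms by auto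
  then have "(of_nat N :: rat) = of_int m * of_int k" by (metis of_int_mult of_int_of_nat_eq)
  then have "1 / of_int m * of_nat N ^ 1 = (of_int k :: rat)" using assms by simp
  then show ?thesis unfolding sint_def by (metis Ints_of_int)
qed

text \<open>Integral closedness of the integers: \<open>y\<close> times a suitable power of
  \<open>N\<close> is a rational number with integral square.\<close>

lemma sint_sqrt:
  assumes "sint N (y ^ 2)"
  shows "sint N y"
proof -
  obtain j where "y ^ 2 * of_nat N ^ j \<in> \<int>" using assms by (auto simp: sint_def)
  then have "y ^ 2 * of_nat N ^ j * of_nat N ^ j \<in> \<int>" by (rule Ints_mult[OF _ Ints_power[OF Ints_of_nat]])
  then have "(y * of_nat N ^ j) ^ 2 \<in> \<int>" by (simp add: power2_eq_square mult_ac)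
  define z where "z = y * of_nat N ^ j"
  obtain m where m: "z ^ 2 = of_int m" using \<open>(y * of_nat N ^ j) ^ 2 \<in> \<int>\<close> by (auto simp: z_def Ints_def)
  obtain n d where nd: "quotient_of z = (n, d)" by (cases "quotient_of z")
  have d: "d > 0" and cop: "coprime n d" and z: "z = of_int n / of_int d"
    using quotient_of_denom_pos[OF nd] quotient_of_coprime[OF nd] quotient_of_div[OF nd] by auto
  have "(of_int (n ^ 2) :: rat) = of_int (m * d ^ 2)"
    using m z d by (simp add: power_divide field_simps)
  then have "n ^ 2 = m * d ^ 2" by (simp only: of_int_eq_iff)
  then have "d dvd n ^ 2" by (simp add: power2_eq_square)
  moreover have "coprime d (n ^ 2)" using cop by (simp add: coprime_commute)
  ultimately have "is_unit d" using coprime_common_divisor[of d "n ^ 2" d] by simp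
  then have "d = 1" using d by simp
  then have "z \<in> \<int>" using z by simp
  then show ?thesis unfolding sint_def z_def by blast
qed

section \<open>Product formula and finiteness of bounded sets\<close>

lemma prod_prime_powers:
  assumes "n > 0"
  shows "(\<Prod>p\<in>prime_factors n. real p ^ multiplicity p n) = real n"
  using prime_factorization_nat[OF assms] by (metis (no_types, lifting) of_nat_power of_nat_prod prod.cong)

text \<open>A power of \<open>N\<close> has product exactly 1 over \<open>places N\<close>, which
  reduces the claim to non-zero integers. There the p-adic factors remove from the real absolute
  value only the part composed of primes of \<open>N\<close>, and at least 1 is left.\<close>

lemma product_formula:
  assumes N: "N > 0" and x: "sint N x" "x \<noteq> 0"
  shows "(\<Prod>w\<in>places N. val w x) \<ge> 1"
proof -
  have split: "(\<Prod>w\<in>places N. val w y) = \<bar>real_of_rat y\<bar> * (\<Prod>p\<in>prime_factors N. padic p y)" for y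
  proof -
    have "0 \<notin> prime_factors N" by auto
    then have "(\<Prod>w\<in>places N. val w y) = val 0 y * (\<Prod>p\<in>prime_factors N. val p y)"
      unfolding places_def by (subst prod.insert) auto
    also have "(\<Prod>p\<in>prime_factors N. val p y) = (\<Prod>p\<in>prime_factors N. padic p y)"
      by (intro prod.cong) (auto simp: val_def)
    finally show ?thesis by (simp add: val_def)
  qed
  have mul: "(\<Prod>w\<in>places N. val w (y * z)) = (\<Prod>w\<in>places N. val w y) * (\<Prod>w\<in>places N. val w z)" for y z
    unfolding prod.distrib[symmetric] by (intro prod.cong refl abs_value.mult[OF abs_value_val])
  have int: "(\<Prod>w\<in>places N. val w (of_int m)) \<ge> 1" if m: "m \<noteq> 0" for m
  proof -
    define n where "n = nat \<bar>m\<bar>"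
    have n0: "n > 0" using m by (simp add: n_def)
    have mu: "multiplicity (int p) m = multiplicity p n" for p
    proof -
      have "multiplicity (int p) m = multiplicity (int p) \<bar>m\<bar>" by (simp add: abs_if)
      also have "\<dots> = multiplicity (int p) (int n)" using m by (simp add: n_def)
      also have "\<dots> = multiplicity p n" by (simp add: multiplicity_int)
      finally show ?thesis .
    qed
    have "(\<Prod>p\<in>prime_factors N. real p ^ multiplicity p n) \<le> real n"
    proof -
      have "(\<Prod>p\<in>prime_factors N. real p ^ multiplicity p n) =
          (\<Prod>p\<in>prime_factors N \<inter> prime_factors n. real p ^ multiplicity p n)"
      proof (intro prod.mono_neutral_right ballI)
        fix p assume p: "p \<in> prime_factors N - prime_factors N \<inter> prime_factors n"
        then have "\<not> p dvd n" using n0 by (auto simp: prime_factors_dvd)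
        then show "real p ^ multiplicity p n = 1" by (simp add: not_dvd_imp_multiplicity_0)
      qed auto
      also have "\<dots> \<le> (\<Prod>p\<in>prime_factors n. real p ^ multiplicity p n)"
        by (intro prod_mono2) (auto intro!: one_le_power dest!: in_prime_factors_imp_prime prime_gt_0_nat)
      finally show ?thesis using prod_prime_powers[OF n0] by simp
    qed
    moreover have "(\<Prod>p\<in>prime_factors N. padic p (of_int m)) = 1 / (\<Prod>p\<in>prime_factors N. real p ^ multiplicity p n)"
    proof -
      have "(\<Prod>p\<in>prime_factors N. padic p (of_int m)) = (\<Prod>p\<in>prime_factors N. 1 / real p ^ multiplicity p n)"
        using m by (intro prod.cong) (auto simp: padic_of_int[OF in_prime_factors_imp_prime] mu)
      then show ?thesis by (simp add: prod_dividef)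
    qed
    moreover have "(\<Prod>p\<in>prime_factors N. real p ^ multiplicity p n) > 0"
      by (intro prod_pos) (auto intro!: zero_less_power dest!: in_prime_factors_imp_prime prime_gt_0_nat)
    moreover have "\<bar>real_of_rat (of_int m)\<bar> = real n" using m by (simp add: n_def)
    ultimately show ?thesis unfolding split by (simp add: le_divide_eq_1)
  qed
  have NN: "(\<Prod>w\<in>places N. val w (of_nat N)) = 1"
  proof -
    have "(\<Prod>p\<in>prime_factors N. padic p (of_nat N)) = (\<Prod>p\<in>prime_factors N. 1 / real p ^ multiplicity p N)"
      using N padic_of_int[OF in_prime_factors_imp_prime, of _ N "int N"]
      by (intro prod.cong) (auto simp: multiplicity_int)
    also have "\<dots> = 1 / real N" using prod_prime_powers[OF N] by (simp add: prod_dividef)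
    finally show ?thesis unfolding split using N by simp
  qed
  have NNj: "(\<Prod>w\<in>places N. val w (of_nat N ^ j)) = 1" for j
  proof (induction j)
    case 0
    have "val w 1 = 1" if "w \<in> places N" for w using abs_value.one[OF abs_value_val[OF that]] .
    then show ?case by simp
  qed (simp add: mul NN)
  obtain j where "x * of_nat N ^ j \<in> \<int>" using x by (auto simp: sint_def)
  then obtain m where m: "x * of_nat N ^ j = of_int m" by (auto simp: Ints_def)
  then have "m \<noteq> 0" using x N by auto
  then have "1 \<le> (\<Prod>w\<in>places N. val w (x * of_nat N ^ j))" using int m by simp
  then show ?thesis by (simp add: mul NNj)
qed

text \<open>The denominator involves only primes of \<open>N\<close>, and for \<open>x\<close>
  non-zero each of its prime powers is the p-adic absolute value of \<open>x\<close>. So denominator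
  and numerator are both bounded.\<close>

lemma finite_bounded_sint:
  assumes N: "N > 0" and B: "B \<ge> 1"
  shows "finite {x. sint N x \<and> (\<forall>w\<in>places N. val w x \<le> B)}"
proof -
  define L where "L = \<lceil>B * B ^ card (prime_factors N)\<rceil>"
  have "{x. sint N x \<and> (\<forall>w\<in>places N. val w x \<le> B)} \<subseteq>
    (\<lambda>(n, d). of_int n / of_int d) ` ({- L..L} \<times> {1..L})"
  proof
    fix x assume "x \<in> {x. sint N x \<and> (\<forall>w\<in>places N. val w x \<le> B)}"
    then have x: "sint N x" and xB: "\<And>w. w \<in> places N \<Longrightarrow> val w x \<le> B" by auto
    obtain n d where nd: "quotient_of x = (n, d)" by (cases "quotient_of x")
    have d: "d > 0" and cop: "coprime n d" and xd: "x = of_int n / of_int d"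
      using quotient_of_denom_pos[OF nd] quotient_of_coprime[OF nd] quotient_of_div[OF nd] by auto
    define k where "k = nat d"
    have dk: "d = int k" "k > 0" using d by (auto simp: k_def)
    have dvdN: "p \<in> prime_factors N" if p: "prime p" "p dvd k" for p
    proof -
      obtain j where "x * of_nat N ^ j \<in> \<int>" using x by (auto simp: sint_def)
      then obtain m where "x * of_nat N ^ j = of_int m" by (auto simp: Ints_def)
      then have "of_int (n * int N ^ j) = (of_int (m * d) :: rat)" using xd d by (simp add: field_simps)
      then have "n * int N ^ j = m * d" by (simp only: of_int_eq_iff)
      then have "d dvd n * int N ^ j" by simp
      then have "d dvd int N ^ j" using cop by (simp add: coprime_dvd_mult_right_iff coprime_commute)
      then have "k dvd N ^ j" unfolding dk(1) by (metis of_nat_dvd_iff of_nat_power)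
      then have "p dvd N ^ j" using p dvd_trans by blast
      then have "p dvd N" using p prime_dvd_power by blast
      then show ?thesis using p N by (simp add: prime_factors_dvd)
    qed
    have k_le: "real k \<le> B ^ card (prime_factors N)"
    proof (cases "n = 0")
      case True
      then have "d = 1" using cop d by simp
      then show ?thesis using B dk by simp
    next
      case False
      have "real p ^ multiplicity p k \<le> B" if p: "p \<in> prime_factors k" for p
      proof -
        have pp: "prime p" "p dvd k" using p by auto
        have "\<not> int p dvd n"
        proof
          assume "int p dvd n"
          moreover have "int p dvd d" using pp dk by simp
          ultimately have "is_unit (int p)" using cop coprime_common_divisor by blast
          then show False using pp by simp
        qed
        then have "multiplicity (int p) n = 0" by (rule not_dvd_imp_multiplicity_0)
        then have "padic p x = real p ^ multiplicity p k"
          using padic_frac[OF pp(1) False, of d] d by (simp add: xd dk multiplicity_int)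
        moreover have "val p x \<le> B" using xB[of p] dvdN[OF pp] by (simp add: places_def)
        ultimately show ?thesis using prime_gt_0_nat[OF pp(1)] by (simp add: val_def)
      qed
      then have "(\<Prod>p\<in>prime_factors k. real p ^ multiplicity p k) \<le> (\<Prod>p\<in>prime_factors k. B)"
        by (intro prod_mono) auto
      then have "real k \<le> B ^ card (prime_factors k)"
        using prod_prime_powers[OF dk(2)] by simp
      also have "\<dots> \<le> B ^ card (prime_factors N)"
        using dvdN B by (intro power_increasing card_mono) auto
      finally show ?thesis .
    qed
    have "\<bar>real_of_rat x\<bar> \<le> B" using xB[of 0] by (simp add: places_def val_def)
    then have "\<bar>real_of_int n\<bar> \<le> B * real k"
      using dk by (simp add: xd of_rat_divide field_simps)
    also have "\<dots> \<le> B * B ^ card (prime_factors N)" using k_le B by (intro mult_left_mono) auto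
    finally have "\<bar>n\<bar> \<le> L" unfolding L_def by linarith
    moreover have "d \<le> L"
    proof -
      have "real k \<le> B * B ^ card (prime_factors N)"
        using order_trans[OF k_le mult_right_mono[of 1 B "B ^ card (prime_factors N)", unfolded mult_1]] B by simp
      then show ?thesis unfolding L_def dk by linarith
    qed
    ultimately have "(n, d) \<in> {- L..L} \<times> {1..L}" using d by auto
    then show "x \<in> (\<lambda>(n, d). of_int n / of_int d) ` ({- L..L} \<times> {1..L})"
      using xd by (metis (mono_tags, lifting) case_prod_conv image_eqI)
  qed
  then show ?thesis by (rule finite_subset) auto
qed

section \<open>Runge's method over rings of S-integers\<close>

text \<open>The sum of the absolute values of the coefficients serves also at p-adic places, where
  the maximum is more usual: it is submultiplicative by the triangle inequality alone.\<close>

definition pnorm :: "(rat \<Rightarrow> real) \<Rightarrow> rat poly \<Rightarrow> real" where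
  "pnorm v P = (\<Sum>i\<le>degree P. v (poly.coeff P i))"

context abs_value
begin

lemma pnorm_eq_sum:
  assumes "degree P \<le> n"
  shows "pnorm v P = (\<Sum>i\<le>n. v (poly.coeff P i))"
  unfolding pnorm_def by (rule sum.mono_neutral_left) (use assms in \<open>auto simp: coeff_eq_0\<close>)

lemma pnorm_nonneg: "pnorm v P \<ge> 0"
  unfolding pnorm_def by (intro sum_nonneg nonneg)

lemma coeff_le_pnorm: "v (poly.coeff P i) \<le> pnorm v P"
proof -
  have "v (poly.coeff P i) \<le> (\<Sum>j\<le>max i (degree P). v (poly.coeff P j))"
    by (rule member_le_sum) (auto intro: nonneg)
  then show ?thesis using pnorm_eq_sum[of P "max i (degree P)"] by simp
qed

lemma pnorm_pCons: "pnorm v (pCons a P) = v a + pnorm v P"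
proof (cases "P = 0")
  case True
  then show ?thesis by (simp add: pnorm_def)
next
  case False
  then show ?thesis
    unfolding pnorm_def by (simp add: sum.atMost_Suc_shift del: sum.atMost_Suc)
qed

lemma pnorm_0 [simp]: "pnorm v 0 = 0"
  by (simp add: pnorm_def)

lemma pnorm_add_le: "pnorm v (P + Q) \<le> pnorm v P + pnorm v Q"
proof -
  define n where "n = max (degree P) (degree Q)"
  have "degree (P + Q) \<le> n" unfolding n_def by (rule degree_add_le) auto
  then have "pnorm v (P + Q) = (\<Sum>i\<le>n. v (poly.coeff (P + Q) i))" by (rule pnorm_eq_sum)
  also have "\<dots> \<le> (\<Sum>i\<le>n. v (poly.coeff P i) + v (poly.coeff Q i))"
    by (intro sum_mono) (simp add: triangle)
  also have "\<dots> = pnorm v P + pnorm v Q"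
    using pnorm_eq_sum[of P n] pnorm_eq_sum[of Q n] by (simp add: sum.distrib n_def)
  finally show ?thesis .
qed

lemma pnorm_smult: "pnorm v (smult a P) = v a * pnorm v P"
  using pnorm_eq_sum[of "smult a P" "degree P"] pnorm_eq_sum[of P "degree P"]
  by (simp add: mult sum_distrib_left degree_smult_le)

lemma pnorm_minus [simp]: "pnorm v (- P) = pnorm v P"
  by (simp add: pnorm_def)

lemma pnorm_diff_le: "pnorm v (P - Q) \<le> pnorm v P + pnorm v Q"
  using pnorm_add_le[of P "- Q"] by simp

lemma pnorm_mult_le: "pnorm v (P * Q) \<le> pnorm v P * pnorm v Q"
proof (induction P)
  case (pCons a P)
  have "pnorm v (pCons a P * Q) \<le> pnorm v (smult a Q) + pnorm v (pCons 0 (P * Q))"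
    using pnorm_add_le by simp
  also have "\<dots> \<le> v a * pnorm v Q + pnorm v P * pnorm v Q"
    using pCons by (simp add: pnorm_smult pnorm_pCons)
  finally show ?case by (simp add: pnorm_pCons algebra_simps)
qed simp

lemma poly_le_pnorm:
  assumes "v x \<le> M" "M \<ge> 1" "degree P \<le> n"
  shows "v (poly P x) \<le> pnorm v P * M ^ n"
proof -
  have "v (poly P x) \<le> (\<Sum>i\<le>degree P. v (poly.coeff P i * x ^ i))"
    unfolding poly_altdef by (rule sum_le)
  also have "\<dots> \<le> (\<Sum>i\<le>degree P. v (poly.coeff P i) * M ^ n)"
  proof (rule sum_mono)
    fix i assume i: "i \<in> {..degree P}"
    have "v x ^ i \<le> M ^ i" using assms nonneg by (intro power_mono) auto
    also have "\<dots> \<le> M ^ n" using assms i by (intro power_increasing) auto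
    finally show "v (poly.coeff P i * x ^ i) \<le> v (poly.coeff P i) * M ^ n"
      by (simp add: mult power mult_left_mono nonneg)
  qed
  finally show ?thesis by (simp add: pnorm_def sum_distrib_right)
qed

lemma pnorm_pcompose_le:
  assumes "pnorm v Q \<le> M" "M \<ge> 1" "degree P \<le> n"
  shows "pnorm v (P \<circ>\<^sub>p Q) \<le> pnorm v P * M ^ n"
  using assms(3)
proof (induction P arbitrary: n)
  case (pCons a P)
  show ?case
  proof (cases "P = 0")
    case True
    have "v a * 1 \<le> v a * M ^ n" using assms by (intro mult_left_mono nonneg) auto
    then show ?thesis using True by (simp add: pnorm_pCons)
  next
    case False
    then obtain n' where n: "n = Suc n'" "degree P \<le> n'" using pCons.prems by (cases n) auto
    have "pnorm v (pCons a P \<circ>\<^sub>p Q) \<le> pnorm v [:a:] + pnorm v (Q * (P \<circ>\<^sub>p Q))"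
      unfolding pcompose_pCons by (rule pnorm_add_le)
    also have "pnorm v (Q * (P \<circ>\<^sub>p Q)) \<le> pnorm v Q * pnorm v (P \<circ>\<^sub>p Q)" by (rule pnorm_mult_le)
    also have "\<dots> \<le> M * (pnorm v P * M ^ n')"
      using assms pCons.IH[OF n(2)] by (intro mult_mono) (auto intro: pnorm_nonneg)
    also have "pnorm v [:a:] \<le> v a * M ^ n"
    proof -
      have "v a * 1 \<le> v a * M ^ n" using assms by (intro mult_left_mono nonneg) auto
      then show ?thesis by (simp add: pnorm_pCons)
    qed
    finally show ?thesis by (simp add: pnorm_pCons n algebra_simps)
  qed
qed simp

lemma lead_term_bound:
  assumes "v x \<ge> 1" "degree P \<le> Suc n"
  shows "v (poly P x - poly.coeff P (Suc n) * x ^ Suc n) \<le> pnorm v P * v x ^ n"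
proof -
  define Q where "Q = P - Polynomial.monom (poly.coeff P (Suc n)) (Suc n)"
  have cQ: "poly.coeff Q i = (if i = Suc n then 0 else poly.coeff P i)" for i
    by (simp add: Q_def)
  have dQ: "degree Q \<le> n"
  proof (rule degree_le, intro allI impI)
    fix i assume "n < i"
    then show "poly.coeff Q i = 0" using assms(2) by (auto simp: cQ intro: coeff_eq_0)
  qed
  have "pnorm v Q = (\<Sum>i\<le>Suc n. v (poly.coeff Q i))" using dQ by (intro pnorm_eq_sum) simp
  also have "\<dots> \<le> (\<Sum>i\<le>Suc n. v (poly.coeff P i))"
    by (intro sum_mono) (auto simp: cQ intro: nonneg)
  also have "\<dots> = pnorm v P" using pnorm_eq_sum[OF assms(2)] by simp
  finally have le: "pnorm v Q \<le> pnorm v P" .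
  have "poly P x - poly.coeff P (Suc n) * x ^ Suc n = poly Q x"
    by (simp add: Q_def poly_monom)
  also have "v (poly Q x) \<le> pnorm v Q * v x ^ n"
    using assms(1) dQ by (intro poly_le_pnorm) auto
  also have "\<dots> \<le> pnorm v P * v x ^ n" using le nonneg by (intro mult_right_mono) auto
  finally show ?thesis .
qed

end

section \<open>S-integral polynomials and polynomial square roots\<close>

definition sint_poly :: "nat \<Rightarrow> rat poly \<Rightarrow> bool" where
  "sint_poly N P \<longleftrightarrow> (\<forall>i. sint N (poly.coeff P i))"

lemma sint_poly_add: "sint_poly N P \<Longrightarrow> sint_poly N Q \<Longrightarrow> sint_poly N (P + Q)"
  by (auto simp: sint_poly_def intro: sint_add)

lemma sint_poly_diff: "sint_poly N P \<Longrightarrow> sint_poly N Q \<Longrightarrow> sint_poly N (P - Q)"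
  by (auto simp: sint_poly_def intro: sint_diff)

lemma sint_poly_mult: "sint_poly N P \<Longrightarrow> sint_poly N Q \<Longrightarrow> sint_poly N (P * Q)"
  by (auto simp: sint_poly_def coeff_mult intro!: sint_sum sint_mult)

lemma sint_poly_smult: "sint N c \<Longrightarrow> sint_poly N P \<Longrightarrow> sint_poly N (smult c P)"
  by (auto simp: sint_poly_def intro!: sint_mult)

lemma sint_poly_of_int_poly: "sint_poly N (of_int_poly P)"
  by (auto simp: sint_poly_def)

lemma sint_poly_eval: "sint_poly N P \<Longrightarrow> sint N x \<Longrightarrow> sint N (poly P x)"
  by (auto simp: poly_altdef sint_poly_def intro!: sint_sum sint_mult sint_power)

text \<open>Coefficients of the formal square root of a power series with constant term 1.\<close>

fun sqrt_coeff :: "(nat \<Rightarrow> rat) \<Rightarrow> nat \<Rightarrow> rat" where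
  "sqrt_coeff c 0 = 1"
| "sqrt_coeff c (Suc m) = (c (Suc m) - (\<Sum>i\<in>{1..m}. sqrt_coeff c i * sqrt_coeff c (Suc m - i))) / 2"

declare sqrt_coeff.simps(2) [simp del]

lemma sqrt_coeff_convolution:
  assumes "c 0 = 1"
  shows "(\<Sum>i\<le>m. sqrt_coeff c i * sqrt_coeff c (m - i)) = c m"
proof (cases m)
  case (Suc k)
  have "{..Suc k} = insert 0 (insert (Suc k) {1..k})" by auto
  then have "(\<Sum>i\<le>m. sqrt_coeff c i * sqrt_coeff c (m - i)) =
     2 * sqrt_coeff c (Suc k) + (\<Sum>i\<in>{1..k}. sqrt_coeff c i * sqrt_coeff c (Suc k - i))"
    unfolding Suc by simp
  then show ?thesis by (simp add: sqrt_coeff.simps(2) Suc)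
qed (use assms in simp)

lemma sint_sqrt_coeff:
  assumes "sint N (1 / 2)" "\<And>m. sint N (c m)"
  shows "sint N (sqrt_coeff c m)"
proof (induction m rule: less_induct)
  case (less m)
  show ?case
  proof (cases m)
    case (Suc k)
    have "sint N ((c (Suc k) - (\<Sum>i\<in>{1..k}. sqrt_coeff c i * sqrt_coeff c (Suc k - i))) * (1 / 2))"
      using Suc by (intro sint_mult sint_diff sint_sum assms less.IH) auto
    then show ?thesis by (simp add: Suc sqrt_coeff.simps(2))
  qed simp
qed

text \<open>The induction runs with exponent \<open>2 * m - 1\<close>. In a product of two earlier
  coefficients the exponents add up to \<open>2 * m - 2\<close>, and the factor \<open>G\<close>
  gained in this way pays for the number of summands and for the division by 2.\<close>

lemma (in abs_value) sqrt_coeff_bound: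
  assumes K: "K \<ge> 1" "v (1 / 2) \<le> K" "\<And>m. v (c m) \<le> K" and e: "e \<ge> 1"
    and m: "m \<le> e"
  shows "v (sqrt_coeff c m) \<le> (2 * real e * K\<^sup>2) ^ (2 * m)"
proof -
  define G where "G = 2 * real e * K\<^sup>2"
  have G1: "G \<ge> 1"
  proof -
    have "1 * 1 \<le> (2 * real e) * K\<^sup>2" using e K by (intro mult_mono) (auto simp: one_le_power)
    then show ?thesis by (simp add: G_def)
  qed
  have *: "v (sqrt_coeff c m) \<le> G ^ (2 * m - 1)" if "m \<ge> 1" "m \<le> e" for m
    using that
  proof (induction m rule: less_induct)
    case (less m)
    then obtain k where k: "m = Suc k" by (cases m) auto
    have "v (\<Sum>i\<in>{1..k}. sqrt_coeff c i * sqrt_coeff c (Suc k - i)) \<le>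
        (\<Sum>i\<in>{1..k}. v (sqrt_coeff c i * sqrt_coeff c (Suc k - i)))"
      by (rule sum_le)
    also have "\<dots> \<le> (\<Sum>i\<in>{1..k}. G ^ (2 * k))"
    proof (rule sum_mono)
      fix i assume i: "i \<in> {1..k}"
      have "v (sqrt_coeff c i) * v (sqrt_coeff c (Suc k - i)) \<le> G ^ (2 * i - 1) * G ^ (2 * (Suc k - i) - 1)"
        using i k less.prems G1 by (intro mult_mono less.IH) (auto intro: nonneg)
      also have "\<dots> = G ^ ((2 * i - 1) + (2 * (Suc k - i) - 1))" by (simp add: power_add)
      also have "(2 * i - 1) + (2 * (Suc k - i) - 1) = 2 * k" using i by auto
      finally show "v (sqrt_coeff c i * sqrt_coeff c (Suc k - i)) \<le> G ^ (2 * k)" by (simp add: mult)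
    qed
    also have "\<dots> = real k * G ^ (2 * k)" by simp
    finally have S: "v (\<Sum>i\<in>{1..k}. sqrt_coeff c i * sqrt_coeff c (Suc k - i)) \<le> real k * G ^ (2 * k)" .
    have "v (sqrt_coeff c m) = v (1 / 2) * v (c (Suc k) - (\<Sum>i\<in>{1..k}. sqrt_coeff c i * sqrt_coeff c (Suc k - i)))"
      unfolding k sqrt_coeff.simps(2) by (subst mult[symmetric]) simp
    also have "\<dots> \<le> K * (K + real k * G ^ (2 * k))"
      using K S by (intro mult_mono order_trans[OF triangle_diff] add_mono nonneg) auto
    also have "\<dots> \<le> K * (K * G ^ (2 * k) + K * real k * G ^ (2 * k))"
    proof -
      have "K * 1 \<le> K * G ^ (2 * k)" using K G1 by (intro mult_left_mono one_le_power) auto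
      moreover have "1 * (real k * G ^ (2 * k)) \<le> K * (real k * G ^ (2 * k))"
        using K G1 by (intro mult_right_mono) auto
      ultimately show ?thesis using K by (intro mult_left_mono add_mono) auto
    qed
    also have "\<dots> = K\<^sup>2 * real m * G ^ (2 * k)" by (simp add: k power2_eq_square algebra_simps)
    also have "\<dots> \<le> G * G ^ (2 * k)"
    proof -
      have "K\<^sup>2 * real m \<le> K\<^sup>2 * (2 * real e)" using less.prems by (intro mult_left_mono) auto
      then show ?thesis using G1 by (intro mult_right_mono) (auto simp: G_def mult_ac)
    qed
    also have "\<dots> = G ^ (2 * m - 1)" by (simp add: k)
    finally show ?case .
  qed
  show ?thesis
  proof (cases "m = 0")
    case False
    then have "v (sqrt_coeff c m) \<le> G ^ (2 * m - 1)" using * m by simp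
    also have "\<dots> \<le> G ^ (2 * m)" using G1 by (intro power_increasing) auto
    finally show ?thesis by (simp add: G_def)
  qed simp
qed

text \<open>The polynomial part at infinity of the square root of a monic \<open>F\<close> of degree
  \<open>2 * e\<close>: the coefficients of \<open>F\<close>, read from the top, form a power series
  in 1/X with constant term 1.\<close>

definition sqrt_poly :: "rat poly \<Rightarrow> nat \<Rightarrow> rat poly" where
  "sqrt_poly F e = Poly (map (\<lambda>i. sqrt_coeff (\<lambda>m. if m \<le> 2 * e then poly.coeff F (2 * e - m) else 0) (e - i)) [0..<Suc e])"

lemma coeff_sqrt_poly:
  "poly.coeff (sqrt_poly F e) i =
    (if i \<le> e then sqrt_coeff (\<lambda>m. if m \<le> 2 * e then poly.coeff F (2 * e - m) else 0) (e - i) else 0)"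
  by (simp add: sqrt_poly_def coeff_Poly_eq nth_default_def del: upt_Suc)

lemma degree_sqrt_poly_le: "degree (sqrt_poly F e) \<le> e"
  by (rule degree_le) (simp add: coeff_sqrt_poly)

text \<open>The coefficients from degree \<open>e\<close> to \<open>2 * e\<close> of the square
  involve only the first \<open>e + 1\<close> terms of the formal square root, and all of these are
  kept.\<close>

lemma degree_diff_sqrt_poly:
  assumes "degree F \<le> 2 * e" "poly.coeff F (2 * e) = 1" "i \<ge> e"
  shows "poly.coeff (F - (sqrt_poly F e)\<^sup>2) i = 0"
proof (cases "i \<le> 2 * e")
  case True
  define h where "h = sqrt_coeff (\<lambda>m. if m \<le> 2 * e then poly.coeff F (2 * e - m) else 0)"
  define m where "m = 2 * e - i"
  have m: "i = 2 * e - m" "m \<le> e" using True assms(3) by (auto simp: m_def)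
  have "poly.coeff ((sqrt_poly F e)\<^sup>2) i = (\<Sum>k\<le>i. poly.coeff (sqrt_poly F e) k * poly.coeff (sqrt_poly F e) (i - k))"
    by (simp add: power2_eq_square coeff_mult)
  also have "\<dots> = (\<Sum>k\<in>{e - m..e}. h (e - k) * h (e - (i - k)))"
    using m by (intro sum.mono_neutral_cong_right) (auto simp: coeff_sqrt_poly h_def)
  also have "\<dots> = (\<Sum>j\<le>m. h j * h (m - j))"
    by (rule sum.reindex_bij_witness[of _ "\<lambda>j. e - j" "\<lambda>k. e - k"]) (use m in \<open>auto\<close>)
  also have "\<dots> = poly.coeff F i"
    unfolding h_def using m assms by (subst sqrt_coeff_convolution) auto
  finally show ?thesis by simp
next
  case False
  then have "degree ((sqrt_poly F e)\<^sup>2) < i"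
    using degree_power_le[of "sqrt_poly F e" 2] degree_sqrt_poly_le[of F e] by simp
  then show ?thesis using False assms by (simp add: coeff_eq_0)
qed

lemma sint_sqrt_poly:
  assumes "sint N (1 / 2)" "sint_poly N F"
  shows "sint_poly N (sqrt_poly F e)"
  unfolding sint_poly_def coeff_sqrt_poly using assms
  by (auto intro!: sint_sqrt_coeff simp: sint_poly_def)

lemma (in abs_value) pnorm_sqrt_poly:
  assumes K: "K \<ge> 1" "v (1 / 2) \<le> K" "pnorm v F \<le> K" and e: "e \<ge> 1"
  shows "pnorm v (sqrt_poly F e) \<le> real (Suc e) * (2 * real e * K\<^sup>2) ^ (2 * e)"
proof -
  have G1: "1 \<le> 2 * real e * K\<^sup>2"
  proof -
    have "1 * 1 \<le> (2 * real e) * K\<^sup>2" using e K by (intro mult_mono) (auto simp: one_le_power)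
    then show ?thesis by simp
  qed
  have "pnorm v (sqrt_poly F e) = (\<Sum>i\<le>e. v (poly.coeff (sqrt_poly F e) i))"
    by (rule pnorm_eq_sum) (rule degree_sqrt_poly_le)
  also have "\<dots> \<le> (\<Sum>i\<le>e. (2 * real e * K\<^sup>2) ^ (2 * e))"
  proof (rule sum_mono)
    fix i assume "i \<in> {..e}"
    then have "v (poly.coeff (sqrt_poly F e) i) \<le> (2 * real e * K\<^sup>2) ^ (2 * (e - i))"
      using K order_trans[OF coeff_le_pnorm K(3)] e unfolding coeff_sqrt_poly
      by (auto intro!: sqrt_coeff_bound)
    also have "\<dots> \<le> (2 * real e * K\<^sup>2) ^ (2 * e)" using G1 by (intro power_increasing) auto
    finally show "v (poly.coeff (sqrt_poly F e) i) \<le> (2 * real e * K\<^sup>2) ^ (2 * e)" .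
  qed
  finally show ?thesis by simp
qed

text \<open>Both \<open>y\<close> and \<open>h\<close> are close to \<open>x ^ e\<close>, so
  \<open>y + h\<close> is not small and the factorisation of the difference of squares bounds
  \<open>y - h\<close>. The tolerance is relative to \<open>v 2\<close> because at the place 2 the
  sum, about \<open>2 * x ^ e\<close>, is itself smaller than \<open>x ^ e\<close>.\<close>

lemma (in abs_value) sqrt_branch:
  assumes y: "y\<^sup>2 - h\<^sup>2 = r" and x: "v x \<ge> 1" and e: "e \<ge> 1"
    and near: "v (y / x ^ e - 1) \<le> v 2 / 4" "v (h / x ^ e - 1) \<le> v 2 / 4"
    and r: "v r \<le> C * v x ^ (e - 1)"
  shows "v (y - h) \<le> 2 * C * v (1 / 2) / v x"
proof -
  have x0: "x \<noteq> 0" using x by auto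
  have two: "v 2 > 0" by (simp add: pos_iff)
  have "v 2 = v (((y / x ^ e - 1) + (h / x ^ e - 1)) - (y + h) / x ^ e)"
    using diff_commute[of 2 0] by (simp add: add_divide_distrib)
  also have "\<dots> \<le> (v 2 / 4 + v 2 / 4) + v ((y + h) / x ^ e)"
    by (intro order_trans[OF triangle_diff] add_mono order_trans[OF triangle] near order_refl)
  finally have "v ((y + h) / x ^ e) \<ge> v 2 / 2" by simp
  then have yh: "v (y + h) \<ge> v 2 / 2 * v x ^ e"
    using x by (simp add: divide power field_simps)
  have pos: "v 2 / 2 * v x ^ e > 0" using two x by simp
  have "(y - h) * (y + h) = r" using y by (simp add: power2_eq_square algebra_simps)
  then have "v (y - h) * v (y + h) \<le> C * v x ^ (e - 1)" using r by (metis mult)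
  moreover have "v (y - h) * (v 2 / 2 * v x ^ e) \<le> v (y - h) * v (y + h)"
    using yh nonneg by (intro mult_left_mono) auto
  ultimately have "v (y - h) * (v 2 / 2 * v x ^ e) \<le> C * v x ^ (e - 1)" by linarith
  then have "v (y - h) \<le> C * v x ^ (e - 1) / (v 2 / 2 * v x ^ e)"
    using pos by (simp add: pos_le_divide_eq)
  also have "\<dots> = 2 * C * v (1 / 2) / v x"
  proof -
    obtain e' where "e = Suc e'" using e by (cases e) auto
    then show ?thesis using x two by (simp add: divide field_simps)
  qed
  finally show ?thesis .
qed

text \<open>With \<open>R = F - H^2\<close> of degree below \<open>e\<close>, the S-integer
  \<open>y - H(x)\<close> is of order 1/T at the places in \<open>E\<close> and bounded at the
  others, so the product formula bounds \<open>T\<close> if it is non-zero. If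
  \<open>R(x) = 0\<close>, then \<open>x\<close> is a root of a fixed non-zero polynomial, and the
  product formula for its leading coefficient bounds \<open>T\<close> instead.\<close>

lemma runge_bound:
  fixes F :: "rat poly"
  assumes N: "N > 0" and half: "sint N (1 / 2)"
    and F: "degree F \<le> 2 * e" "poly.coeff F (2 * e) = 1" "sint_poly N F" and e: "e \<ge> 1"
    and K: "K \<ge> 1" "\<And>w. w \<in> places N \<Longrightarrow> pnorm (val w) F \<le> K" "\<And>w. w \<in> places N \<Longrightarrow> val w (1 / 2) \<le> K"
    and nonsq: "\<And>H. sint_poly N H \<Longrightarrow> H\<^sup>2 \<noteq> F"
    and xy: "sint N x" "sint N y" "y\<^sup>2 = poly F x"
    and E: "E \<subseteq> places N" "w0 \<in> E"
    and large: "\<And>w. w \<in> E \<Longrightarrow> val w x \<ge> T" "\<And>w. w \<in> E \<Longrightarrow> val w (y / x ^ e - 1) \<le> val w 2 / 4"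
    and small: "\<And>w. w \<in> places N - E \<Longrightarrow> val w x \<le> B" and B: "B \<ge> 1"
    and K2: "K2 = real (Suc e) * (2 * real e * K\<^sup>2) ^ (2 * e)"
  shows "T \<le> (8 * K ^ 3 * K2 ^ 3 * B ^ e) ^ Suc (card (places N))"
proof -
  define n where "n = card (places N)"
  define H where "H = sqrt_poly F e"
  define R where "R = F - H\<^sup>2"
  define K3 where "K3 = 2 * K * K2\<^sup>2"
  \<comment> \<open>\<open>Z\<close> dominates all constants met below, so that each case can end in
    a power of \<open>Z\<close>.\<close>
  define Z where "Z = 8 * K ^ 3 * K2 ^ 3 * B ^ e"
  have G1: "1 \<le> 2 * real e * K\<^sup>2"
  proof -
    have "1 * 1 \<le> (2 * real e) * K\<^sup>2" using e K by (intro mult_mono) (auto simp: one_le_power)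
    then show ?thesis by simp
  qed
  have K21: "K2 \<ge> 1"
  proof -
    have "1 * 1 \<le> K2" unfolding K2 using G1 by (intro mult_mono one_le_power) auto
    then show ?thesis by simp
  qed
  have Be: "B ^ e \<ge> 1" using B by (simp add: one_le_power)
  have K2p: "1 \<le> K2 ^ k" and Kp: "1 \<le> K ^ k" for k using K21 K(1) by (auto simp: one_le_power)
  have mul1: "a \<le> b \<Longrightarrow> 1 \<le> c \<Longrightarrow> 0 \<le> b \<Longrightarrow> a \<le> b * c" for a b c :: real
    using mult_left_mono[of 1 c b] by simp
  have Z1: "Z \<ge> 1" and Z4: "4 * K * K2 \<le> Z" and Z3: "K3 \<le> Z" and ZK: "2 * K * K3 \<le> Z"
    and ZT: "2 * K * K2 * B ^ e \<le> Z"
  proof -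
    have eq: "Z = (4 * K * K2) * (2 * (K ^ 2 * K2 ^ 2 * B ^ e))"
      "Z = K3 * (4 * (K ^ 2 * K2 * B ^ e))" "Z = (2 * K * K3) * (2 * (K * K2 * B ^ e))"
      "Z = (2 * K * K2 * B ^ e) * (4 * (K ^ 2 * K2 ^ 2))"
      by (simp_all add: Z_def K3_def power2_eq_square power3_eq_cube)
    have p: "1 \<le> K ^ i * K2 ^ j * B ^ e" "1 \<le> K ^ i * K2 ^ j" for i j
      using mul1[OF mul1[OF Kp[of i] K2p[of j]] Be] mul1[OF Kp[of i] K2p[of j]] K(1) K21 by auto
    have c: "1 \<le> 2 * (K ^ 2 * K2 ^ 2 * B ^ e)" "1 \<le> 4 * (K ^ 2 * K2 * B ^ e)" "1 \<le> 2 * (K * K2 * B ^ e)"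
      "1 \<le> 4 * (K ^ 2 * K2 ^ 2)"
      using p(1)[of 2 2] p(1)[of 2 1] p(1)[of 1 1] p(2)[of 2 2] by simp_all
    have k3: "K3 \<ge> 0" using K(1) K21 by (simp add: K3_def)
    show "4 * K * K2 \<le> Z" unfolding eq(1) using K(1) K21 c by (intro mul1[OF order_refl]) auto
    then show "Z \<ge> 1" using mult_mono[of 1 K 1 K2] K(1) K21 by auto
    show "K3 \<le> Z" unfolding eq(2) using k3 c by (intro mul1[OF order_refl]) auto
    show "2 * K * K3 \<le> Z" unfolding eq(3) using k3 K(1) c by (intro mul1[OF order_refl]) auto
    show "2 * K * K2 * B ^ e \<le> Z" unfolding eq(4) using K(1) K21 Be c by (intro mul1[OF order_refl]) auto
  qed
  have av: "abs_value (val w)" if "w \<in> places N" for w using abs_value_val[OF that] .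
  have nH: "pnorm (val w) H \<le> K2" if w: "w \<in> places N" for w
    unfolding H_def K2 by (rule abs_value.pnorm_sqrt_poly[OF av[OF w] K(1) K(3)[OF w] K(2)[OF w] e])
  have nR: "pnorm (val w) R \<le> K3" if w: "w \<in> places N" for w
  proof -
    interpret abs_value "val w" using av[OF w] .
    have "pnorm (val w) R \<le> pnorm (val w) F + pnorm (val w) (H * H)"
      unfolding R_def power2_eq_square by (rule pnorm_diff_le)
    also have "\<dots> \<le> K + K2 * K2"
      using K(2)[OF w] nH[OF w] pnorm_nonneg K21 by (intro add_mono order_trans[OF pnorm_mult_le] mult_mono) auto
    also have "\<dots> \<le> K3"
    proof -
      have "K \<le> K * K2\<^sup>2" using mul1[of K K "K2\<^sup>2"] K(1) K2p by simp
      moreover have "1 * K2\<^sup>2 \<le> K * K2\<^sup>2" using K(1) by (intro mult_right_mono) auto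
      ultimately show ?thesis by (simp add: K3_def power2_eq_square)
    qed
    finally show ?thesis .
  qed
  have sH: "sint_poly N H" unfolding H_def by (rule sint_sqrt_poly[OF half F(3)])
  have sR: "sint_poly N R" unfolding R_def power2_eq_square by (intro sint_poly_diff sint_poly_mult F sH)
  have cR: "poly.coeff R i = 0" if "i \<ge> e" for i
    unfolding R_def H_def by (rule degree_diff_sqrt_poly[OF F(1,2) that])
  have R0: "R \<noteq> 0" using nonsq[OF sH] by (auto simp: R_def)
  have dR: "degree R < e" using cR R0 by (meson leading_coeff_0_iff not_le)
  have X1: "T \<le> 1 \<Longrightarrow> T \<le> Z ^ Suc n" using Z1 one_le_power[of Z "Suc n"] by linarith
  have w0: "w0 \<in> places N" using E by auto
  have n1: "n \<ge> 1" unfolding n_def using w0 finite_places by (metis One_nat_def Suc_leI card_gt_0_iff empty_iff)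
  have Zpow: "Z ^ k \<le> Z ^ Suc n" if "k \<le> Suc n" for k using Z1 that by (intro power_increasing)
  show ?thesis
  proof (cases "T \<le> 4 * K * K2")
    case True
    then have "T \<le> Z ^ 1" using Z4 by simp
    also have "\<dots> \<le> Z ^ Suc n" by (rule Zpow) simp
    finally show ?thesis by (simp add: Z_def n_def)
  next
    case X4: False
    then have X1: "T > 1" using K(1) K21 mult_mono[of 1 K 1 K2] by simp
    show ?thesis
    proof (cases "poly R x = 0")
      case True
      \<comment> \<open>At \<open>w0\<close> a root as large as \<open>x\<close> forces the leading
        coefficient of \<open>R\<close> to be small, while elsewhere it is at most \<open>Z\<close>;
        the product formula balances the two.\<close>
      define \<rho> where "\<rho> = lead_coeff R"
      have \<rho>: "\<rho> \<noteq> 0" "sint N \<rho>" using R0 sR by (auto simp: \<rho>_def sint_poly_def)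
      have "degree R \<noteq> 0"
      proof
        assume "degree R = 0"
        then obtain a where "R = [:a:]" by (rule degree_eq_zeroE)
        then show False using True R0 by simp
      qed
      then obtain j where j: "degree R = Suc j" by (cases "degree R") auto
      interpret v0: abs_value "val w0" using av[OF w0] .
      have vx: "val w0 x \<ge> T" using large(1) E by auto
      have "val w0 (poly R x - poly.coeff R (Suc j) * x ^ Suc j) \<le> pnorm (val w0) R * val w0 x ^ j"
        using vx X1 j by (intro v0.lead_term_bound) auto
      then have "val w0 \<rho> * val w0 x ^ Suc j \<le> pnorm (val w0) R * val w0 x ^ j"
        using True j by (simp add: \<rho>_def v0.mult v0.power)
      also have "\<dots> \<le> K3 * val w0 x ^ j" using nR[OF w0] v0.nonneg by (intro mult_right_mono) auto
      finally have "(val w0 \<rho> * val w0 x) * val w0 x ^ j \<le> K3 * val w0 x ^ j" by (simp add: mult_ac)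
      moreover have "val w0 x ^ j > 0" using vx X1 by simp
      ultimately have A: "val w0 \<rho> * val w0 x \<le> K3" by simp
      have "1 \<le> (\<Prod>w\<in>places N. val w \<rho>)" by (rule product_formula[OF N \<rho>(2,1)])
      also have "\<dots> = val w0 \<rho> * (\<Prod>w\<in>places N - {w0}. val w \<rho>)"
        using w0 by (simp add: prod.remove)
      also have "\<dots> \<le> val w0 \<rho> * (\<Prod>w\<in>places N - {w0}. Z)"
      proof (intro mult_left_mono prod_mono conjI v0.nonneg)
        fix w assume w: "w \<in> places N - {w0}"
        interpret abs_value "val w" using av w by auto
        show "0 \<le> val w \<rho>" by (rule nonneg)
        show "val w \<rho> \<le> Z" using coeff_le_pnorm[of R "degree R"] nR[of w] w Z3 by (simp add: \<rho>_def)
      qed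
      also have "\<dots> = val w0 \<rho> * Z ^ (n - 1)" using w0 by (simp add: n_def card_Diff_singleton)
      finally have C: "1 \<le> val w0 \<rho> * Z ^ (n - 1)" .
      have "T * 1 \<le> val w0 x * (val w0 \<rho> * Z ^ (n - 1))"
        using vx X1 C by (intro mult_mono) auto
      also have "\<dots> = (val w0 \<rho> * val w0 x) * Z ^ (n - 1)" by simp
      also have "\<dots> \<le> Z * Z ^ (n - 1)" using A Z3 Z1 by (intro mult_right_mono) auto
      also have "\<dots> = Z ^ n" using n1 by (cases n) auto
      also have "\<dots> \<le> Z ^ Suc n" by (rule Zpow) simp
      finally show ?thesis by (simp add: Z_def n_def)
    next
      case False
      define \<delta> where "\<delta> = y - poly H x"
      have yR: "y\<^sup>2 - (poly H x)\<^sup>2 = poly R x" using xy(3) by (simp add: R_def)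
      have \<delta>0: "\<delta> \<noteq> 0" using yR False by (auto simp: \<delta>_def)
      have s\<delta>: "sint N \<delta>" unfolding \<delta>_def by (intro sint_diff xy sint_poly_eval sH)
      have big: "val w \<delta> \<le> 2 * K * K3 / T" if w: "w \<in> E" for w
      proof -
        have wp: "w \<in> places N" using w E by auto
        interpret abs_value "val w" using av[OF wp] .
        have vx: "val w x \<ge> T" using large(1)[OF w] .
        then have vx1: "val w x \<ge> 1" using X1 by simp
        obtain e' where e': "e = Suc e'" using e by (cases e) auto
        have "val w (poly H x - poly.coeff H (Suc e') * x ^ Suc e') \<le> pnorm (val w) H * val w x ^ e'"
          using vx1 degree_sqrt_poly_le[of F e] e' by (intro lead_term_bound) (auto simp: H_def)
        also have "\<dots> \<le> K2 * val w x ^ e'" using nH[OF wp] vx1 by (intro mult_right_mono) auto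
        finally have "val w (poly H x - poly.coeff H (Suc e') * x ^ Suc e') \<le> K2 * val w x ^ e'" .
        moreover have "poly.coeff H (Suc e') = 1" by (simp add: H_def coeff_sqrt_poly e')
        ultimately have "val w (poly H x - x ^ e) \<le> K2 * val w x ^ e'" by (simp add: e')
        then have "val w (poly H x - x ^ e) / val w x ^ e \<le> K2 * val w x ^ e' / val w x ^ e"
          using vx1 by (intro divide_right_mono) auto
        moreover have x0: "x \<noteq> 0" using vx1 by auto
        then have "poly H x / x ^ e - 1 = (poly H x - x ^ e) / x ^ e" by (simp add: diff_divide_distrib)
        ultimately have "val w (poly H x / x ^ e - 1) \<le> K2 / val w x"
          using vx1 x0 by (simp add: divide power e' mult)
        also have "\<dots> \<le> K2 / (4 * K * K2)"
        proof (rule divide_left_mono)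
          have "K > 0" "K2 > 0" "val w x > 0" using K21 K(1) vx1 by linarith+
          then show "0 < val w x * (4 * K * K2)" by simp
        qed (use vx X4 K21 in auto)
        also have "\<dots> = 1 / K / 4" using K21 by simp
        also have "\<dots> \<le> val w 2 / 4"
        proof -
          have "1 / val w 2 \<le> K" using K(3)[OF wp] by (simp add: divide)
          moreover have "val w 2 > 0" by (simp add: pos_iff)
          ultimately show ?thesis using K(1) by (simp add: field_simps)
        qed
        finally have nearH: "val w (poly H x / x ^ e - 1) \<le> val w 2 / 4" .
        have "val w (poly R x) \<le> pnorm (val w) R * val w x ^ (e - 1)"
          using vx1 dR by (intro poly_le_pnorm) auto
        also have "\<dots> \<le> K3 * val w x ^ (e - 1)"
          using nR[OF wp] nonneg by (intro mult_right_mono) auto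
        finally have "val w \<delta> \<le> 2 * K3 * val w (1 / 2) / val w x"
          unfolding \<delta>_def by (intro sqrt_branch[OF yR vx1 e large(2)[OF w] nearH])
        also have "\<dots> \<le> 2 * K3 * K / T"
        proof (rule frac_le)
          have "K3 \<ge> 0" using K(1) K21 by (simp add: K3_def)
          then show "0 \<le> 2 * K3 * K" "2 * K3 * val w (1 / 2) \<le> 2 * K3 * K"
            using K(1) K(3)[OF wp] by (auto intro!: mult_left_mono)
        qed (use vx X1 in auto)
        finally show ?thesis by (simp add: mult_ac)
      qed
      have sm: "val w \<delta> \<le> Z" if w: "w \<in> places N - E" for w
      proof -
        have wp: "w \<in> places N" using w by auto
        interpret abs_value "val w" using av[OF wp] .
        have "val w y ^ 2 = val w (poly F x)" by (simp add: xy(3)[symmetric] power)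
        also have "\<dots> \<le> pnorm (val w) F * B ^ (2 * e)"
          by (rule poly_le_pnorm[OF small[OF w] B F(1)])
        also have "\<dots> \<le> K\<^sup>2 * B ^ (2 * e)"
        proof (rule mult_right_mono)
          have "K * 1 \<le> K * K" using K(1) by (intro mult_left_mono) auto
          then show "pnorm (val w) F \<le> K\<^sup>2" using K(2)[OF wp] by (simp add: power2_eq_square)
        qed (use B in auto)
        also have "\<dots> = (K * B ^ e) ^ 2" by (simp add: power_mult_distrib power_mult[symmetric] mult.commute)
        finally have y: "val w y \<le> K * B ^ e" by (rule power2_le_imp_le) (use K(1) B in auto)
        have "val w (poly H x) \<le> pnorm (val w) H * B ^ e"
          using degree_sqrt_poly_le[of F e] by (intro poly_le_pnorm[OF small[OF w] B]) (simp add: H_def)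
        also have "\<dots> \<le> K2 * B ^ e" using nH[OF wp] B by (intro mult_right_mono) auto
        finally have "val w \<delta> \<le> K * B ^ e + K2 * B ^ e"
          unfolding \<delta>_def using y by (intro order_trans[OF triangle_diff] add_mono)
        also have "\<dots> = (K + K2) * B ^ e" by (simp add: algebra_simps)
        also have "\<dots> \<le> (2 * K * K2) * B ^ e"
        proof (rule mult_right_mono)
          have "K * 1 \<le> K * K2" "1 * K2 \<le> K * K2" using K(1) K21 by (auto intro!: mult_mono)
          then show "K + K2 \<le> 2 * K * K2" by simp
        qed (use B in auto)
        also have "\<dots> \<le> Z" by (rule ZT)
        finally show ?thesis .
      qed
      show ?thesis
      \<comment> \<open>Once \<open>T\<close> exceeds this constant, \<open>\<delta>\<close> is
        below 1 at every place in \<open>E\<close>. The gain is then used at \<open>w0\<close> only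
        and the other places are bounded by \<open>Z\<close>.\<close>
      proof (cases "T \<le> 2 * K * K3")
        case True
        then have "T \<le> Z ^ 1" using ZK by simp
        also have "\<dots> \<le> Z ^ Suc n" by (rule Zpow) simp
        finally show ?thesis by (simp add: Z_def n_def)
      next
        case XK: False
        have "1 \<le> (\<Prod>w\<in>places N. val w \<delta>)" by (rule product_formula[OF N s\<delta> \<delta>0])
        also have "\<dots> = val w0 \<delta> * (\<Prod>w\<in>places N - {w0}. val w \<delta>)"
          using w0 by (simp add: prod.remove)
        also have "\<dots> \<le> (2 * K * K3 / T) * (\<Prod>w\<in>places N - {w0}. Z)"
        proof (intro mult_mono prod_mono conjI big E prod_nonneg)
          show "0 \<le> 2 * K * K3 / T" using K(1) K21 X1 by (simp add: K3_def)
          fix w assume w: "w \<in> places N - {w0}"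
          then show n: "0 \<le> val w \<delta>" using abs_value.nonneg[OF av] by auto
          show "val w \<delta> \<le> Z"
          proof (cases "w \<in> E")
            case True
            then have "val w \<delta> \<le> 2 * K * K3 / T" by (rule big)
            also have "\<dots> \<le> 1" using XK X1 by simp
            finally show ?thesis using Z1 by simp
          qed (use sm w in auto)
        qed (use abs_value.nonneg[OF av] in auto)
        also have "\<dots> = (2 * K * K3 / T) * Z ^ (n - 1)" using w0 by (simp add: n_def card_Diff_singleton)
        finally have "T \<le> 2 * K * K3 * Z ^ (n - 1)" using X1 by (simp add: field_simps)
        also have "\<dots> \<le> Z * Z ^ (n - 1)" using ZK Z1 by (intro mult_right_mono) auto
        also have "\<dots> = Z ^ n" using n1 by (cases n) auto
        also have "\<dots> \<le> Z ^ Suc n" by (rule Zpow) simp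
        finally show ?thesis by (simp add: Z_def n_def)
      qed
    qed
  qed
qed

section \<open>Square classes in an orbit\<close>

context abs_value
begin

lemma lead_ratio:
  assumes "degree P = Suc n" "v (1 / lead_coeff P) \<le> K" "pnorm v P \<le> K" "v x \<ge> T" "T \<ge> 1"
  shows "v (poly P x / (lead_coeff P * x ^ Suc n) - 1) \<le> K\<^sup>2 / T"
proof -
  define l where "l = lead_coeff P"
  have "P \<noteq> 0" using assms(1) by auto
  then have l0: "l \<noteq> 0" by (simp only: l_def leading_coeff_0_iff not_False_eq_True)
  have x0: "x \<noteq> 0" using assms by auto
  have K0: "K \<ge> 0" using assms(3) pnorm_nonneg by (rule order_trans[rotated])
  have "v (poly P x - l * x ^ Suc n) \<le> pnorm v P * v x ^ n"
    using lead_term_bound[of x P n] assms by (simp add: l_def)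
  also have "\<dots> \<le> K * v x ^ n" using assms nonneg by (intro mult_right_mono) auto
  finally have 1: "v (poly P x - l * x ^ Suc n) \<le> K * v x ^ n" .
  have "poly P x / (l * x ^ Suc n) - 1 = (poly P x - l * x ^ Suc n) * (1 / l) / x ^ Suc n"
    using l0 x0 by (simp add: field_simps)
  then have "v (poly P x / (l * x ^ Suc n) - 1) = v (poly P x - l * x ^ Suc n) * v (1 / l) / v x ^ Suc n"
    by (simp add: mult divide power)
  also have "\<dots> \<le> (K * v x ^ n) * K / v x ^ Suc n"
    using 1 assms(2) K0 nonneg by (intro divide_right_mono mult_mono) (auto simp: l_def)
  also have "\<dots> = K\<^sup>2 / v x" using x0 by (simp add: power2_eq_square)
  also have "\<dots> \<le> K\<^sup>2 / T" using assms by (intro divide_left_mono) auto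
  finally show ?thesis by (simp add: l_def)
qed

lemma near_mult:
  assumes "v (a - 1) \<le> \<alpha>" "v (b - 1) \<le> \<beta>" "\<beta> \<le> 1"
  shows "v (a * b - 1) \<le> 2 * \<alpha> + \<beta>"
proof -
  have "v b \<le> v 1 + v (b - 1)" by (rule le_add_diff)
  then have vb: "v b \<le> 2" using assms by simp
  have "a * b - 1 = (a - 1) * b + (b - 1)" by (simp add: algebra_simps)
  then have "v (a * b - 1) \<le> v (a - 1) * v b + v (b - 1)" using triangle by (metis mult)
  also have "\<dots> \<le> \<alpha> * 2 + \<beta>" using assms vb nonneg by (intro add_mono mult_mono order_trans[OF nonneg assms(1)])
  finally show ?thesis by simp
qed

lemma near_power:
  assumes "v (z - 1) \<le> \<eta>" "\<eta> \<le> 1"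
  shows "v (z ^ h - 1) \<le> (2 ^ h - 1) * \<eta>"
proof (induction h)
  case (Suc h)
  have "v (z ^ h * z - 1) \<le> 2 * ((2 ^ h - 1) * \<eta>) + \<eta>"
    using Suc assms by (rule near_mult)
  then show ?case by (simp add: mult.commute algebra_simps)
qed simp

text \<open>Since the square of \<open>s\<close> is close to 1, one of \<open>s - 1\<close> and
  \<open>s + 1\<close> is small. Which of the two is the smaller one takes over the role of a sign
  at an arbitrary place; if it agrees for \<open>s\<close> and \<open>s'\<close>, their product is
  close to 1.\<close>

lemma same_sign_near:
  assumes r: "v (r0 - 1) \<le> \<eta>" "v (r - 1) \<le> \<eta>" "v (r' - 1) \<le> \<eta>" and \<eta>: "\<eta> \<le> 1 / 2"
    and s: "s\<^sup>2 * r0 = r" "s'\<^sup>2 * r0 = r'"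
    and sign: "v (s - 1) \<le> v (s + 1) \<longleftrightarrow> v (s' - 1) \<le> v (s' + 1)"
    and \<epsilon>: "4 * \<eta> \<le> \<epsilon>\<^sup>2" "0 \<le> \<epsilon>" "\<epsilon> \<le> 1"
  shows "v (s * s' * r0 - 1) \<le> 7 * \<epsilon>"
proof -
  have vr0: "v r0 \<ge> 1 / 2"
    using le_add_diff[of 1 r0] r(1) \<eta> diff_commute[of 1 r0] by simp
  have prod: "v (t - 1) * v (t + 1) \<le> \<epsilon>\<^sup>2" if t: "t\<^sup>2 * r0 = q" "v (q - 1) \<le> \<eta>" for t q
  proof -
    have "(t - 1) * (t + 1) * r0 = (q - 1) - (r0 - 1)" using t(1) by (simp add: power2_eq_square algebra_simps)
    then have "v (t - 1) * v (t + 1) * v r0 \<le> \<eta> + \<eta>"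
      using triangle_diff[of "q - 1" "r0 - 1"] t(2) r(1) by (metis add_mono mult order_trans)
    moreover have "v (t - 1) * v (t + 1) * (1 / 2) \<le> v (t - 1) * v (t + 1) * v r0"
      using vr0 nonneg by (intro mult_left_mono) auto
    ultimately show ?thesis using \<epsilon>(1) by linarith
  qed
  have small: "v a \<le> \<epsilon>" if "v a \<le> v b" "v a * v b \<le> \<epsilon>\<^sup>2" for a b
  proof -
    have "v a * v a \<le> v a * v b" using that nonneg by (intro mult_left_mono) auto
    then have "(v a)\<^sup>2 \<le> \<epsilon>\<^sup>2" using that by (simp add: power2_eq_square)
    then show ?thesis using \<epsilon>(2) by (rule power2_le_imp_le)
  qed
  have ss: "v (s * s' - 1) \<le> 3 * \<epsilon>"
  proof (cases "v (s - 1) \<le> v (s + 1)")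
    case True
    then have "v (s - 1) \<le> \<epsilon>" "v (s' - 1) \<le> \<epsilon>"
      using small prod[OF s(1) r(2)] prod[OF s(2) r(3)] sign by auto
    then show ?thesis using near_mult[of s \<epsilon> s' \<epsilon>] \<epsilon> by simp
  next
    case False
    then have "v (s + 1) \<le> v (s - 1)" "v (s' + 1) \<le> v (s' - 1)" using sign by auto
    then have "v (s + 1) \<le> \<epsilon>" "v (s' + 1) \<le> \<epsilon>"
      using small prod[OF s(1) r(2)] prod[OF s(2) r(3)] by (auto simp: mult.commute)
    moreover have "v (- s - 1) = v (s + 1)" "v (- s' - 1) = v (s' + 1)"
      using minus[of "s + 1"] minus[of "s' + 1"] by simp_all
    ultimately show ?thesis using near_mult[of "- s" \<epsilon> "- s'" \<epsilon>] \<epsilon> by simp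
  qed
  have "\<eta> \<le> \<epsilon>"
  proof -
    have "\<epsilon> * \<epsilon> \<le> \<epsilon> * 1" using \<epsilon> by (intro mult_left_mono) auto
    moreover have "0 \<le> \<eta>" using r(1) nonneg by (rule order_trans[rotated])
    ultimately show ?thesis using \<epsilon> by (simp add: power2_eq_square)
  qed
  then show ?thesis using near_mult[OF ss r(1)] \<eta> by simp
qed

text \<open>In this range the leading term outweighs the others. Only squaring is extracted from the
  degree, which is enough for doubly exponential growth.\<close>

lemma poly_growth:
  assumes d: "degree f \<ge> 2" and K: "K \<ge> 1" "v (1 / lead_coeff f) \<le> K" "pnorm v f \<le> K"
    and x: "v x \<ge> 2 * K\<^sup>2"
  shows "v (poly f x) \<ge> (v x)\<^sup>2 / (2 * K)"
proof -
  obtain n where n: "degree f = Suc n" "n \<ge> 1" using d by (cases "degree f") auto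
  define c where "c = lead_coeff f"
  have c0: "c \<noteq> 0" using d by (auto simp: c_def)
  have KK: "K\<^sup>2 \<ge> 1" using K(1) by (simp add: one_le_power)
  have x1: "v x \<ge> 1" using x KK by linarith
  have "v (poly f x - c * x ^ Suc n) \<le> pnorm v f * v x ^ n"
    using lead_term_bound[of x f n] x1 n by (simp add: c_def)
  also have "\<dots> \<le> K * v x ^ n" using K x1 by (intro mult_right_mono) auto
  finally have 1: "v (poly f x - c * x ^ Suc n) \<le> K * v x ^ n" .
  have vc: "1 / K \<le> v c"
  proof -
    have "v c > 0" using c0 pos_iff by simp
    moreover have "1 / v c \<le> K" using K(2) by (simp add: divide c_def)
    ultimately show ?thesis using K(1) by (simp add: field_simps)
  qed
  have "v (c * x ^ Suc n) \<le> v (poly f x) + v (poly f x - c * x ^ Suc n)"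
    using le_add_diff[of "c * x ^ Suc n" "poly f x"] diff_commute[of "poly f x"] by simp
  then have 2: "v c * v x ^ Suc n \<le> v (poly f x) + K * v x ^ n" using 1 by (simp add: mult power)
  have "1 / K * v x ^ Suc n \<le> v c * v x ^ Suc n" using vc x1 by (intro mult_right_mono) auto
  moreover have "K * v x ^ n \<le> v x ^ Suc n / (2 * K)"
  proof -
    have "2 * K\<^sup>2 * v x ^ n \<le> v x * v x ^ n" using x x1 by (intro mult_right_mono) auto
    then show ?thesis using K(1) by (simp add: field_simps power2_eq_square)
  qed
  moreover have "1 / K * v x ^ Suc n = 2 * (v x ^ Suc n / (2 * K))" using K(1) by simp
  ultimately have "v x ^ Suc n / (2 * K) \<le> v (poly f x)" using 2 by linarith
  moreover have "(v x)\<^sup>2 / (2 * K) \<le> v x ^ Suc n / (2 * K)"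
    using x1 n K(1) by (intro divide_right_mono power_increasing) auto
  ultimately show ?thesis by linarith
qed

lemma orbit_dichotomy:
  assumes d: "degree f \<ge> 2" and K: "K \<ge> 1" "v (1 / lead_coeff f) \<le> K" "pnorm v f \<le> K"
    and u: "\<And>n. u (Suc n) = poly f (u n)"
  shows "(\<forall>n. v (u n) \<le> 4 * K\<^sup>2) \<or> (\<exists>n0. \<forall>n. v (u (n0 + n)) \<ge> 2 ^ (2 ^ n))"
proof (cases "\<forall>n. v (u n) \<le> 4 * K\<^sup>2")
  case False
  then obtain n0 where n0: "v (u n0) > 4 * K\<^sup>2" by (auto simp: not_le)
  have KK: "K\<^sup>2 \<ge> 1" using K(1) by (simp add: one_le_power)
  \<comment> \<open>The factor \<open>2 * K^2\<close> compensates for the division by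
    \<open>2 * K\<close> at each squaring; at \<open>n = 0\<close> it gives the threshold
    \<open>4 * K^2\<close> of the dichotomy.\<close>
  have *: "v (u (n0 + n)) \<ge> 2 * K\<^sup>2 * 2 ^ (2 ^ n)" for n
  proof (induction n)
    case 0
    then show ?case using n0 by simp
  next
    case (Suc n)
    have "2 * K\<^sup>2 * 1 \<le> 2 * K\<^sup>2 * 2 ^ (2 ^ n)" using KK by (intro mult_left_mono one_le_power) auto
    then have "v (u (n0 + n)) \<ge> 2 * K\<^sup>2" using Suc by linarith
    then have "(v (u (n0 + n)))\<^sup>2 / (2 * K) \<le> v (u (n0 + Suc n))"
      using poly_growth[OF d K] by (simp add: u)
    moreover have "(2 * K\<^sup>2 * 2 ^ (2 ^ n))\<^sup>2 / (2 * K) \<le> (v (u (n0 + n)))\<^sup>2 / (2 * K)"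
      using Suc K(1) by (intro divide_right_mono power_mono) auto
    moreover have "(2 * K\<^sup>2 * 2 ^ (2 ^ n))\<^sup>2 / (2 * K) = K * (2 * K\<^sup>2 * 2 ^ (2 ^ Suc n))"
    proof -
      have "(2 ^ (2 ^ n) :: real)\<^sup>2 = 2 ^ (2 ^ Suc n)" by (simp add: mult.commute flip: power_mult)
      moreover have "(2 * K\<^sup>2 * A)\<^sup>2 / (2 * K) = K * (2 * K\<^sup>2 * A\<^sup>2)" for A
        using K(1) by (simp add: power2_eq_square field_simps)
      ultimately show ?thesis by simp
    qed
    moreover have "1 * (2 * K\<^sup>2 * 2 ^ (2 ^ Suc n)) \<le> K * (2 * K\<^sup>2 * 2 ^ (2 ^ Suc n))"
      using K(1) by (intro mult_right_mono) auto
    ultimately show ?case by linarith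
  qed
  have "v (u (n0 + n)) \<ge> 2 ^ (2 ^ n)" for n
  proof -
    have "1 * 2 ^ (2 ^ n) \<le> 2 * K\<^sup>2 * 2 ^ (2 ^ n)" using KK by (intro mult_right_mono) auto
    then show ?thesis using *[of n] by linarith
  qed
  then show ?thesis by blast
qed simp

text \<open>One composition turns an exponent \<open>s\<close> into \<open>1 + s * degree f\<close>,
  which is at most \<open>s * Suc (degree f)\<close>. This is the origin of the base
  \<open>Suc (degree f)\<close> in the later bounds.\<close>

lemma pnorm_poly_iterate:
  assumes d: "degree f \<ge> 1" and K: "K \<ge> 1" "v (1 / lead_coeff f) \<le> K" "pnorm v f \<le> K"
  shows "pnorm v (poly_iterate f n) \<le> K ^ (Suc (degree f) ^ n)"
    "v (1 / lead_coeff (poly_iterate f n)) \<le> K ^ (Suc (degree f) ^ n)"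
proof (induction n)
  case 0
  show "pnorm v (poly_iterate f 0) \<le> K ^ (Suc (degree f) ^ 0)"
    "v (1 / lead_coeff (poly_iterate f 0)) \<le> K ^ (Suc (degree f) ^ 0)"
    using K(1) by (simp_all add: pnorm_pCons)
next
  case (Suc n)
  define s where "s = Suc (degree f) ^ n"
  have s1: "s \<ge> 1" by (simp add: s_def)
  have Ks: "K ^ s \<ge> 1" using K(1) by (rule one_le_power)
  have step: "K * (K ^ s) ^ degree f \<le> K ^ (Suc (degree f) ^ Suc n)"
  proof -
    have "K * (K ^ s) ^ degree f = K ^ Suc (s * degree f)" by (simp add: power_mult)
    also have "\<dots> \<le> K ^ (Suc (degree f) ^ Suc n)"
      using K(1) s1 by (intro power_increasing) (auto simp: s_def)
    finally show ?thesis .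
  qed
  have "pnorm v (poly_iterate f (Suc n)) \<le> pnorm v f * (K ^ s) ^ degree f"
    using Suc(1) Ks by (simp add: pnorm_pcompose_le s_def)
  also have "\<dots> \<le> K * (K ^ s) ^ degree f" using K Ks by (intro mult_right_mono) auto
  finally show "pnorm v (poly_iterate f (Suc n)) \<le> K ^ (Suc (degree f) ^ Suc n)" using step by linarith
  have "lead_coeff (poly_iterate f (Suc n)) = lead_coeff f * lead_coeff (poly_iterate f n) ^ degree f"
    unfolding poly_iterate_Suc by (rule lead_coeff_comp) (use d in \<open>simp add: degree_poly_iterate\<close>)
  then have "v (1 / lead_coeff (poly_iterate f (Suc n))) =
      v (1 / lead_coeff f) * v (1 / lead_coeff (poly_iterate f n)) ^ degree f"
    by (simp add: mult divide power power_divide)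
  also have "\<dots> \<le> K * (K ^ s) ^ degree f"
    using Suc(2) K nonneg by (intro mult_mono power_mono) (auto simp: s_def)
  finally show "v (1 / lead_coeff (poly_iterate f (Suc n))) \<le> K ^ (Suc (degree f) ^ Suc n)" using step by linarith
qed

end

section \<open>Escaping places and the bound for one square class\<close>

lemma exists_pow2_bound:
  fixes g :: "'a \<Rightarrow> real"
  assumes "finite A"
  shows "\<exists>n::nat. \<forall>a\<in>A. g a \<le> 2 ^ n"
  using assms
proof induction
  case (insert a A)
  then obtain n where n: "\<forall>a\<in>A. g a \<le> 2 ^ n" by auto
  obtain m where m: "g a \<le> 2 ^ m" using real_arch_pow[of 2 "g a"] by (auto intro: less_imp_le)
  have "g b \<le> 2 ^ max m n" if "b \<in> insert a A" for b
    using that n m by (auto intro: order_trans[OF _ power_increasing])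
  then show ?case by blast
qed auto

text \<open>An orbit bounded at every place would be a bounded set of S-integers, hence finite.
  Taking a maximum makes the starting index \<open>n0\<close> common to all escaping places.\<close>

lemma escaping_places:
  fixes f :: "rat poly"
  assumes N: "N > 0" and d: "degree f \<ge> 2" and K: "K \<ge> 1"
    and Kw: "\<And>w. w \<in> places N \<Longrightarrow> val w (1 / lead_coeff f) \<le> K" "\<And>w. w \<in> places N \<Longrightarrow> pnorm (val w) f \<le> K"
    and u: "\<And>n. u (Suc n) = poly f (u n)" and sint: "\<And>n. sint N (u n)" and inf: "infinite (range u)"
  obtains E n0 where "E \<subseteq> places N" "E \<noteq> {}"
    "\<And>w n. w \<in> E \<Longrightarrow> val w (u (n0 + n)) \<ge> 2 ^ (2 ^ n)"
    "\<And>w n. w \<in> places N - E \<Longrightarrow> val w (u n) \<le> 4 * K\<^sup>2"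
proof -
  define E where "E = {w \<in> places N. \<exists>n0. \<forall>n. val w (u (n0 + n)) \<ge> 2 ^ (2 ^ n)}"
  have dich: "(\<forall>n. val w (u n) \<le> 4 * K\<^sup>2) \<or> (\<exists>n0. \<forall>n. val w (u (n0 + n)) \<ge> 2 ^ (2 ^ n))"
    if w: "w \<in> places N" for w
    by (rule abs_value.orbit_dichotomy[OF abs_value_val[OF w] d K Kw(1)[OF w] Kw(2)[OF w]]) (rule u)
  have small: "val w (u n) \<le> 4 * K\<^sup>2" if "w \<in> places N - E" for w n
    using dich[of w] that by (auto simp: E_def)
  have "E \<noteq> {}"
  proof
    assume "E = {}"
    then have "range u \<subseteq> {x. sint N x \<and> (\<forall>w\<in>places N. val w x \<le> 4 * K\<^sup>2)}"
      using small sint by auto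
    moreover have "1 * 1 \<le> 4 * K\<^sup>2" using K by (intro mult_mono one_le_power) auto
    then have "finite {x. sint N x \<and> (\<forall>w\<in>places N. val w x \<le> 4 * K\<^sup>2)}"
      by (intro finite_bounded_sint[OF N]) simp
    ultimately show False using inf finite_subset by blast
  qed
  moreover have "\<forall>w\<in>E. \<exists>n0. \<forall>n. val w (u (n0 + n)) \<ge> 2 ^ (2 ^ n)" by (auto simp: E_def)
  then obtain m where m: "\<And>w n. w \<in> E \<Longrightarrow> val w (u (m w + n)) \<ge> 2 ^ (2 ^ n)" by metis
  have finE: "finite E" by (rule finite_subset[of _ "places N"]) (auto simp: E_def)
  define n0 where "n0 = Max (m ` E)"
  have "val w (u (n0 + n)) \<ge> 2 ^ (2 ^ n)" if w: "w \<in> E" for w n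
  proof -
    have le: "m w \<le> n0" unfolding n0_def using w finE by (intro Max_ge) auto
    then have "val w (u (n0 + n)) \<ge> 2 ^ (2 ^ (n0 - m w + n))" using m[OF w, of "n0 - m w + n"] by simp
    moreover have "(2::real) ^ (2 ^ n) \<le> 2 ^ (2 ^ (n0 - m w + n))" by (intro power_increasing) auto
    ultimately show ?thesis by linarith
  qed
  ultimately show thesis using that[of E n0] small by (auto simp: E_def)
qed

text \<open>The Runge constant for coefficient bound \<open>K ^ (4 * s)\<close> and orbit bound
  \<open>4 * K^2\<close>, where \<open>K = 2 ^ \<kappa>\<close>, brought into the form 2 to a
  multiple of \<open>s^2\<close>. The numbers 20 = 3 + 15 + 2 and 62 = 12 + 48 + 2 collect the
  exponents of its four factors.\<close>

lemma runge_constant_le: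
  fixes \<kappa> s e n :: nat
  assumes "e \<ge> 1" "e \<le> s"
  shows "(8 * ((2 ^ \<kappa>) ^ (4 * s)) ^ 3 *
      (real (Suc e) * (2 * real e * ((2 ^ \<kappa>) ^ (4 * s))\<^sup>2) ^ (2 * e)) ^ 3 * (4 * (2 ^ \<kappa>)\<^sup>2) ^ e) ^ n
    \<le> 2 ^ ((20 + 62 * \<kappa>) * s\<^sup>2 * n)"
proof -
  have s1: "s \<ge> 1" using assms by simp
  have s2: "s \<le> s\<^sup>2" using s1 by (simp add: power2_eq_square)
  have e_le: "real e \<le> 2 ^ s"
  proof -
    have "e < 2 ^ e" by (rule less_exp)
    also have "\<dots> \<le> 2 ^ s" using assms by (intro power_increasing) auto
    finally show ?thesis by (metis less_imp_le of_nat_le_iff of_nat_numeral of_nat_power)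
  qed
  have Se_le: "real (Suc e) \<le> 2 ^ s"
  proof -
    have "Suc e \<le> 2 ^ e" by (rule Suc_leI[OF less_exp])
    also have "\<dots> \<le> 2 ^ s" using assms by (intro power_increasing) auto
    finally show ?thesis by (metis of_nat_le_iff of_nat_numeral of_nat_power)
  qed
  have pw: "((2 ^ \<kappa>) ^ (4 * s)) ^ k = (2::real) ^ (4 * \<kappa> * s * k)" for k by (simp add: mult_ac flip: power_mult)
  have "2 * real e * ((2 ^ \<kappa>) ^ (4 * s))\<^sup>2 \<le> 2 ^ 1 * 2 ^ s * 2 ^ (8 * \<kappa> * s)"
    unfolding pw using e_le by (intro mult_mono) (auto simp: mult_ac)
  also have "\<dots> = 2 ^ (1 + s + 8 * \<kappa> * s)" by (simp add: power_add)
  finally have "(2 * real e * ((2 ^ \<kappa>) ^ (4 * s))\<^sup>2) ^ (2 * e) \<le> (2 ^ (1 + s + 8 * \<kappa> * s)) ^ (2 * e)"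
    by (intro power_mono) auto
  also have "\<dots> = 2 ^ ((1 + s + 8 * \<kappa> * s) * (2 * e))" by (simp only: power_mult)
  also have "\<dots> \<le> 2 ^ ((4 + 16 * \<kappa>) * s\<^sup>2)"
  proof (rule power_increasing)
    have "(1 + s + 8 * \<kappa> * s) * (2 * e) \<le> (s + s + 8 * \<kappa> * s) * (2 * s)"
      using assms s1 by (intro mult_le_mono) auto
    also have "\<dots> = (4 + 16 * \<kappa>) * s\<^sup>2" by (simp add: power2_eq_square algebra_simps)
    finally show "(1 + s + 8 * \<kappa> * s) * (2 * e) \<le> (4 + 16 * \<kappa>) * s\<^sup>2" .
  qed simp
  finally have A: "(2 * real e * ((2 ^ \<kappa>) ^ (4 * s))\<^sup>2) ^ (2 * e) \<le> 2 ^ ((4 + 16 * \<kappa>) * s\<^sup>2)" .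
  have "real (Suc e) * (2 * real e * ((2 ^ \<kappa>) ^ (4 * s))\<^sup>2) ^ (2 * e) \<le> 2 ^ s * 2 ^ ((4 + 16 * \<kappa>) * s\<^sup>2)"
    using Se_le A by (intro mult_mono) auto
  also have "\<dots> = 2 ^ (s + (4 + 16 * \<kappa>) * s\<^sup>2)" by (simp add: power_add)
  also have "\<dots> \<le> 2 ^ ((5 + 16 * \<kappa>) * s\<^sup>2)"
    using s2 by (intro power_increasing) (auto simp: algebra_simps)
  finally have "(real (Suc e) * (2 * real e * ((2 ^ \<kappa>) ^ (4 * s))\<^sup>2) ^ (2 * e)) ^ 3 \<le> (2 ^ ((5 + 16 * \<kappa>) * s\<^sup>2)) ^ 3"
    by (intro power_mono) auto
  also have "\<dots> = 2 ^ ((15 + 48 * \<kappa>) * s\<^sup>2)" by (simp add: algebra_simps flip: power_mult)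
  finally have B: "(real (Suc e) * (2 * real e * ((2 ^ \<kappa>) ^ (4 * s))\<^sup>2) ^ (2 * e)) ^ 3 \<le> 2 ^ ((15 + 48 * \<kappa>) * s\<^sup>2)" .
  have C: "(4 * (2 ^ \<kappa>)\<^sup>2) ^ e \<le> (2::real) ^ ((2 + 2 * \<kappa>) * s)"
  proof -
    have "4 * (2 ^ \<kappa>)\<^sup>2 = (2::real) ^ (2 + 2 * \<kappa>)" by (simp add: power_add mult.commute flip: power_mult)
    then have "(4 * (2 ^ \<kappa>)\<^sup>2) ^ e = (2::real) ^ ((2 + 2 * \<kappa>) * e)" by (simp only: power_mult)
    also have "\<dots> \<le> 2 ^ ((2 + 2 * \<kappa>) * s)" using assms by (intro power_increasing mult_le_mono) auto
    finally show ?thesis .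
  qed
  have "8 * ((2 ^ \<kappa>) ^ (4 * s)) ^ 3 *
      (real (Suc e) * (2 * real e * ((2 ^ \<kappa>) ^ (4 * s))\<^sup>2) ^ (2 * e)) ^ 3 * (4 * (2 ^ \<kappa>)\<^sup>2) ^ e
      \<le> 2 ^ 3 * 2 ^ (12 * \<kappa> * s) * 2 ^ ((15 + 48 * \<kappa>) * s\<^sup>2) * 2 ^ ((2 + 2 * \<kappa>) * s)"
    unfolding pw[of 3] using B C by (intro mult_mono) (auto simp: mult_ac)
  also have "\<dots> = 2 ^ (3 + 12 * \<kappa> * s + (15 + 48 * \<kappa>) * s\<^sup>2 + (2 + 2 * \<kappa>) * s)" by (simp only: power_add)
  also have "\<dots> \<le> 2 ^ ((20 + 62 * \<kappa>) * s\<^sup>2)"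
  proof (rule power_increasing)
    have "\<kappa> * s \<le> \<kappa> * s\<^sup>2" using s2 by (rule mult_le_mono2)
    moreover have "1 \<le> s\<^sup>2" using s1 by simp
    moreover have "3 + 12 * \<kappa> * s + (15 + 48 * \<kappa>) * s\<^sup>2 + (2 + 2 * \<kappa>) * s =
      3 + 2 * s + 15 * s\<^sup>2 + 14 * (\<kappa> * s) + 48 * (\<kappa> * s\<^sup>2)" by (simp add: algebra_simps)
    moreover have "(20 + 62 * \<kappa>) * s\<^sup>2 = 20 * s\<^sup>2 + 62 * (\<kappa> * s\<^sup>2)" by (simp add: algebra_simps)
    ultimately show "3 + 12 * \<kappa> * s + (15 + 48 * \<kappa>) * s\<^sup>2 + (2 + 2 * \<kappa>) * s \<le> (20 + 62 * \<kappa>) * s\<^sup>2"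
      using s2 by linarith
  qed simp
  finally have "(8 * ((2 ^ \<kappa>) ^ (4 * s)) ^ 3 *
      (real (Suc e) * (2 * real e * ((2 ^ \<kappa>) ^ (4 * s))\<^sup>2) ^ (2 * e)) ^ 3 * (4 * (2 ^ \<kappa>)\<^sup>2) ^ e) ^ n
      \<le> (2 ^ ((20 + 62 * \<kappa>) * s\<^sup>2)) ^ n"
    by (intro power_mono) auto
  then show ?thesis by (simp only: power_mult)
qed

text \<open>Each index of \<open>J\<close> determines the set of escaping places at which its square
  root, taken relative to a fixed \<open>j0\<close>, has positive sign. Two indices with the same
  set give an S-integral point on the same branch at all escaping places, as
  \<open>runge_bound\<close> requires. The hypothesis relating \<open>M\<close> and \<open>L\<close>
  makes the Runge constant smaller than that point.\<close>

lemma square_class_card: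
  fixes f :: "rat poly"
  assumes N: "N > 0" and half: "sint N (1 / 2)" and d: "even (degree f)" "degree f > 0"
    and f: "sint_poly N f" "sint N (1 / lead_coeff f)"
    and u: "\<And>n. u n = poly (poly_iterate f n) (u 0)" and u0: "sint N (u 0)" and inf: "infinite (range u)"
    and nonsq: "\<And>k H. k \<ge> 1 \<Longrightarrow> sint_poly N H \<Longrightarrow>
      smult (lead_coeff f * lead_coeff (poly_iterate f (Suc k))) (H\<^sup>2) \<noteq> f * poly_iterate f (Suc k)"
  obtains C n0 where
    "\<And>n. n \<ge> n0 \<Longrightarrow> u n \<noteq> 0"
    "\<And>M L J. n0 \<le> M \<Longrightarrow> C * Suc (degree f) ^ (2 * L + 2) < 2 ^ (M - n0) \<Longrightarrow> J \<subseteq> {M<..M + L} \<Longrightarrow>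
      (\<And>i j. i \<in> J \<Longrightarrow> j \<in> J \<Longrightarrow> \<exists>y. u i * u j = y\<^sup>2) \<Longrightarrow> card J \<le> C"
proof -
  define d where "d = degree f"
  obtain h where h: "d = 2 * h" using d(1) by (auto simp: d_def)
  have h1: "h \<ge> 1" using h d(2) by (simp add: d_def)
  have d2: "d \<ge> 2" using h h1 by simp
  define c where "c = lead_coeff f"
  have f0: "f \<noteq> 0" using d(2) by auto
  then have c0: "c \<noteq> 0" by (simp add: c_def)
  define P where "P k = poly_iterate f k" for k
  have uSuc: "u (Suc n) = poly f (u n)" for n
    by (metis u poly_iterate_Suc poly_pcompose)
  have uadd: "u (k + n) = poly (P k) (u n)" for k n
    by (metis u P_def poly_iterate_add poly_pcompose)
  have su: "sint N (u n)" for n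
    by (induction n) (auto simp: u0 uSuc intro: sint_poly_eval f)
  note ex = exists_pow2_bound[OF finite_places[of N]]
  obtain \<kappa>1 where k1: "\<forall>w\<in>places N. val w (1 / c) \<le> 2 ^ \<kappa>1" using ex[of "\<lambda>w. val w (1 / c)"] by auto
  obtain \<kappa>2 where k2: "\<forall>w\<in>places N. pnorm (val w) f \<le> 2 ^ \<kappa>2" using ex[of "\<lambda>w. pnorm (val w) f"] by auto
  obtain \<kappa>3 where k3: "\<forall>w\<in>places N. val w (1 / 2) \<le> 2 ^ \<kappa>3" using ex[of "\<lambda>w. val w (1 / 2)"] by auto
  define \<kappa> where "\<kappa> = Suc (\<kappa>1 + \<kappa>2 + \<kappa>3)"
  define K :: real where "K = 2 ^ \<kappa>"
  have inc: "(2::real) ^ \<kappa>1 \<le> K" "(2::real) ^ \<kappa>2 \<le> K" "(2::real) ^ \<kappa>3 \<le> K"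
    unfolding K_def \<kappa>_def by (intro power_increasing; simp)+
  have K1: "K \<ge> 1" by (simp add: K_def)
  have Kc: "val w (1 / c) \<le> K" and Kf: "pnorm (val w) f \<le> K" and K2: "val w (1 / 2) \<le> K"
    if "w \<in> places N" for w using k1 k2 k3 inc that by (meson order_trans)+
  obtain E n0 where E: "E \<subseteq> places N" "E \<noteq> {}"
    and big: "\<And>w n. w \<in> E \<Longrightarrow> val w (u (n0 + n)) \<ge> 2 ^ (2 ^ n)"
    and small: "\<And>w n. w \<in> places N - E \<Longrightarrow> val w (u n) \<le> 4 * K\<^sup>2"
    using escaping_places[OF N, of f K u] d2 K1 Kc Kf uSuc su inf unfolding d_def c_def by metis
  have finE: "finite E" by (rule finite_subset[OF E(1) finite_places])
  obtain w0 where w0: "w0 \<in> E" using E by auto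
  have av: "abs_value (val w)" if "w \<in> E" for w using abs_value_val that E by auto
  have un0: "u n \<noteq> 0" if "n \<ge> n0" for n
  proof
    assume "u n = 0"
    then have "val w0 (u n) = 0" using abs_value.zero[OF av[OF w0]] by simp
    moreover have "val w0 (u n) \<ge> 2 ^ (2 ^ (n - n0))" using big[OF w0, of "n - n0"] that by simp
    moreover have "(2::real) ^ (2 ^ (n - n0)) > 0" by simp
    ultimately show False by linarith
  qed
  \<comment> \<open>The first summand is the pigeonhole bound. The other two bring the Runge
    constant and the factor \<open>2 ^ h\<close>, lost when \<open>\<rho>\<close> is raised to the
    power \<open>h\<close>, under the growth hypothesis.\<close>
  define C where "C = 2 ^ card E + (20 + 62 * \<kappa>) * Suc (card (places N)) + h"
  have main: "card J \<le> C"
    if M: "n0 \<le> M" and L: "C * Suc d ^ (2 * L + 2) < 2 ^ (M - n0)" and J: "J \<subseteq> {M<..M + L}"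
      and sq: "\<And>i j. i \<in> J \<Longrightarrow> j \<in> J \<Longrightarrow> \<exists>y. u i * u j = y\<^sup>2" for M L J
  proof (rule ccontr)
    assume "\<not> card J \<le> C"
    then have cJ: "card J > card (Pow E)" using finE by (simp add: C_def card_Pow)
    then obtain j0 where j0: "j0 \<in> J" by fastforce
    define m where "m = M - n0"
    define T :: real where "T = 2 ^ (2 ^ m)"
    define s where "s = Suc d ^ Suc L"
    have ss: "s\<^sup>2 = Suc d ^ (2 * L + 2)"
    proof -
      have "2 * L + 2 = Suc L * 2" by simp
      then show ?thesis by (simp only: s_def power_mult)
    qed
    have s3: "s \<ge> 3" using d2 mult_le_mono[of 3 "Suc d" 1 "Suc d ^ L"] by (simp add: s_def)
    then have s1: "s \<ge> 1" by simp
    have s2: "s \<le> s\<^sup>2" using s1 by (simp add: power2_eq_square)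
    have Ls: "C * s\<^sup>2 < 2 ^ m" using L unfolding ss m_def .
    have T1: "T \<ge> 1" by (simp add: T_def)
    \<comment> \<open>Predecessors are used so that \<open>u i * u j\<close> is the value at
      \<open>x i\<close> of the even-degree polynomial \<open>f * P (Suc k)\<close>.\<close>
    define x where "x j = u (j - 1)" for j
    have jM: "j \<ge> 1" "j - 1 \<ge> M" if "j \<in> J" for j using that J by force+
    have ux: "u j = poly f (x j)" if "j \<in> J" for j
      using uSuc[of "j - 1"] jM[OF that] by (simp add: x_def)
    have xT: "val w (x j) \<ge> T" if "j \<in> J" "w \<in> E" for j w
    proof -
      have "val w (x j) \<ge> 2 ^ (2 ^ (j - 1 - n0))"
        using big[OF that(2), of "j - 1 - n0"] jM[OF that(1)] M by (simp add: x_def)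
      moreover have "T \<le> 2 ^ (2 ^ (j - 1 - n0))"
        unfolding T_def m_def using jM[OF that(1)] M by (intro power_increasing) auto
      ultimately show ?thesis by linarith
    qed
    have x0: "x j \<noteq> 0" if "j \<in> J" for j using un0[of "j - 1"] jM[OF that] M by (simp add: x_def)
    have u0: "u j \<noteq> 0" if "j \<in> J" for j using un0[of j] jM[OF that] M by simp
    define r where "r j = u j / (c * x j ^ d)" for j
    have r0: "r j \<noteq> 0" if "j \<in> J" for j using u0 x0 c0 that by (simp add: r_def)
    have r_near: "val w (r j - 1) \<le> K\<^sup>2 / T" if "j \<in> J" "w \<in> E" for j w
    proof -
      interpret abs_value "val w" using av[OF that(2)] .
      obtain n where n: "degree f = Suc n" using d(2) gr0_conv_Suc by blast
      have "val w (poly f (x j) / (lead_coeff f * x j ^ Suc n) - 1) \<le> K\<^sup>2 / T"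
        using that E Kc Kf T1 xT by (intro lead_ratio n) (auto simp: c_def)
      then show ?thesis by (simp add: r_def ux[OF that(1)] c_def d_def n)
    qed
    \<comment> \<open>All square roots are taken against the one index \<open>j0\<close>, so that
      their signs can be compared.\<close>
    obtain t where t: "\<And>j. j \<in> J \<Longrightarrow> u j0 * u j = (t j)\<^sup>2" using sq[OF j0] by metis
    define \<sigma> where "\<sigma> j = t j / u j0 * x j0 ^ h / x j ^ h" for j
    have \<sigma>2: "(\<sigma> j)\<^sup>2 * r j0 = r j" if "j \<in> J" for j
    proof -
      have xx: "x i ^ d = (x i ^ h)\<^sup>2" for i by (simp add: h mult.commute flip: power_mult)
      have "(\<sigma> j)\<^sup>2 * r j0 = (t j)\<^sup>2 / (u j0)\<^sup>2 * (x j0 ^ h)\<^sup>2 / (x j ^ h)\<^sup>2 * (u j0 / (c * (x j0 ^ h)\<^sup>2))"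
        by (simp add: \<sigma>_def r_def power_mult_distrib power_divide xx)
      also have "\<dots> = u j / (c * (x j ^ h)\<^sup>2)"
        unfolding t[OF that, symmetric]
        using u0[OF j0] x0[OF j0] x0[OF that] c0 by (simp add: power2_eq_square)
      finally show ?thesis by (simp add: r_def xx)
    qed
    define S where "S j = {w \<in> E. val w (\<sigma> j - 1) \<le> val w (\<sigma> j + 1)}" for j
    have "\<not> inj_on S J"
    proof
      assume "inj_on S J"
      moreover have "S ` J \<subseteq> Pow E" by (auto simp: S_def)
      ultimately have "card J \<le> card (Pow E)" using finE by (intro card_inj_on_le) auto
      then show False using cJ by simp
    qed
    then obtain i1 i2 where "i1 \<in> J" "i2 \<in> J" "i1 \<noteq> i2" "S i1 = S i2" by (auto simp: inj_on_def)
    then obtain i j where ij: "i \<in> J" "j \<in> J" "i < j" "S i = S j" by (metis nat_neq_iff)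
    define k where "k = j - i"
    have "i \<in> {M<..M + L}" "j \<in> {M<..M + L}" using ij J by auto
    then have k1: "k \<ge> 1" and kL: "k < L" and jk: "j = k + i"
      using ij(3) by (auto simp: k_def)
    define lk where "lk = lead_coeff (P k)"
    have degP: "degree (P n) = d ^ n" for n unfolding P_def d_def by (rule degree_poly_iterate)
    have lk0: "lk \<noteq> 0"
    proof -
      have "degree (P k) > 0" using degP d2 by simp
      then show ?thesis by (auto simp: lk_def)
    qed
    have lP: "lead_coeff (P (Suc k)) = c * lk ^ d"
      unfolding P_def poly_iterate_Suc c_def lk_def d_def
      by (rule lead_coeff_comp) (use degP[of k] d2 in \<open>simp add: P_def\<close>)
    \<comment> \<open>As the degree is even, \<open>c * lead_coeff (P (Suc k))\<close> is a rational
      square, so \<open>F\<close> can be made monic without twisting the curve.\<close>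
    define \<mu> where "\<mu> = c * lk ^ h"
    have \<mu>0: "\<mu> \<noteq> 0" using c0 lk0 by (simp add: \<mu>_def)
    have \<mu>2: "\<mu>\<^sup>2 = c * lead_coeff (P (Suc k))"
      unfolding lP by (simp add: \<mu>_def h power_mult_distrib power2_eq_square mult_ac power_mult)
    define F where "F = smult (1 / \<mu>\<^sup>2) (f * P (Suc k))"
    define e where "e = h * (1 + d ^ k)"
    have e2: "2 * e = d + d ^ Suc k" by (simp add: e_def h algebra_simps)
    have e1: "e \<ge> 1" using h1 by (simp add: e_def)
    have es: "e \<le> s"
    proof -
      have "1 + d ^ k \<le> (1 + d) ^ k" using k1 d2
      proof (induction k rule: nat_induct_at_least)
        case (Suc k)
        have "1 + d ^ Suc k \<le> (1 + d ^ k) * (1 + d)" by (simp add: algebra_simps)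
        also have "\<dots> \<le> (1 + d) ^ k * (1 + d)" using Suc by (intro mult_le_mono) auto
        finally show ?case by (simp add: mult.commute)
      qed simp
      then have "e \<le> Suc d * Suc d ^ k" unfolding e_def using h by (intro mult_le_mono) auto
      also have "\<dots> = Suc d ^ Suc k" by simp
      also have "\<dots> \<le> s" unfolding s_def using kL by (intro power_increasing) auto
      finally show ?thesis .
    qed
    have PSk0: "P (Suc k) \<noteq> 0" using lP c0 lk0 by auto
    have degF: "degree F = 2 * e"
      using \<mu>0 f0 PSk0 by (simp add: F_def degree_mult_eq degP e2 d_def)
    have lcF: "poly.coeff F (2 * e) = 1"
    proof -
      have "poly.coeff F (2 * e) = lead_coeff F" by (simp add: degF)
      also have "\<dots> = 1 / \<mu>\<^sup>2 * (c * lead_coeff (P (Suc k)))" by (simp add: F_def lead_coeff_mult c_def)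
      also have "\<dots> = 1" using \<mu>0 by (simp add: \<mu>2[symmetric])
      finally show ?thesis .
    qed
    have sP: "sint_poly N (P n)" for n unfolding P_def
    proof (induction n)
      case 0
      show ?case by (auto simp: sint_poly_def coeff_pCons split: nat.splits)
    next
      case (Suc n)
      have "sint_poly N (A \<circ>\<^sub>p B)" if "sint_poly N A" "sint_poly N B" for A B
        using that(1)
      proof (induction A)
        case 0
        show ?case by (simp add: sint_poly_def)
      next
        case (pCons a A)
        have "sint N (poly.coeff (pCons a A) n)" for n using pCons.prems by (simp add: sint_poly_def)
        from this[of 0] this[of "Suc _"] have a: "sint N a" "sint_poly N A" by (auto simp: sint_poly_def)
        have "sint_poly N [:a:]" using a by (auto simp: sint_poly_def coeff_pCons split: nat.splits)
        then show ?case unfolding pcompose_pCons using a pCons.IH that(2)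
          by (intro sint_poly_add sint_poly_mult) auto
      qed
      then show ?case using Suc f by simp
    qed
    have sc: "sint N (1 / c)" using f(2) by (simp add: c_def)
    have slP: "sint N (1 / lead_coeff (P n))" for n
    proof (induction n)
      case (Suc n)
      have "lead_coeff (P (Suc n)) = c * lead_coeff (P n) ^ d"
        unfolding P_def poly_iterate_Suc c_def d_def
        by (rule lead_coeff_comp) (use degP[of n] d2 in \<open>simp add: P_def\<close>)
      then have eq: "1 / lead_coeff (P (Suc n)) = 1 / c * (1 / lead_coeff (P n)) ^ d"
        by (simp add: power_divide)
      show ?case unfolding eq by (intro sint_mult sint_power Suc sc)
    qed (simp add: P_def)
    have sF: "sint_poly N F"
    proof -
      have eq: "1 / \<mu>\<^sup>2 = 1 / c * (1 / lead_coeff (P (Suc k)))" by (simp add: \<mu>2)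
      have "sint N (1 / \<mu>\<^sup>2)" unfolding eq by (intro sint_mult sc slP)
      then show ?thesis unfolding F_def by (intro sint_poly_smult sint_poly_mult f sP)
    qed
    have Kpow: "K ^ (Suc d ^ n) \<le> K ^ s" if "n \<le> Suc L" for n
      unfolding s_def using K1 that by (intro power_increasing) auto
    have nP: "pnorm (val w) (P n) \<le> K ^ s" "val w (1 / lead_coeff (P n)) \<le> K ^ s"
      if w: "w \<in> places N" and n: "n \<le> Suc L" for w n
      using abs_value.pnorm_poly_iterate[OF abs_value_val[OF w], of f K n] Kpow[OF n] d(2) K1 Kc[OF w] Kf[OF w]
      by (auto simp: P_def d_def c_def)
    have Ks: "K \<le> K ^ s" using K1 s1 power_increasing[of 1 s K] by simp
    \<comment> \<open>The exponent 4 counts the factors: the inverses of two leading coefficients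
      and the norms of \<open>f\<close> and \<open>P (Suc k)\<close>.\<close>
    have nF: "pnorm (val w) F \<le> K ^ (4 * s)" if w: "w \<in> places N" for w
    proof -
      interpret abs_value "val w" using abs_value_val[OF w] .
      have "pnorm (val w) F = val w (1 / c) * val w (1 / lead_coeff (P (Suc k))) * pnorm (val w) (f * P (Suc k))"
        unfolding F_def pnorm_smult \<mu>2 by (subst mult[symmetric]) simp
      also have "\<dots> \<le> K ^ s * K ^ s * (K ^ s * K ^ s)"
        using Kc[OF w] Kf[OF w] nP[OF w, of "Suc k"] kL Ks K1 pnorm_nonneg nonneg
        by (intro mult_mono order_trans[OF pnorm_mult_le]) auto
      also have "\<dots> = K ^ ((s + s) + (s + s))" by (simp only: power_add)
      also have "(s + s) + (s + s) = 4 * s" by simp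
      finally show ?thesis .
    qed
    define y where "y = u j0 * t i * t j / \<mu> / (u j0)\<^sup>2"
    have y2: "y\<^sup>2 = poly F (x i)"
    proof -
      have "poly f (x i) = u i" using ux[OF ij(1)] by simp
      moreover have "poly (P (Suc k)) (x i) = u j"
        using uadd[of "Suc k" "i - 1"] jk jM[OF ij(1)] by (simp add: x_def)
      ultimately have "poly F (x i) = u i * u j / \<mu>\<^sup>2" by (simp add: F_def)
      moreover have "y\<^sup>2 = (u j0)\<^sup>2 * (t i)\<^sup>2 * (t j)\<^sup>2 / \<mu>\<^sup>2 / ((u j0)\<^sup>2)\<^sup>2"
        by (simp add: y_def power_mult_distrib power_divide)
      moreover have "\<dots> = u i * u j / \<mu>\<^sup>2"
        unfolding t[OF ij(1), symmetric] t[OF ij(2), symmetric]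
        using u0[OF j0] by (simp add: power2_eq_square)
      ultimately show ?thesis by simp
    qed
    have sx: "sint N (x i)" by (simp add: x_def su)
    have sy: "sint N y"
      by (rule sint_sqrt) (simp add: y2 sint_poly_eval[OF sF sx])
    \<comment> \<open>\<open>y / x i ^ e\<close> splits into a part governed by the common signs of
      \<open>i\<close> and \<open>j\<close> and the power \<open>\<rho> ^ h\<close>, where
      \<open>\<rho>\<close> is close to 1 because \<open>x j\<close> is an iterate of
      \<open>x i\<close>.\<close>
    define \<rho> where "\<rho> = x j / (lk * x i ^ (d ^ k))"
    have yx: "y / x i ^ e = (\<sigma> i * \<sigma> j * r j0) * \<rho> ^ h"
    proof -
      have xd: "x j0 ^ d = x j0 ^ h * x j0 ^ h" by (simp add: h mult_2 flip: power_add)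
      have xe: "x i ^ e = x i ^ h * x i ^ (d ^ k * h)" by (simp add: e_def algebra_simps power_add)
      have "(\<sigma> i * \<sigma> j * r j0) * \<rho> ^ h =
        (t i / u j0 * x j0 ^ h / x i ^ h) * (t j / u j0 * x j0 ^ h / x j ^ h) * (u j0 / (c * (x j0 ^ h * x j0 ^ h))) *
        (x j ^ h / (lk ^ h * x i ^ (d ^ k * h)))"
        by (simp add: \<sigma>_def r_def \<rho>_def xd power_divide power_mult_distrib power_mult)
      also have "\<dots> = t i * t j / u j0 / (c * lk ^ h) / (x i ^ h * x i ^ (d ^ k * h))"
        using x0[OF j0] x0[OF ij(2)] u0[OF j0] by simp
      also have "\<dots> = y / x i ^ e"
        using u0[OF j0] by (simp add: y_def \<mu>_def xe power2_eq_square)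
      finally show ?thesis by simp
    qed
    have ks: "(20 + 62 * \<kappa>) * Suc (card (places N)) * s\<^sup>2 < 2 ^ m"
      using Ls by (simp add: C_def algebra_simps)
    have "(20 + 62 * \<kappa>) * s\<^sup>2 \<le> (20 + 62 * \<kappa>) * Suc (card (places N)) * s\<^sup>2" by simp
    then have ks': "(20 + 62 * \<kappa>) * s\<^sup>2 < 2 ^ m" using ks by linarith
    have near: "val w (y / x i ^ e - 1) \<le> val w 2 / 4" if w: "w \<in> E" for w
    proof -
      interpret abs_value "val w" using av[OF w] .
      have wp: "w \<in> places N" using w E by auto
      obtain m' where m': "m = Suc m'"
      proof (cases m)
        case 0
        have "1 * 1 \<le> (20 + 62 * \<kappa>) * s\<^sup>2" using s1 by (intro mult_le_mono) auto
        then show ?thesis using ks' 0 by simp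
      qed
      \<comment> \<open>\<open>V\<close> is the square root of \<open>T\<close>: squares known up to
        \<open>K^2 / T\<close> determine the numbers themselves only up to order
        \<open>K / V\<close>.\<close>
      define V :: real where "V = 2 ^ (2 ^ m')"
      have TV: "T = V\<^sup>2" by (simp add: T_def V_def m' mult.commute flip: power_mult)
      have V0: "V > 0" by (simp add: V_def)
      have V_ge: "V \<ge> 2 ^ 8 * K\<^sup>2"
      proof -
        define Q where "Q = (20 + 62 * \<kappa>) * s\<^sup>2"
        have "(20 + 62 * \<kappa>) * 1 \<le> Q" unfolding Q_def using s1 by (intro mult_le_mono) auto
        moreover have "Q < 2 * 2 ^ m'" using ks' m' by (simp add: Q_def)
        ultimately have "8 + 2 * \<kappa> \<le> 2 ^ m'" by simp
        then have "(2::real) ^ (8 + 2 * \<kappa>) \<le> V" unfolding V_def by (intro power_increasing) auto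
        then show ?thesis by (simp add: K_def power_add mult.commute flip: power_mult)
      qed
      define \<epsilon> where "\<epsilon> = 2 * K / V"
      have \<epsilon>0: "0 \<le> \<epsilon>" using K1 V0 by (simp add: \<epsilon>_def)
      have \<epsilon>K: "\<epsilon> \<le> 1 / (128 * K)"
      proof -
        have "K > 0" using K1 by simp
        then have "2 * K / V \<le> 2 * K / (2 ^ 8 * K\<^sup>2)" using V_ge V0 by (intro divide_left_mono) auto
        also have "\<dots> = 1 / (128 * K)" using K1 by (simp add: power2_eq_square)
        finally show ?thesis by (simp add: \<epsilon>_def)
      qed
      also have "\<dots> \<le> 1 / 128" using K1 by (intro divide_left_mono) auto
      finally have \<epsilon>1: "\<epsilon> \<le> 1 / 128" .
      have \<eta>: "4 * (K\<^sup>2 / T) = \<epsilon>\<^sup>2" by (simp add: TV \<epsilon>_def power_divide power_mult_distrib)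
      have "\<epsilon>\<^sup>2 \<le> 1" using \<epsilon>0 \<epsilon>1 power_mono[of \<epsilon> 1 2] by simp
      then have \<eta>2: "K\<^sup>2 / T \<le> 1 / 2" using \<eta> by linarith
      have sign: "val w (\<sigma> i - 1) \<le> val w (\<sigma> i + 1) \<longleftrightarrow> val w (\<sigma> j - 1) \<le> val w (\<sigma> j + 1)"
        using ij(4) w by (auto simp: S_def)
      have \<eta>': "4 * (K\<^sup>2 / T) \<le> \<epsilon>\<^sup>2" unfolding \<eta> by (rule order_refl)
      have \<epsilon>1': "\<epsilon> \<le> 1" using \<epsilon>1 by simp
      have A: "val w (\<sigma> i * \<sigma> j * r j0 - 1) \<le> 7 * \<epsilon>"
        by (rule same_sign_near[OF r_near[OF j0 w] r_near[OF ij(1) w] r_near[OF ij(2) w]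
            \<eta>2 \<sigma>2[OF ij(1)] \<sigma>2[OF ij(2)] sign \<eta>' \<epsilon>0 \<epsilon>1'])
      have R: "val w (\<rho> - 1) \<le> (K ^ s)\<^sup>2 / T"
      proof -
        have "degree (P k) > 0" using degP d2 by simp
        then obtain n where n: "degree (P k) = Suc n" using gr0_conv_Suc by blast
        have "val w (poly (P k) (x i) / (lead_coeff (P k) * x i ^ Suc n) - 1) \<le> (K ^ s)\<^sup>2 / T"
          using nP[OF wp, of k] kL xT[OF ij(1) w] T1 by (intro lead_ratio n) auto
        moreover have "poly (P k) (x i) = x j"
          using uadd[of k "i - 1"] jk jM[OF ij(1)] by (simp add: x_def)
        moreover have "Suc n = d ^ k" using n degP[of k] by simp
        ultimately show ?thesis by (simp add: \<rho>_def lk_def)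
      qed
      have R2: "2 ^ h * ((K ^ s)\<^sup>2 / T) \<le> 1 / (8 * K)"
      proof -
        define q where "q = s\<^sup>2"
        have q: "1 \<le> q" "s \<le> q" using s1 s2 by (simp_all add: q_def)
        have "h * q + (20 + 62 * \<kappa>) * q \<le> C * q" by (simp add: C_def algebra_simps)
        then have "h * q + (20 + 62 * \<kappa>) * q < 2 ^ m" using Ls by (simp add: q_def)
        moreover have "h * 1 + (3 + \<kappa> + 2 * \<kappa>) * q \<le> h * q + (20 + 62 * \<kappa>) * q"
        proof (rule add_mono)
          show "h * 1 \<le> h * q" using q by simp
          show "(3 + \<kappa> + 2 * \<kappa>) * q \<le> (20 + 62 * \<kappa>) * q" by (rule mult_le_mono1) simp
        qed
        moreover have "h + 3 + \<kappa> + 2 * \<kappa> * s \<le> h * 1 + (3 + \<kappa> + 2 * \<kappa>) * q"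
        proof -
          have "\<kappa> * s \<le> \<kappa> * q" "\<kappa> * 1 \<le> \<kappa> * q" using q by (intro mult_le_mono2; simp)+
          moreover have "(3 + \<kappa> + 2 * \<kappa>) * q = 3 * q + \<kappa> * q + 2 * (\<kappa> * q)" "2 * \<kappa> * s = 2 * (\<kappa> * s)"
            by (simp_all add: algebra_simps)
          ultimately show ?thesis using q(1) by linarith
        qed
        ultimately have "h + 3 + \<kappa> + 2 * \<kappa> * s \<le> 2 ^ m" by (meson le_trans less_imp_le)
        then have "(2::real) ^ (h + 3 + \<kappa> + 2 * \<kappa> * s) \<le> T" unfolding T_def by (intro power_increasing) auto
        then have "2 ^ h * 8 * K * (K ^ s)\<^sup>2 \<le> T"
          by (simp add: K_def power_add mult_ac flip: power_mult)
        then show ?thesis using K1 T1 by (simp add: field_simps)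
      qed
      have R1: "(K ^ s)\<^sup>2 / T \<le> 1"
      proof -
        have "1 * ((K ^ s)\<^sup>2 / T) \<le> 2 ^ h * ((K ^ s)\<^sup>2 / T)" using T1 by (intro mult_right_mono) auto
        moreover have "1 / (8 * K) \<le> 1" using K1 by simp
        ultimately show ?thesis using R2 by linarith
      qed
      have "val w (\<rho> ^ h - 1) \<le> (2 ^ h - 1) * ((K ^ s)\<^sup>2 / T)" by (rule near_power[OF R R1])
      also have "\<dots> \<le> 2 ^ h * ((K ^ s)\<^sup>2 / T)" using T1 by (intro mult_right_mono) auto
      also have "\<dots> \<le> 1 / (8 * K)" by (rule R2)
      finally have B: "val w (\<rho> ^ h - 1) \<le> 1 / (8 * K)" .
      have "1 / (8 * K) \<le> 1" using K1 by simp
      from near_mult[OF A B this]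
      have "val w (y / x i ^ e - 1) \<le> 14 * \<epsilon> + 1 / (8 * K)" unfolding yx by simp
      also have "\<dots> \<le> 14 * (1 / (128 * K)) + 1 / (8 * K)" using \<epsilon>K by simp
      also have "\<dots> \<le> 1 / (4 * K)" using K1 by (simp add: field_simps)
      also have "\<dots> \<le> val w 2 / 4"
      proof -
        have "1 / val w 2 \<le> K" using K2[OF wp] by (simp add: divide)
        moreover have "val w 2 > 0" by (simp add: pos_iff)
        ultimately show ?thesis using K1 by (simp add: field_simps)
      qed
      finally show ?thesis .
    qed
    have K4: "1 \<le> K ^ (4 * s)" "val w (1 / 2) \<le> K ^ (4 * s)" if "w \<in> places N" for w
      using K2[OF that] K1 s1 power_increasing[of 1 "4 * s" K] by auto
    have nsF: "H\<^sup>2 \<noteq> F" if H: "sint_poly N H" for H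
    proof
      assume "H\<^sup>2 = F"
      then have "smult (\<mu>\<^sup>2) (H\<^sup>2) = f * P (Suc k)" using \<mu>0 by (simp add: F_def)
      then show False using nonsq[OF k1 H] by (simp add: \<mu>2 P_def c_def)
    qed
    have "(1::real) * 1 \<le> 4 * K\<^sup>2" using K1 by (intro mult_mono one_le_power) auto
    then have B1: "4 * K\<^sup>2 \<ge> 1" by simp
    have K4': "1 \<le> K ^ (4 * s)" using K1 by (rule one_le_power)
    have "T \<le> (8 * (K ^ (4 * s)) ^ 3 * (real (Suc e) * (2 * real e * (K ^ (4 * s))\<^sup>2) ^ (2 * e)) ^ 3 * (4 * K\<^sup>2) ^ e)
        ^ Suc (card (places N))"
    proof (rule runge_bound[OF N half _ lcF sF e1 K4' nF K4(2) nsF sx sy y2 E(1) w0 _ near _ B1 refl])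
      show "degree F \<le> 2 * e" by (simp add: degF)
      show "\<And>w. w \<in> E \<Longrightarrow> T \<le> val w (x i)" by (rule xT[OF ij(1)])
      show "\<And>w. w \<in> places N - E \<Longrightarrow> val w (x i) \<le> 4 * K\<^sup>2" unfolding x_def by (rule small)
    qed
    also have "\<dots> \<le> 2 ^ ((20 + 62 * \<kappa>) * s\<^sup>2 * Suc (card (places N)))"
      unfolding K_def by (rule runge_constant_le[OF e1 es])
    also have "\<dots> < 2 ^ (2 ^ m)"
    proof (rule power_strict_increasing)
      have "(20 + 62 * \<kappa>) * s\<^sup>2 * Suc (card (places N)) = (20 + 62 * \<kappa>) * Suc (card (places N)) * s\<^sup>2"
        by (simp only: mult_ac)
      then show "(20 + 62 * \<kappa>) * s\<^sup>2 * Suc (card (places N)) < 2 ^ m" using ks by simp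
    qed simp
    finally show False by (simp add: T_def)
  qed
  show thesis
    by (rule that[of n0 C]) (use un0 main in \<open>auto simp: d_def\<close>)
qed

section \<open>Counting primes\<close>

lemma of_int_poly_pcompose:
  "(of_int_poly (A \<circ>\<^sub>p B) :: 'k::comm_ring_1 poly) = of_int_poly A \<circ>\<^sub>p of_int_poly B"
  by (induction A)
    (auto simp: pcompose_pCons of_int_hom.map_poly_pCons_hom of_int_poly_hom.hom_mult of_int_poly_hom.hom_add)

lemma of_int_poly_poly_iterate:
  "(of_int_poly (poly_iterate f n) :: 'k::comm_ring_1 poly) = poly_iterate (of_int_poly f) n"
  by (induction n) (auto simp: of_int_poly_pcompose of_int_hom.map_poly_pCons_hom)

text \<open>If \<open>g\<close> were zero, \<open>f\<close> would be constant and every orbit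
  finite. Otherwise the derivative has the odd degree \<open>2 * degree g + 1\<close>.\<close>

lemma degree_critical:
  fixes f g :: "int poly"
  assumes f': "pderiv f = g ^ 2 * [:b, a:]" and a: "a \<noteq> 0"
    and np: "\<not> preperiodic (of_int_poly f :: rat poly) x"
  shows "even (degree f)" "degree f > 0"
proof -
  have "g \<noteq> 0"
  proof
    assume "g = 0"
    then have "degree f = 0" using f' by (simp add: pderiv_eq_0_iff)
    then obtain c where c: "f = [:c:]" by (rule degree_eq_zeroE)
    have "poly (poly_iterate (of_int_poly f :: rat poly) n) x \<in> {x, of_int c}" for n
      by (cases n) (auto simp: c of_int_hom.map_poly_pCons_hom)
    then have "{poly (poly_iterate (of_int_poly f :: rat poly) n) x |n. True} \<subseteq> {x, of_int c}" by blast
    then show False using np finite_subset unfolding preperiodic_def by blast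
  qed
  then have "degree (pderiv f) = Suc (2 * degree g)"
    unfolding f' using a by (subst degree_mult_eq) (auto simp: degree_power_eq)
  then have "degree f - 1 = Suc (2 * degree g)" by (simp add: degree_pderiv)
  then have "degree f = 2 * degree g + 2" by simp
  then show "even (degree f)" "degree f > 0" by simp_all
qed

lemma sint_poly_common_denom:
  assumes "sint_poly N H" "N > 0"
  obtains j H' where "of_int_poly H' = smult (of_nat N ^ j) H"
proof -
  have "\<exists>j. poly.coeff H i * of_nat N ^ j \<in> \<int>" for i using assms by (auto simp: sint_poly_def sint_def)
  then obtain j where j: "\<And>i. poly.coeff H i * of_nat N ^ j i \<in> \<int>" by metis
  define J where "J = Max (j ` {..degree H})"
  have "poly.coeff H i * of_nat N ^ J \<in> \<int>" for i
  proof (cases "i \<le> degree H")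
    case True
    then have "j i \<le> J" unfolding J_def by (intro Max_ge) auto
    then have "(of_nat N :: rat) ^ J = of_nat N ^ j i * of_nat N ^ (J - j i)" by (simp flip: power_add)
    then have eq: "poly.coeff H i * of_nat N ^ J = (poly.coeff H i * of_nat N ^ j i) * of_nat N ^ (J - j i)"
      by (simp add: mult.assoc)
    show ?thesis unfolding eq by (rule Ints_mult[OF j Ints_power[OF Ints_of_nat]])
  qed (simp add: coeff_eq_0)
  then have "\<exists>c. poly.coeff H i * of_nat N ^ J = of_int c" for i by (auto simp: Ints_def)
  then obtain c where c: "\<And>i. poly.coeff H i * of_nat N ^ J = of_int (c i)" by metis
  define H' where "H' = Poly (map c [0..<Suc (degree H)])"
  have "of_int_poly H' = smult (of_nat N ^ J) H"
  proof (rule poly_eqI)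
    fix n
    show "poly.coeff (of_int_poly H') n = poly.coeff (smult (of_nat N ^ J) H) n"
      by (cases "n < Suc (degree H)")
        (auto simp: H'_def coeff_map_poly coeff_Poly_eq nth_default_def coeff_eq_0 mult.commute[of "of_nat N ^ J"]
           simp del: upt_Suc simp flip: c)
  qed
  then show thesis by (rule that)
qed

lemma iterate_obstructionD:
  fixes f g :: "int poly"
  assumes "prime p" "p \<noteq> 2" "even (degree f)" "degree f > 0" "pderiv f = g ^ 2 * [:b, a:]"
    "\<not> int p dvd lead_coeff f" "\<not> int p dvd a"
    "dynamically_irreducible (residue_ring (int p)) (reduce_poly (int p) f)"
  shows "n \<ge> 2 \<Longrightarrow> \<not> [lead_coeff (poly_iterate f n) * hval (poly_iterate f n) (degree f ^ n) a b = t\<^sup>2] (mod int p)"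
    "k \<ge> 1 \<Longrightarrow> \<not> int p dvd s \<Longrightarrow> H\<^sup>2 \<noteq> smult s (f * poly_iterate f (Suc k))"
proof -
  have "p \<noteq> 2 \<and> even (degree f) \<and> degree f > 0 \<and> pderiv f = g ^ 2 * [:b, a:] \<and>
     \<not> int p dvd lead_coeff f \<and> \<not> int p dvd a \<and>
     dynamically_irreducible (residue_ring (int p)) (reduce_poly (int p) f)"
    using assms by (intro conjI)
  from iterate_obstruction_prime[OF assms(1), unfolded iterate_obstruction_def, THEN spec[of _ f],
      THEN spec[of _ g], THEN spec[of _ a], THEN spec[of _ b], THEN mp, OF this]
  show "n \<ge> 2 \<Longrightarrow> \<not> [lead_coeff (poly_iterate f n) * hval (poly_iterate f n) (degree f ^ n) a b = t\<^sup>2] (mod int p)"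
    "k \<ge> 1 \<Longrightarrow> \<not> int p dvd s \<Longrightarrow> H\<^sup>2 \<noteq> smult s (f * poly_iterate f (Suc k))"
    by iprover+
qed

text \<open>The rational identity is multiplied by a power of \<open>N\<close> until it holds over
  the integers. That factor is a unit modulo a prime \<open>p > N\<close>, so the single prime
  \<open>p\<close> rules the identity out.\<close>

lemma iterate_product_not_square:
  fixes f g :: "int poly"
  assumes f': "pderiv f = g ^ 2 * [:b, a:]" and d: "even (degree f)" "degree f > 0"
    and N: "N = nat \<bar>2 * a * lead_coeff f\<bar>" "N > 0"
    and p: "prime p" "p > N" "dynamically_irreducible (residue_ring (int p)) (reduce_poly (int p) f)"
    and k: "k \<ge> 1" and H: "sint_poly N H"
  shows "smult (lead_coeff (of_int_poly f) * lead_coeff (poly_iterate (of_int_poly f) (Suc k))) (H\<^sup>2) \<noteq>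
    (of_int_poly f :: rat poly) * poly_iterate (of_int_poly f) (Suc k)"
proof
  assume eq: "smult (lead_coeff (of_int_poly f) * lead_coeff (poly_iterate (of_int_poly f) (Suc k))) (H\<^sup>2) =
    (of_int_poly f :: rat poly) * poly_iterate (of_int_poly f) (Suc k)"
  define P where "P k = poly_iterate f k" for k
  obtain h where h: "degree f = 2 * h" using d(1) by auto
  define \<mu> where "\<mu> = lead_coeff f * lead_coeff (P k) ^ h"
  have "lead_coeff (P (Suc k)) = lead_coeff f * lead_coeff (P k) ^ degree f"
    unfolding P_def poly_iterate_Suc
    by (rule lead_coeff_comp) (use d in \<open>simp add: degree_poly_iterate\<close>)
  then have \<mu>: "\<mu>\<^sup>2 = lead_coeff f * lead_coeff (P (Suc k))"
    by (simp add: \<mu>_def h power_mult_distrib power2_eq_square mult_ac power_mult)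
  obtain j H' where H': "of_int_poly H' = smult (of_nat N ^ j) H"
    using sint_poly_common_denom[OF H N(2)] .
  have "(of_int_poly ((smult \<mu> H')\<^sup>2) :: rat poly) = smult (of_int (\<mu>\<^sup>2)) ((of_int_poly H')\<^sup>2)"
    by (simp add: of_int_poly_hom.hom_power of_int_hom.map_poly_hom_smult smult_power)
  also have "\<dots> = smult (of_nat N ^ (2 * j)) (smult (of_int (\<mu>\<^sup>2)) (H\<^sup>2))"
    by (simp add: H' smult_power mult.commute flip: power_mult)
  also have "smult (of_int (\<mu>\<^sup>2)) (H\<^sup>2) = (of_int_poly f :: rat poly) * of_int_poly (P (Suc k))"
    unfolding P_def of_int_poly_poly_iterate eq[symmetric]
    unfolding of_int_poly_poly_iterate[symmetric] using \<mu> by (simp add: P_def)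
  also have "smult (of_nat N ^ (2 * j)) ((of_int_poly f :: rat poly) * of_int_poly (P (Suc k))) =
      of_int_poly (smult (int N ^ (2 * j)) (f * P (Suc k)))"
    by (simp add: of_int_poly_hom.hom_mult of_int_hom.map_poly_hom_smult)
  finally have sq: "(smult \<mu> H')\<^sup>2 = smult (int N ^ (2 * j)) (f * P (Suc k))"
    by (simp only: of_int_poly_hom.eq_iff)
  have ndvd: "\<not> int p dvd x" if "x dvd int N" for x
  proof
    assume "int p dvd x"
    then have "int p dvd int N" using that by (rule dvd_trans)
    then have "p dvd N" by simp
    then show False using p(2) N(2) by (auto dest: dvd_imp_le)
  qed
  have Nj: "\<not> int p dvd int N ^ (2 * j)"
    using ndvd[of "int N"] p(1) prime_dvd_power[of "int p" "int N"] by auto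
  have iN: "int N = \<bar>2 * a * lead_coeff f\<bar>" using N by simp
  have n: "\<not> int p dvd lead_coeff f" "\<not> int p dvd a" "\<not> int p dvd 2"
    by (rule ndvd; simp add: iN)+
  then have "p \<noteq> 2" by auto
  from iterate_obstructionD(2)[OF p(1) this d f' n(1,2) p(3) k Nj] sq show False by (simp add: P_def)
qed

text \<open>The leading coefficient of the iterate is \<open>lead_coeff f\<close> up to a square, so
  the non-square given by the obstruction fixes the symbol independently of
  \<open>n\<close>.\<close>

lemma Legendre_orbit:
  fixes f g :: "int poly"
  assumes f': "pderiv f = g ^ 2 * [:b, a:]" and d: "even (degree f)" "degree f > 0"
    and p: "prime p" "p > 2" "dynamically_irreducible (residue_ring (int p)) (reduce_poly (int p) f)"
    and nd: "\<not> int p dvd a" "\<not> int p dvd lead_coeff f"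
    and n: "n \<ge> 2" and v: "\<not> int p dvd hval (poly_iterate f n) (degree f ^ n) a b"
  shows "Legendre (hval (poly_iterate f n) (degree f ^ n) a b) (int p) = - Legendre (lead_coeff f) (int p)"
proof -
  define v where "v = hval (poly_iterate f n) (degree f ^ n) a b"
  define c where "c = lead_coeff f"
  obtain k where k: "lead_coeff (poly_iterate f n) = c ^ k" "odd k"
    using lead_coeff_poly_iterate_dvd[of f n] d n by (auto simp: c_def)
  then obtain l where l: "k = Suc (2 * l)" by (auto elim: oddE)
  have "\<not> QuadRes (int p) (c * v)"
  proof
    assume "QuadRes (int p) (c * v)"
    then obtain y where "[y\<^sup>2 = c * v] (mod int p)" by (auto simp: QuadRes_def)
    then have "[(c ^ l)\<^sup>2 * (c * v) = (c ^ l)\<^sup>2 * y\<^sup>2] (mod int p)" by (rule cong_scalar_left[OF cong_sym])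
    moreover have "(c ^ l)\<^sup>2 * (c * v) = lead_coeff (poly_iterate f n) * v"
      by (simp add: k l mult_ac flip: power_mult)
    ultimately have "[lead_coeff (poly_iterate f n) * v = (c ^ l * y)\<^sup>2] (mod int p)"
      by (simp add: power_mult_distrib)
    moreover have "p \<noteq> 2" using p(2) by simp
    ultimately show False
      using iterate_obstructionD(1)[OF p(1) _ d f' nd(2,1) p(3) n] by (simp add: v_def)
  qed
  moreover have "\<not> int p dvd c * v" using v nd(2) p(1) by (simp add: v_def c_def prime_dvd_mult_iff)
  then have "\<not> [c * v = 0] (mod int p)" by (simp add: cong_0_iff)
  ultimately have "Legendre (c * v) (int p) = - 1" by (simp add: Legendre_def)
  then have "Legendre c (int p) * Legendre v (int p) = - 1" by (simp add: Legendre_mult[OF p(1,2)])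
  then show ?thesis
    using Legendre_values[of c "int p"] Legendre_values[of v "int p"] by (auto simp: v_def c_def)
qed

lemma hval_bound:
  fixes f :: "int poly"
  assumes a: "a \<noteq> 0" and d: "degree f > 0"
  shows "\<exists>A::nat. \<forall>n. real_of_int \<bar>hval (poly_iterate f n) (degree f ^ n) a b\<bar> \<le> 2 ^ (A * Suc (degree f) ^ n)"
proof -
  interpret abs_value "\<lambda>x. \<bar>real_of_rat x\<bar>" by (rule abs_value_abs)
  let ?v = "\<lambda>x. \<bar>real_of_rat x\<bar>"
  define fq where "fq = (of_int_poly f :: rat poly)"
  define x where "x = (- of_int b / of_int a :: rat)"
  define K where "K = max 1 (max (?v (1 / lead_coeff fq)) (pnorm ?v fq))"
  define M where "M = max 1 (?v x)"
  have K: "K \<ge> 1" "?v (1 / lead_coeff fq) \<le> K" "pnorm ?v fq \<le> K" by (auto simp: K_def)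
  have M: "M \<ge> 1" "?v x \<le> M" by (auto simp: M_def)
  have a1: "real_of_int \<bar>a\<bar> \<ge> 1" using a by simp
  have dq: "degree fq = degree f" by (simp add: fq_def)
  obtain A where A: "real_of_int \<bar>a\<bar> * (K * M) \<le> 2 ^ A"
    using real_arch_pow[of 2 "real_of_int \<bar>a\<bar> * (K * M)"] by (auto intro: less_imp_le)
  have "real_of_int \<bar>hval (poly_iterate f n) (degree f ^ n) a b\<bar> \<le> 2 ^ (A * Suc (degree f) ^ n)" for n
  proof -
    define s where "s = Suc (degree f) ^ n"
    define D where "D = degree f ^ n"
    have Ds: "D \<le> s" unfolding s_def D_def by (intro power_mono) auto
    have "(of_int (hval (poly_iterate f n) D a b) :: rat) = of_int a ^ D * poly (poly_iterate fq n) x"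
      unfolding fq_def x_def of_int_poly_poly_iterate[symmetric]
      by (rule of_int_hval) (use a in \<open>auto simp: degree_poly_iterate D_def\<close>)
    then have "?v (of_int (hval (poly_iterate f n) D a b)) = ?v (of_int a ^ D) * ?v (poly (poly_iterate fq n) x)"
      by (simp only: mult)
    also have "?v (poly (poly_iterate fq n) x) \<le> pnorm ?v (poly_iterate fq n) * M ^ D"
      by (rule poly_le_pnorm[OF M(2,1)]) (simp add: degree_poly_iterate dq D_def)
    also have "\<dots> \<le> K ^ s * M ^ D"
      using pnorm_poly_iterate(1)[of fq K n] K d dq M by (intro mult_right_mono) (auto simp: s_def)
    also have "K ^ s * M ^ D \<le> K ^ s * M ^ s"
      using K M Ds by (intro mult_left_mono power_increasing) auto
    finally have "real_of_int \<bar>hval (poly_iterate f n) D a b\<bar> \<le> real_of_int \<bar>a\<bar> ^ D * (K ^ s * M ^ s)"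
      by (simp add: of_rat_power power_abs mult_left_mono)
    also have "\<dots> \<le> real_of_int \<bar>a\<bar> ^ s * (K ^ s * M ^ s)"
      using a1 Ds K M by (intro mult_right_mono power_increasing) auto
    also have "\<dots> = (real_of_int \<bar>a\<bar> * (K * M)) ^ s" by (simp add: power_mult_distrib)
    also have "\<dots> \<le> (2 ^ A) ^ s" using A a1 K M by (intro power_mono) auto
    finally show ?thesis by (simp add: s_def D_def power_mult)
  qed
  then show ?thesis by blast
qed

text \<open>A single prime from \<open>ex\<close> makes all Runge curves non-degenerate and so
  bounds the square classes. In a window some type has at least \<open>L / 8\<close> indices, and
  \<open>R\<close> contains at most \<open>C\<close> pairs for each of them, so dividing by
  \<open>card J ^ 2\<close> saves a factor \<open>card J\<close> in the main term. The constant 16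
  is 8 for the types times 2 from the sieve.\<close>

lemma count_bound:
  fixes f g :: "int poly"
  assumes f': "pderiv f = g ^ 2 * [:b, a:]" and a: "a \<noteq> 0"
    and np: "\<not> preperiodic (of_int_poly f :: rat poly) (- of_int b / of_int a)"
    and ex: "\<exists>p. prime p \<and> p > nat \<bar>2 * a * lead_coeff f\<bar> \<and>
       dynamically_irreducible (residue_ring (int p)) (reduce_poly (int p) f)"
  obtains C A n0 :: nat where
    "\<And>M L z Q. n0 \<le> M \<Longrightarrow> C * Suc (degree f) ^ (2 * L + 2) < 2 ^ (M - n0) \<Longrightarrow> L \<ge> 1 \<Longrightarrow> z \<ge> 2 \<Longrightarrow>
       real z + 2 < Q \<Longrightarrow> 2 ^ (A * Suc (degree f) ^ (M + L)) < Q \<Longrightarrow>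
       real (dyn_irred_prime_count f Q) \<le>
         16 * real C * (Q + 2) / (real L * ln z) + 8 * real z ^ 6 / (ln z)\<^sup>2 * (2 ^ (A * Suc (degree f) ^ (M + L)))\<^sup>2"
proof -
  note d = degree_critical[OF f' a np]
  define d where "d = degree f"
  define c where "c = lead_coeff f"
  have c0: "c \<noteq> 0" using d(2) by (auto simp: c_def)
  define N where "N = nat \<bar>2 * a * c\<bar>"
  have N0: "N > 0" using a c0 by (simp add: N_def)
  have iN: "int N = \<bar>2 * a * c\<bar>" by (simp add: N_def)
  define fq where "fq = (of_int_poly f :: rat poly)"
  have dq: "degree fq = d" by (simp add: fq_def d_def)
  have lq: "lead_coeff fq = of_int c" by (simp add: fq_def c_def)
  define x0 where "x0 = (- of_int b / of_int a :: rat)"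
  define u where "u n = poly (poly_iterate fq n) x0" for n
  define v where "v n = hval (poly_iterate f n) (d ^ n) a b" for n
  have vu: "of_int (v n) = of_int a ^ (d ^ n) * u n" for n
    unfolding v_def u_def fq_def x0_def of_int_poly_poly_iterate[symmetric]
    by (rule of_int_hval) (use a in \<open>auto simp: degree_poly_iterate d_def\<close>)
  have u0: "u 0 = x0" by (simp add: u_def)
  have half: "sint N (1 / 2)" using sint_inverse_dvd[of 2 N] by (simp add: iN)
  have sa: "sint N (1 / of_int a)" using sint_inverse_dvd[of a N] a by (simp add: iN)
  have sc: "sint N (1 / lead_coeff fq)" unfolding lq using sint_inverse_dvd[of c N] c0 by (simp add: iN)
  have sx: "sint N (u 0)"
    using sint_mult[OF sint_of_int[of N "- b"] sa] by (simp add: u0 x0_def)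
  have inf: "infinite (range u)"
  proof -
    have "range u = {poly (poly_iterate fq n) x0 |n. True}" by (auto simp: u_def)
    then show ?thesis using np by (simp add: preperiodic_def fq_def x0_def)
  qed
  obtain p0 where p0: "prime p0" "p0 > N" "dynamically_irreducible (residue_ring (int p0)) (reduce_poly (int p0) f)"
    using ex by (auto simp: N_def c_def)
  have nonsq: "smult (lead_coeff fq * lead_coeff (poly_iterate fq (Suc k))) (H\<^sup>2) \<noteq> fq * poly_iterate fq (Suc k)"
    if "k \<ge> 1" "sint_poly N H" for k H
    unfolding fq_def
    by (rule iterate_product_not_square[OF f' d _ N0 p0 that]) (simp add: N_def c_def)
  have dq': "even (degree fq)" "degree fq > 0" using d by (simp_all add: dq d_def)
  have uu: "u n = poly (poly_iterate fq n) (u 0)" for n by (simp add: u_def)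
  have "\<exists>C n0. (\<forall>n\<ge>n0. u n \<noteq> 0) \<and>
    (\<forall>M L J. n0 \<le> M \<longrightarrow> C * Suc d ^ (2 * L + 2) < 2 ^ (M - n0) \<longrightarrow> J \<subseteq> {M<..M + L} \<longrightarrow>
      (\<forall>i\<in>J. \<forall>j\<in>J. \<exists>y. u i * u j = y\<^sup>2) \<longrightarrow> card J \<le> C)"
  proof (rule square_class_card[where f = fq and u = u, OF N0 half dq'
        sint_poly_of_int_poly[of N f, folded fq_def] sc uu sx inf])
    fix k :: nat and H assume "1 \<le> k" "sint_poly N H"
    then show "smult (lead_coeff fq * lead_coeff (poly_iterate fq (Suc k))) (H\<^sup>2) \<noteq> fq * poly_iterate fq (Suc k)"
      by (rule nonsq)
  next
    fix C n0
    assume 1: "\<And>n. n \<ge> n0 \<Longrightarrow> u n \<noteq> 0"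
      and 2: "\<And>M L J. n0 \<le> M \<Longrightarrow> C * Suc (degree fq) ^ (2 * L + 2) < 2 ^ (M - n0) \<Longrightarrow> J \<subseteq> {M<..M + L} \<Longrightarrow>
      (\<And>i j. i \<in> J \<Longrightarrow> j \<in> J \<Longrightarrow> \<exists>y. u i * u j = y\<^sup>2) \<Longrightarrow> card J \<le> C"
    show ?thesis
      by (intro exI[of _ C] exI[of _ n0] conjI allI impI) (rule 1, assumption, rule 2, auto simp: dq)
  qed
  then obtain C n0 where un0: "\<And>n. n \<ge> n0 \<Longrightarrow> u n \<noteq> 0" and
    card: "\<And>M L J. n0 \<le> M \<Longrightarrow> C * Suc d ^ (2 * L + 2) < 2 ^ (M - n0) \<Longrightarrow> J \<subseteq> {M<..M + L} \<Longrightarrow>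
      \<forall>i\<in>J. \<forall>j\<in>J. \<exists>y. u i * u j = y\<^sup>2 \<Longrightarrow> card J \<le> C"
    by blast
  obtain A0 where A0: "\<And>n. real_of_int \<bar>v n\<bar> \<le> 2 ^ (A0 * Suc d ^ n)"
    using hval_bound[OF a d(2)] by (auto simp: v_def d_def)
  \<comment> \<open>Adding \<open>N\<close> lets the same power of 2 dominate \<open>a\<close> and
    \<open>c\<close>, so that a prime at least \<open>Q\<close> divides neither of them.\<close>
  define A where "A = A0 + N"
  have A: "real_of_int \<bar>v n\<bar> \<le> 2 ^ (A * Suc d ^ m)" if "n \<le> m" for n m
  proof -
    have "A0 * Suc d ^ n \<le> A * Suc d ^ m"
      using that by (intro mult_le_mono power_increasing) (auto simp: A_def)
    then have "(2::real) ^ (A0 * Suc d ^ n) \<le> 2 ^ (A * Suc d ^ m)" by (intro power_increasing) auto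
    then show ?thesis using A0[of n] by linarith
  qed
  have AN: "real N \<le> 2 ^ (A * Suc d ^ m)" for m
  proof -
    have "real N \<le> 2 ^ N" using less_exp[of N] by (metis less_imp_le of_nat_le_iff of_nat_numeral of_nat_power)
    also have "N * 1 \<le> A * Suc d ^ m" by (intro mult_le_mono) (auto simp: A_def)
    then have "(2::real) ^ N \<le> 2 ^ (A * Suc d ^ m)" by (intro power_increasing) auto
    finally show ?thesis .
  qed
  \<comment> \<open>The start \<open>n0 + 2\<close> keeps the window away from the indices 0 and 1,
    for which the obstruction says nothing.\<close>
  have main: "real (dyn_irred_prime_count f Q) \<le>
         16 * real C * (Q + 2) / (real L * ln z) + 8 * real z ^ 6 / (ln z)\<^sup>2 * (2 ^ (A * Suc d ^ (M + L)))\<^sup>2"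
    if M: "n0 + 2 \<le> M" and CL: "C * Suc d ^ (2 * L + 2) < 2 ^ (M - (n0 + 2))" and L: "L \<ge> 1" and z: "z \<ge> 2"
      and zQ: "real z + 2 < Q" and AQ: "2 ^ (A * Suc d ^ (M + L)) < Q" for M L z Q
  proof -
    have CL': "C * Suc d ^ (2 * L + 2) < 2 ^ (M - n0)"
    proof -
      have "(2::nat) ^ (M - (n0 + 2)) \<le> 2 ^ (M - n0)" by (intro power_increasing) auto
      then show ?thesis using CL by linarith
    qed
    define W where "W = {M<..M + L}"
    have v0: "v j \<noteq> 0" if "j \<in> W" for j
      using un0[of j] that M a vu[of j] by (auto simp: W_def)
    have vQ: "real_of_int \<bar>v j\<bar> \<le> 2 ^ (A * Suc d ^ (M + L))" if "j \<in> W" for j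
      using A[of j "M + L"] that by (simp add: W_def)
    \<comment> \<open>\<open>d ^ n\<close> is even for \<open>n \<ge> 1\<close>, so clearing
      denominators changes \<open>u n\<close> only by a square.\<close>
    have sq_transfer: "\<exists>y. u i * u j = y\<^sup>2" if ij: "i \<in> W" "j \<in> W" "v i * v j = y\<^sup>2" for i j y
    proof -
      have "even (d ^ n)" if "n \<in> W" for n using d(1) that by (auto simp: W_def d_def)
      then obtain e e' where e: "d ^ i = 2 * e" "d ^ j = 2 * e'" using ij by blast
      have "(of_int (v i * v j) :: rat) = of_int (y\<^sup>2)" using ij(3) by simp
      then have "(of_int a ^ (e + e'))\<^sup>2 * (u i * u j) = (of_int y :: rat)\<^sup>2"
        unfolding of_int_mult vu e by (simp add: power_add power_mult power_mult_distrib power2_eq_square mult_ac)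
      moreover have "(of_int a ^ (e + e') :: rat) \<noteq> 0" using a by simp
      ultimately have "u i * u j = (of_int y / of_int a ^ (e + e'))\<^sup>2"
        by (simp add: power_divide eq_divide_eq mult.commute)
      then show ?thesis by blast
    qed
    \<comment> \<open>There are 8 types, so one of them takes at least an eighth of the
      window.\<close>
    obtain T where T: "L \<le> 8 * card {j \<in> W. square_class_type (v j) = T}"
    proof -
      have "L = card W" by (simp add: W_def)
      also have "W = (\<Union>T\<in>UNIV. {j \<in> W. square_class_type (v j) = T})" by auto
      also have "card \<dots> \<le> (\<Sum>T\<in>UNIV. card {j \<in> W. square_class_type (v j) = T})"
        by (rule card_UN_le) simp
      finally have le: "L \<le> (\<Sum>T\<in>UNIV. card {j \<in> W. square_class_type (v j) = T})" .
      show thesis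
      proof (rule ccontr)
        assume "\<not> thesis"
        then have "8 * card {j \<in> W. square_class_type (v j) = T} < L" for T using that by (meson not_le)
        then have "(\<Sum>T\<in>UNIV. 8 * card {j \<in> W. square_class_type (v j) = T}) < (\<Sum>T\<in>(UNIV::(bool \<times> bool \<times> bool) set). L)"
          by (intro sum_strict_mono) auto
        also have "\<dots> = 8 * L" by (simp add: card_prod)
        finally show False using le by (simp flip: sum_distrib_left)
      qed
    qed
    define J where "J = {j \<in> W. square_class_type (v j) = T}"
    have JW: "J \<subseteq> W" by (auto simp: J_def)
    have finJ: "finite J" by (simp add: J_def W_def)
    have cJ: "L \<le> 8 * card J" using T by (simp add: J_def)
    then have cJ0: "card J > 0" using L by linarith
    define m where "m j = odd_part (v j)" for j
    have modd: "odd (m j)" and mle: "real (m j) \<le> 2 ^ (A * Suc d ^ (M + L))" if "j \<in> W" for j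
    proof -
      show "odd (m j)" using odd_part_decompose(2)[OF v0[OF that]] by (simp add: m_def)
      have "m j \<le> nat \<bar>v j\<bar>" using odd_part_decompose(3)[OF v0[OF that]] by (simp add: m_def)
      then have "real (m j) \<le> real_of_int \<bar>v j\<bar>" by linarith
      then show "real (m j) \<le> 2 ^ (A * Suc d ^ (M + L))" using vQ[OF that] by linarith
    qed
    define R where "R = {(i, j). i \<in> J \<and> j \<in> J \<and> (\<exists>y. m i * m j = y ^ 2)}"
    have R_sub: "R \<subseteq> J \<times> J" by (auto simp: R_def)
    have RC: "card R \<le> C * card J"
    proof -
      \<comment> \<open>Squareness passes through \<open>i\<close>, so the indices related to
        \<open>i\<close> are pairwise related and lie in one square class.\<close>
      have le: "card {j. (i, j) \<in> R} \<le> C" if i: "i \<in> J" for i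
      proof (rule card[OF _ CL'])
        show "n0 \<le> M" using M by simp
        show "{j. (i, j) \<in> R} \<subseteq> {M<..M + L}" using JW by (auto simp: R_def W_def)
        show "\<forall>j\<in>{j. (i, j) \<in> R}. \<forall>j'\<in>{j. (i, j) \<in> R}. \<exists>y. u j * u j' = y\<^sup>2"
        proof (intro ballI)
          fix j j' assume jj: "j \<in> {j. (i, j) \<in> R}" "j' \<in> {j. (i, j) \<in> R}"
          have "\<exists>y::int. v i * v k = y\<^sup>2" if "(i, k) \<in> R" for k
          proof -
            obtain y where y: "odd_part (v i) * odd_part (v k) = y ^ 2" "k \<in> J" using \<open>(i, k) \<in> R\<close> by (auto simp: R_def m_def)
            then show ?thesis using mult_square_of_odd_part[OF v0 v0 _ y(1)] i JW by (auto simp: J_def)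
          qed
          then obtain y y' where y: "v i * v j = y\<^sup>2" "v i * v j' = y'\<^sup>2" using jj by blast
          have W: "i \<in> W" "j \<in> W" "j' \<in> W" using i jj JW by (auto simp: R_def)
          obtain w w' where w: "u i * u j = w\<^sup>2" "u i * u j' = w'\<^sup>2"
            using sq_transfer[OF W(1,2) y(1)] sq_transfer[OF W(1,3) y(2)] by blast
          have ui: "u i \<noteq> 0" using un0[of i] W M by (simp add: W_def)
          have "(u i)\<^sup>2 * (u j * u j') = (w * w')\<^sup>2" using w by (simp add: power2_eq_square mult_ac)
          then have "u j * u j' = (w * w' / u i)\<^sup>2" using ui by (simp add: power_divide eq_divide_eq mult.commute)
          then show "\<exists>y. u j * u j' = y\<^sup>2" by blast
        qed
      qed
      have "R = (SIGMA i:J. {j. (i, j) \<in> R})" by (auto simp: R_def)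
      then have "card R = (\<Sum>i\<in>J. card {j. (i, j) \<in> R})"
        using card_SigmaI[of J "\<lambda>i. {j. (i, j) \<in> R}"] finJ finite_subset[OF _ finJ]
        by (metis (no_types, lifting) R_sub SigmaD2 mem_Collect_eq subsetD subsetI)
      also have "\<dots> \<le> (\<Sum>i\<in>J. C)" using le by (rule sum_mono)
      finally show ?thesis by (simp add: mult.commute)
    qed
    define \<psi> where "\<psi> j n = real_of_int (jacobi (m j) n)" for j n
    define BP where "BP = {p::nat. prime p \<and> real p \<in> {Q..2 * Q} \<and>
       dynamically_irreducible (residue_ring (int p)) (reduce_poly (int p) f)}"
    \<comment> \<open>The sieve interval \<open>{lo<..hi}\<close> is open on the left, hence the
      step of one below the ceiling of \<open>Q\<close>.\<close>
    define lo where "lo = nat \<lceil>Q\<rceil> - 1"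
    define hi where "hi = nat \<lfloor>2 * Q\<rfloor>"
    have Q4: "Q > 4" using zQ z by simp
    have XY: "lo \<le> hi" "real hi - real lo \<le> Q + 2"
      unfolding lo_def hi_def using Q4 by linarith+
    have "real (card BP) * real (card J) ^ 2 \<le>
      real (card R) * ((real hi - real lo) * 2 / ln z) +
      real (card J) ^ 2 * (8 * real z ^ 6 / (ln z)\<^sup>2 * (2 ^ (A * Suc d ^ (M + L)))\<^sup>2)"
    proof (rule prime_large_values_bound[OF z XY(1) _ finJ R_sub, of _ \<psi>])
      show "1 \<le> ((2::real) ^ (A * Suc d ^ (M + L)))\<^sup>2" by (simp add: one_le_power)
      show "\<bar>\<psi> j n\<bar> \<le> 1" for j n using abs_jacobi_le[of "m j" n] by (simp add: \<psi>_def flip: of_int_abs)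
      show "\<psi> j (n * n') = \<psi> j n * \<psi> j n'" if "j \<in> J" for j n n'
        using jacobi_mult_right[OF modd[of j]] that JW by (auto simp: \<psi>_def)
      show "\<exists>k>0. real k \<le> (2 ^ (A * Suc d ^ (M + L)))\<^sup>2 \<and>
        (\<forall>n. \<psi> i (n + k) * \<psi> j (n + k) = \<psi> i n * \<psi> j n) \<and> (\<Sum>n<k. \<psi> i n * \<psi> j n) = 0"
        if ij: "(i, j) \<in> J \<times> J - R" for i j
      \<comment> \<open>Outside \<open>R\<close> the product of the two characters is the Jacobi
        symbol of the non-square modulus \<open>m i * m j\<close>, which sums to 0 over a
        period.\<close>
      proof (intro exI[of _ "m i * m j"] conjI allI)
        have W: "i \<in> W" "j \<in> W" using ij JW by auto
        have pos: "m i > 0" "m j > 0" using modd[OF W(1)] modd[OF W(2)] by (auto intro: Nat.gr0I)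
        then show "m i * m j > 0" by simp
        show "real (m i * m j) \<le> (2 ^ (A * Suc d ^ (M + L)))\<^sup>2"
          unfolding of_nat_mult power2_eq_square using mle[OF W(1)] mle[OF W(2)] by (intro mult_mono) auto
        have prod: "\<psi> i n * \<psi> j n = real_of_int (jacobi (m i * m j) n)" for n
          by (simp add: \<psi>_def jacobi_mult_left[OF pos])
        show "\<psi> i (n + m i * m j) * \<psi> j (n + m i * m j) = \<psi> i n * \<psi> j n" for n
          unfolding prod by (intro arg_cong[of _ _ real_of_int] jacobi_cong) (simp add: unique_euclidean_semiring_class.cong_def)
        have "odd (m i * m j)" using modd[OF W(1)] modd[OF W(2)] by simp
        moreover have "\<not> (\<exists>x. m i * m j = x ^ 2)" using ij by (auto simp: R_def)
        ultimately show "(\<Sum>n<m i * m j. \<psi> i n * \<psi> j n) = 0"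
          unfolding prod of_int_sum[symmetric] by (simp add: sum_jacobi_eq_0)
      qed
      show "prime p \<and> p \<in> {lo<..hi} \<and> p > z \<and> (\<Sum>j\<in>J. \<psi> j p)\<^sup>2 = real (card J) ^ 2" if p: "p \<in> BP" for p
      proof (intro conjI)
        have pp: "prime p" "real p \<ge> Q" "real p \<le> 2 * Q"
          "dynamically_irreducible (residue_ring (int p)) (reduce_poly (int p) f)"
          using p by (auto simp: BP_def)
        show "prime p" by (rule pp)
        show "p > z" using pp(2) zQ by linarith
        have "lo < p" unfolding lo_def using pp(2) Q4 by linarith
        moreover have "p \<le> hi" unfolding hi_def using pp(3) by linarith
        ultimately show "p \<in> {lo<..hi}" by simp
        have p2: "p > 2" using pp(2) Q4 by linarith
        have small: "\<not> int p dvd y" if "y \<noteq> 0" "real_of_int \<bar>y\<bar> \<le> 2 ^ (A * Suc d ^ (M + L))" for y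
        proof
          assume "int p dvd y"
          then have "int p \<le> \<bar>y\<bar>" using that(1) zdvd_imp_le[of "int p" "\<bar>y\<bar>"] by simp
          then have "real p \<le> real_of_int \<bar>y\<bar>" by linarith
          then show False using that(2) AQ pp(2) by linarith
        qed
        have ac: "\<not> int p dvd a" "\<not> int p dvd c"
        proof -
          have "\<bar>a\<bar> \<le> int N" "\<bar>c\<bar> \<le> int N"
            using a c0 dvd_imp_le_int[of "int N" a] dvd_imp_le_int[of "int N" c] N0 by (auto simp: iN)
          then have "real_of_int \<bar>a\<bar> \<le> real N" "real_of_int \<bar>c\<bar> \<le> real N" by linarith+
          then show "\<not> int p dvd a" "\<not> int p dvd c"
            using small[of a] small[of c] a c0 AN[of "M + L"] by linarith+
        qed
        obtain B where B: "\<And>w. w \<noteq> 0 \<Longrightarrow> \<not> int p dvd w \<Longrightarrow> square_class_type w = T \<Longrightarrow>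
          jacobi (odd_part w) p = B * Legendre w (int p) \<and> jacobi (odd_part w) p \<noteq> 0"
          using Legendre_eq_jacobi_odd_part[OF pp(1) p2, of T] by blast
        \<comment> \<open>This is the common value at \<open>p\<close> of all characters indexed by
          \<open>J\<close>; it will turn out to be 1 or -1, so their sum attains the maximal modulus
          \<open>card J\<close>.\<close>
        define \<kappa> where "\<kappa> = B * - Legendre c (int p)"
        have jac: "jacobi (m j) p = \<kappa> \<and> \<kappa> \<noteq> 0" if j: "j \<in> J" for j
        proof -
          have W: "j \<in> W" using j JW by auto
          have nd: "\<not> int p dvd v j" by (rule small[OF v0[OF W] vQ[OF W]])
          have "j \<ge> 2" using W M by (simp add: W_def)
          then have "Legendre (v j) (int p) = - Legendre c (int p)"
            using Legendre_orbit[OF f' d pp(1) p2 pp(4) ac(1) ac(2)[unfolded c_def], of j] nd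
            by (simp add: v_def d_def c_def)
          moreover have "square_class_type (v j) = T" using j by (simp add: J_def)
          ultimately have "jacobi (m j) p = \<kappa>" "jacobi (m j) p \<noteq> 0"
            using B[OF v0[OF W] nd] unfolding m_def \<kappa>_def by metis+
          then show ?thesis by metis
        qed
        obtain j where "j \<in> J" using cJ0 by fastforce
        then have "\<bar>\<kappa>\<bar> \<le> 1" "\<kappa> \<noteq> 0" using jac abs_jacobi_le[of "m j" p] by auto
        then have "\<kappa> = 1 \<or> \<kappa> = - 1" by linarith
        then have "\<kappa> * \<kappa> = 1" by auto
        then have k2: "(real_of_int \<kappa>)\<^sup>2 = 1" by (simp add: power2_eq_square flip: of_int_mult)
        have "(\<Sum>j\<in>J. \<psi> j p) = (\<Sum>j\<in>J. real_of_int \<kappa>)" using jac by (intro sum.cong) (auto simp: \<psi>_def)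
        then show "(\<Sum>j\<in>J. \<psi> j p)\<^sup>2 = real (card J) ^ 2" using k2 by (simp add: power_mult_distrib)
      qed
    qed
    also have "\<dots> \<le> real (card J) ^ 2 * (16 * real C * (Q + 2) / (real L * ln z)) +
      real (card J) ^ 2 * (8 * real z ^ 6 / (ln z)\<^sup>2 * (2 ^ (A * Suc d ^ (M + L)))\<^sup>2)"
    proof (rule add_right_mono)
      have lz: "ln (real z) > 0" using z by simp
      have "real (card R) * ((real hi - real lo) * 2 / ln z) \<le> (real C * real (card J)) * ((Q + 2) * 2 / ln z)"
      proof (rule mult_mono)
        show "real (card R) \<le> real C * real (card J)" using RC by (metis of_nat_le_iff of_nat_mult)
        show "(real hi - real lo) * 2 / ln z \<le> (Q + 2) * 2 / ln z"
          using XY lz by (intro divide_right_mono) auto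
        show "0 \<le> (real hi - real lo) * 2 / ln z" using XY lz by simp
      qed simp
      also have "\<dots> = (real (card J) * real C * ((Q + 2) * 2 / ln z)) * 1" by simp
      also have "\<dots> \<le> (real (card J) * real C * ((Q + 2) * 2 / ln z)) * (8 * real (card J) / real L)"
      proof (rule mult_left_mono)
        have "real L \<le> 8 * real (card J)" using cJ by linarith
        then show "1 \<le> 8 * real (card J) / real L" using L by simp
        show "0 \<le> real (card J) * real C * ((Q + 2) * 2 / ln z)" using lz Q4 by simp
      qed
      also have "\<dots> = real (card J) ^ 2 * (16 * real C * (Q + 2) / (real L * ln z))"
      proof -
        have "(c * C' * ((q + 2) * 2 / y)) * (8 * c / x) = c ^ 2 * (16 * C' * (q + 2) / (x * y))"
          for c C' q x y :: real
          by (cases "x = 0"; cases "y = 0") (simp_all add: power2_eq_square field_simps)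
        then show ?thesis .
      qed
      finally show "real (card R) * ((real hi - real lo) * 2 / ln z) \<le>
        real (card J) ^ 2 * (16 * real C * (Q + 2) / (real L * ln z))" .
    qed
    finally have "real (card BP) * real (card J) ^ 2 \<le> (16 * real C * (Q + 2) / (real L * ln z) +
      8 * real z ^ 6 / (ln z)\<^sup>2 * (2 ^ (A * Suc d ^ (M + L)))\<^sup>2) * real (card J) ^ 2"
      by (simp add: algebra_simps)
    then have "real (card BP) \<le> 16 * real C * (Q + 2) / (real L * ln z) +
      8 * real z ^ 6 / (ln z)\<^sup>2 * (2 ^ (A * Suc d ^ (M + L)))\<^sup>2"
      by (rule mult_right_le_imp_le) (use cJ0 in simp)
    then show ?thesis by (simp add: dyn_irred_prime_count_def BP_def)
  qed
  show thesis by (rule that[of "n0 + 2" C A]) (use main in \<open>simp_all add: d_def\<close>)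
qed

section \<open>Choice of parameters\<close>

text \<open>The length \<open>L = M div (8 * q)\<close> gives \<open>2 * q * L \<le> M / 4\<close>.
  The left-hand side is then below 2 to the power \<open>C + 2 * q + M / 4\<close>, and half of
  \<open>M\<close> already covers the constants.\<close>

lemma pow_orbit_condition:
  fixes C q n0 M D :: nat
  assumes q: "q > 0" "D \<le> 2 ^ q" and M: "M \<ge> 2 * (C + 2 * q + n0)"
  shows "C * D ^ (2 * (M div (8 * q)) + 2) < 2 ^ (M - n0)"
proof -
  define L where "L = M div (8 * q)"
  have L: "8 * (q * L) \<le> M" unfolding L_def by (metis mult.assoc mult.commute times_div_less_eq_dividend)
  have "C < 2 ^ C" by (rule less_exp)
  then have C: "C * (2 ^ q) ^ (2 * L + 2) < 2 ^ C * (2 ^ q) ^ (2 * L + 2)" by (rule mult_less_mono1) simp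
  have "D ^ (2 * L + 2) \<le> (2 ^ q) ^ (2 * L + 2)" using q(2) by (rule power_mono) simp
  then have "C * D ^ (2 * L + 2) \<le> C * (2 ^ q) ^ (2 * L + 2)" by (rule mult_le_mono2)
  also have "\<dots> < 2 ^ C * (2 ^ q) ^ (2 * L + 2)" by (rule C)
  also have "\<dots> = 2 ^ (C + q * (2 * L + 2))" by (simp only: power_add power_mult)
  also have "\<dots> \<le> 2 ^ (M - n0)"
  proof (rule power_increasing)
    have "C + (2 * k + 2 * q) + n0 \<le> M" if "8 * k \<le> M" for k :: nat using M that by presburger
    from this[OF L] have "C + (2 * (q * L) + 2 * q) \<le> M - n0" by simp
    then show "C + q * (2 * L + 2) \<le> M - n0" by (simp add: algebra_simps)
  qed simp
  finally show ?thesis by (simp add: L_def)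
qed

text \<open>Applied with \<open>x = ln (ln Q)\<close>, \<open>l = ln x\<close> and
  \<open>y = ln Q / 8\<close>: indices of order \<open>l\<close> keep \<open>D ^ (M + L)\<close>
  below a power of \<open>x\<close>, and hence the integers of the window below Q^(1/8).\<close>

lemma modulus_bound:
  fixes A D q M L :: nat
  assumes q: "D \<le> 2 ^ q" and D: "D \<ge> 1" and L: "L \<le> M" and M: "real M \<le> l" and l: "exp l = x"
    and Ax: "real A * x ^ (2 * q) \<le> y"
  shows "2 ^ (A * D ^ (M + L)) \<le> exp y"
proof -
  have "real (D ^ (M + L)) \<le> real (D ^ (2 * M))"
    using D L by (intro of_nat_mono power_increasing) auto
  also have "\<dots> \<le> real ((2 ^ q) ^ (2 * M))" using q by (intro of_nat_mono power_mono) auto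
  also have "\<dots> = 2 ^ (q * (2 * M))" by (simp flip: power_mult)
  also have "\<dots> \<le> exp 1 ^ (q * (2 * M))"
    using exp_ge_add_one_self[of 1] by (intro power_mono) auto
  also have "\<dots> = exp (real (q * (2 * M)))" by (simp flip: exp_of_nat_mult)
  also have "\<dots> \<le> exp (real (2 * q) * l)"
    using M mult_left_mono[of "real M" l "real (2 * q)"] by (simp add: mult_ac)
  also have "\<dots> = x ^ (2 * q)" by (simp only: exp_of_nat_mult l)
  finally have *: "real (D ^ (M + L)) \<le> x ^ (2 * q)" .
  have "(2::real) ^ (A * D ^ (M + L)) \<le> exp 1 ^ (A * D ^ (M + L))"
    using exp_ge_add_one_self[of 1] by (intro power_mono) auto
  also have "\<dots> = exp (real A * real (D ^ (M + L)))" by (simp flip: exp_of_nat_mult)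
  also have "\<dots> \<le> exp (real A * x ^ (2 * q))" using * by (simp add: mult_left_mono del: of_nat_power)
  also have "\<dots> \<le> exp y" using Ax by simp
  finally show ?thesis .
qed

text \<open>\<open>M\<close> is about \<open>ln (ln (ln Q))\<close>, \<open>L\<close> a fixed
  fraction of it, and \<open>z\<close> about Q^(1/16). The error term is then of order Q^(6/16 +
  1/4) = Q^(5/8) up to logarithms, while the main term is of order
  \<open>Q / (L * ln Q)\<close>.\<close>

lemma eventually_count_bound:
  fixes P :: "real \<Rightarrow> real" and C A n0 D :: nat
  assumes D: "D \<ge> 1"
    and P: "\<And>M L z Q. n0 \<le> M \<Longrightarrow> C * D ^ (2 * L + 2) < 2 ^ (M - n0) \<Longrightarrow> L \<ge> 1 \<Longrightarrow> z \<ge> 2 \<Longrightarrow>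
       real z + 2 < Q \<Longrightarrow> 2 ^ (A * D ^ (M + L)) < Q \<Longrightarrow>
       P Q \<le> 16 * real C * (Q + 2) / (real L * ln z) + 8 * real z ^ 6 / (ln z)\<^sup>2 * (2 ^ (A * D ^ (M + L)))\<^sup>2"
  shows "\<forall>\<^sub>F Q in at_top. P Q \<le> ln (ln (ln (ln Q))) powr 2 / ln (ln (ln Q)) * (Q / ln Q)"
proof -
  define q where "q = D"
  have q: "q > 0" "D \<le> 2 ^ q" using D less_exp[of D] by (auto simp: q_def)
  \<comment> \<open>16384 = 16 * 2 * 16 * 32: the constant of the count,
    \<open>Q + 2 \<le> 2 * Q\<close>, \<open>L \<ge> l / (16 * q)\<close> and
    \<open>ln z \<ge> ln Q / 32\<close>.\<close>
  define K where "K = 16384 * real C * real q"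
  have e1: "\<forall>\<^sub>F Q::real in at_top. ln (ln (ln Q)) \<ge> real (2 * (C + 2 * q + n0)) + 16 * real q + 2"
  proof -
    have "filterlim (\<lambda>Q::real. ln (ln (ln Q))) at_top at_top" by real_asymp
    then show ?thesis unfolding filterlim_at_top by blast
  qed
  \<comment> \<open>The square of the fourfold logarithm serves to absorb the constant
    \<open>K + 1\<close>.\<close>
  have e2: "\<forall>\<^sub>F Q::real in at_top. (ln (ln (ln (ln Q))))\<^sup>2 \<ge> K + 1"
  proof -
    have "filterlim (\<lambda>Q::real. (ln (ln (ln (ln Q))))\<^sup>2) at_top at_top" by real_asymp
    then show ?thesis unfolding filterlim_at_top by blast
  qed
  \<comment> \<open>8192 is 8 times the square of 32, the latter from
    \<open>ln z \<ge> ln Q / 32\<close>.\<close>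
  have e3: "\<forall>\<^sub>F Q::real in at_top. 8192 * Q powr (5/8) / (ln Q)\<^sup>2 \<le> Q / (ln (ln (ln Q)) * ln Q)" by real_asymp
  \<comment> \<open>Rounding \<open>z\<close> down costs at most 1, which the passage from the
    exponent 1/16 to 1/32 absorbs.\<close>
  have e4: "\<forall>\<^sub>F Q::real in at_top. Q powr (1/32) \<le> Q powr (1/16) - 1" by real_asymp
  have e5: "\<forall>\<^sub>F Q::real in at_top. Q powr (1/16) + 2 < Q" by real_asymp
  have e6: "\<forall>\<^sub>F Q::real in at_top. Q powr (1/8) < Q" by real_asymp
  have e7: "\<forall>\<^sub>F Q::real in at_top. Q powr (1/32) \<ge> 2" by real_asymp
  have e8: "\<forall>\<^sub>F Q::real in at_top. ln (ln Q) > 0" by real_asymp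
  have e9: "\<forall>\<^sub>F Q::real in at_top. ln (ln (ln (ln Q))) > 0" by real_asymp
  have e10: "\<forall>\<^sub>F Q::real in at_top. real A * ln (ln Q) ^ (2 * q) \<le> ln Q / 8"
  proof -
    have "((\<lambda>x::real. real A * (x ^ (2 * q) / exp x)) \<longlongrightarrow> real A * 0) at_top"
      by (intro tendsto_intros tendsto_power_div_exp_0)
    then have "\<forall>\<^sub>F x::real in at_top. real A * (x ^ (2 * q) / exp x) < 1 / 8"
      by (rule order_tendstoD) simp
    moreover have "filterlim (\<lambda>Q::real. ln (ln Q)) at_top at_top" by real_asymp
    ultimately have "\<forall>\<^sub>F Q::real in at_top. real A * (ln (ln Q) ^ (2 * q) / exp (ln (ln Q))) < 1 / 8"
      by (rule eventually_compose_filterlim)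
    moreover have "\<forall>\<^sub>F Q::real in at_top. ln Q > 0" by real_asymp
    ultimately show ?thesis by eventually_elim (simp add: field_simps)
  qed
  have e11: "\<forall>\<^sub>F Q::real in at_top. Q \<ge> 2" by real_asymp
  show ?thesis
    using e1 e2 e3 e4 e5 e6 e7 e8 e9 e10 e11
  proof eventually_elim
    case (elim Q)
    define l where "l = ln (ln (ln Q))"
    define M where "M = nat \<lfloor>l\<rfloor>"
    define L where "L = M div (8 * q)"
    define z where "z = nat \<lfloor>Q powr (1/16)\<rfloor>"
    have Q2: "Q \<ge> 2" using elim by simp
    have lQ: "ln Q > 0" using Q2 by simp
    have l: "l \<ge> real (2 * (C + 2 * q + n0)) + 16 * real q + 2" using elim(1) by (simp add: l_def)
    have l0: "l > 0" using l by (rule less_le_trans[rotated]) (simp add: add_nonneg_pos)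
    have Ml: "real M \<le> l" "l - 1 \<le> real M" unfolding M_def using l0 by linarith+
    have M: "M \<ge> 2 * (C + 2 * q + n0)" "M \<ge> 8 * q"
    proof -
      have "real (2 * (C + 2 * q + n0)) + 16 * real q + 1 \<le> real M" using l Ml by linarith
      then show "M \<ge> 2 * (C + 2 * q + n0)" "M \<ge> 8 * q" by linarith+
    qed
    have LM: "L \<le> M" by (simp add: L_def)
    have L1: "L \<ge> 1" unfolding L_def using M(2) q(1) by (simp add: Suc_le_eq div_greater_zero_iff)
    have Lq: "l / (16 * real q) \<le> real L"
    proof -
      have "M < 8 * q + 8 * q * (M div (8 * q))" using q(1) by (intro dividend_less_times_div) simp
      then have "M < 8 * q * Suc L" by (simp add: L_def)
      then have "real M < real (8 * q * Suc L)" by (simp only: of_nat_less_iff)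
      then have "real M < 8 * (real q * real L) + 8 * real q" by (simp add: algebra_simps)
      then have "l \<le> 16 * (real q * real L)" using Ml l by linarith
      then show ?thesis using q(1) by (simp add: field_simps)
    qed
    have z: "real z \<le> Q powr (1/16)" "Q powr (1/32) \<le> real z"
    proof -
      have "0 \<le> Q powr (1/16)" by simp
      then show "real z \<le> Q powr (1/16)" "Q powr (1/32) \<le> real z"
        unfolding z_def using elim(4) by linarith+
    qed
    have z2: "z \<ge> 2" using z(2) elim(7) by linarith
    have lz: "ln Q / 32 \<le> ln (real z)"
    proof -
      have "ln Q / 32 = ln (Q powr (1/32))" using Q2 by (simp add: ln_powr)
      also have "\<dots> \<le> ln (real z)"
        by (subst ln_le_cancel_iff) (use z(2) Q2 z2 in auto)
      finally show ?thesis .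
    qed
    have mod: "2 ^ (A * D ^ (M + L)) \<le> Q powr (1/8)"
    proof -
      have "2 ^ (A * D ^ (M + L)) \<le> exp (ln Q / 8)"
        by (rule modulus_bound[OF q(2) D LM Ml(1) _ elim(10)]) (use elim(8) in \<open>simp add: l_def\<close>)
      also have "\<dots> = Q powr (1/8)" using Q2 by (simp add: powr_def)
      finally show ?thesis .
    qed
    have "P Q \<le> 16 * real C * (Q + 2) / (real L * ln z) + 8 * real z ^ 6 / (ln z)\<^sup>2 * (2 ^ (A * D ^ (M + L)))\<^sup>2"
    proof (rule P)
      show "n0 \<le> M" using M by simp
      show "C * D ^ (2 * L + 2) < 2 ^ (M - n0)" unfolding L_def by (rule pow_orbit_condition[OF q M(1)])
      show "real z + 2 < Q" using z(1) elim(5) by linarith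
      show "2 ^ (A * D ^ (M + L)) < Q" using mod elim(6) by linarith
    qed (rule L1 z2)+
    also have "16 * real C * (Q + 2) / (real L * ln z) \<le> 16 * real C * (2 * Q) / (l / (16 * real q) * (ln Q / 32))"
      using Q2 Lq lz l0 lQ q(1) by (intro frac_le mult_mono mult_pos_pos) auto
    also have "\<dots> = K * (Q / (l * ln Q))"
      using q(1) l0 lQ by (simp add: K_def field_simps)
    also have "8 * real z ^ 6 / (ln z)\<^sup>2 * (2 ^ (A * D ^ (M + L)))\<^sup>2 \<le>
      8 * (Q powr (1/16)) ^ 6 / (ln Q / 32)\<^sup>2 * (Q powr (1/8))\<^sup>2"
      using z(1) lz lQ mod by (intro mult_mono frac_le power_mono) auto
    also have "\<dots> = 8192 * Q powr (5/8) / (ln Q)\<^sup>2"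
    proof -
      have "(Q powr (1/16)) ^ 6 = Q powr (3/8)" "(Q powr (1/8))\<^sup>2 = Q powr (1/4)"
        using Q2 by (simp_all add: powr_powr flip: powr_realpow)
      moreover have "Q powr (3/8) * Q powr (1/4) = Q powr (5/8)" by (simp flip: powr_add)
      ultimately show ?thesis by (simp add: power_divide mult_ac)
    qed
    also have "\<dots> \<le> 1 * (Q / (l * ln Q))" using elim(3) by (simp add: l_def)
    finally have "P Q \<le> (K + 1) * (Q / (l * ln Q))" by (simp only: distrib_right)
    also have "\<dots> \<le> (ln l)\<^sup>2 * (Q / (l * ln Q))"
      using elim(2) Q2 l0 lQ by (intro mult_right_mono) (auto simp: l_def)
    also have "\<dots> = ln l powr 2 / l * (Q / ln Q)"
      using elim(9) by (simp add: l_def powr_realpow[of _ 2, simplified])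
    finally show ?case by (simp add: l_def)
  qed
qed

theorem theorem1p2:
  fixes f g :: "int poly" and a b :: int
  assumes "pderiv f = g ^ 2 * [:b, a:]"
    and "a \<noteq> 0"
    and "\<not> preperiodic (map_poly of_int f :: rat poly) (- of_int b / of_int a)"
  shows "\<exists>\<epsilon>. \<epsilon> \<in> o[at_top](\<lambda>_. 1) \<and>
    (\<forall>\<^sub>F Q::real in at_top.
       real (dyn_irred_prime_count f Q) \<le>
         ln (ln (ln (ln Q))) powr (2 + \<epsilon> Q) / ln (ln (ln Q)) * (Q / ln Q))"
proof (intro exI[of _ "\<lambda>_. 0"] conjI)
  \<comment> \<open>The exponent 2 alone leaves room for the constant, so the zero function is taken
    for \<open>\<epsilon>\<close>.\<close>
  show "(\<lambda>_. 0) \<in> o[at_top](\<lambda>_. 1)" by simp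
  show "\<forall>\<^sub>F Q::real in at_top. real (dyn_irred_prime_count f Q) \<le>
         ln (ln (ln (ln Q))) powr (2 + 0) / ln (ln (ln Q)) * (Q / ln Q)"
  \<comment> \<open>One prime beyond the absolute value of \<open>2 * a * lead_coeff f\<close> with
    dynamically irreducible reduction is the input of \<open>count_bound\<close>; without such a
    prime the count is 0 for large \<open>Q\<close>.\<close>
  proof (cases "\<exists>p. prime p \<and> p > nat \<bar>2 * a * lead_coeff f\<bar> \<and>
       dynamically_irreducible (residue_ring (int p)) (reduce_poly (int p) f)")
    case True
    show ?thesis
    proof (rule count_bound[OF assms True])
      fix C A n0 :: nat
      assume "\<And>M L z Q. n0 \<le> M \<Longrightarrow> C * Suc (degree f) ^ (2 * L + 2) < 2 ^ (M - n0) \<Longrightarrow> L \<ge> 1 \<Longrightarrow> z \<ge> 2 \<Longrightarrow>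
         real z + 2 < Q \<Longrightarrow> 2 ^ (A * Suc (degree f) ^ (M + L)) < Q \<Longrightarrow>
         real (dyn_irred_prime_count f Q) \<le>
           16 * real C * (Q + 2) / (real L * ln z) + 8 * real z ^ 6 / (ln z)\<^sup>2 * (2 ^ (A * Suc (degree f) ^ (M + L)))\<^sup>2"
      from eventually_count_bound[where P = "\<lambda>Q. real (dyn_irred_prime_count f Q)", OF _ this]
      show ?thesis by simp
    qed
  next
    case False
    have "\<forall>\<^sub>F Q::real in at_top. ln (ln (ln Q)) > 0" by real_asymp
    moreover have "\<forall>\<^sub>F Q::real in at_top. Q > max 2 (real (nat \<bar>2 * a * lead_coeff f\<bar>))"
      by (rule eventually_gt_at_top)
    ultimately show ?thesis
    proof eventually_elim
      case (elim Q)
      have "{p::nat. prime p \<and> real p \<in> {Q..2 * Q} \<and>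
         dynamically_irreducible (residue_ring (int p)) (reduce_poly (int p) f)} = {}"
      proof (rule equals0I)
        fix p
        assume p: "p \<in> {p::nat. prime p \<and> real p \<in> {Q..2 * Q} \<and>
           dynamically_irreducible (residue_ring (int p)) (reduce_poly (int p) f)}"
        have "real p > real (nat \<bar>2 * a * lead_coeff f\<bar>)" using p elim(2) by simp
        then have "p > nat \<bar>2 * a * lead_coeff f\<bar>" by (simp only: of_nat_less_iff)
        then show False using False p by blast
      qed
      then have "dyn_irred_prime_count f Q = 0" unfolding dyn_irred_prime_count_def by (simp only: card.empty)
      then show ?case using elim by simp
    qed
  qed
qed

end
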